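(* Let $f$ be analytically extendable into $\boldsymbol\Sigma(\boldsymbol\tau)$ for an isotone (nondecreasing) sequence $\boldsymbol\tau=\{\tau_n\}_{n\ge 1}$ with $\tau_n\to\infty$, and assume $\tau_n\ge c\,n^{r}$ for all $n\ge1$ with some $r>1$ and some constant $c>0$ (so that $\{\tau_n^{-1}\}_n$ is summable). Let the numbers of points of the univariate Gauss-Legendre quadratures be $N_j=\lceil\tfrac12(j+2)\rceil$, let $\kappa_n=\tau_n+\sqrt{1+\tau_n^2}$, and let the weight vector $\mathbf w$ be given by $w_n=\log(\kappa_n)$. Then, for each $\delta>0$, there exists a constant $c(\delta)$ independent of $m$ such that the error of the anisotropic sparse grid quadrature of level $q$ is bounded by \[ \big|\big(\mathbf I-\mathcal A_{\mathbf w}(q,m)\big)f_m\big|\le c(\delta,\boldsymbol\tau)\,e^{-q(1-\delta)}\,\|f_m\|_{C(\boldsymbol\Sigma_m)} \qquad\text{with}\qquad c(\delta,\boldsymbol\tau)=4\,c(\delta)\,\big\|\{\tau_n^{-1}\}_n\big\|_{\ell^1}, \] where $c(\delta)$ denotes the constant, independent of $q\ge1$, in the estimate \[ \prod_{n=1}^\infty(q\psi_n+1)\le c(\delta)\exp(\delta q)\quad\text{for } q\ge1 \] with respect to the summable sequence $\psi_n=\tau_n^{-1}$ (such a constant exists for every $\delta>0$ and every summable sequence $\{\psi_n\}_n$ of positive real numbers). The constant $c(\delta,\boldsymbol\tau)$ tends to infinity as $\delta$ tends to $0$.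
   Context: Here $\mathbb N=\{0,1,2,\ldots\}$, $\Gamma=[-1,1]$, and $m\ge1$ is the integer dimension. Analyticity. For $\tau>0$ let $\Sigma(\Gamma,\tau)=\{z\in\mathbb C:\operatorname{dist}(z,\Gamma)\le\tau\}$. Given $\boldsymbol\tau=\{\tau_n\}_{n\ge1}$, put $\Sigma_n=\Sigma(\Gamma,\tau_n)$, $\boldsymbol\Sigma(\boldsymbol\tau)=\prod_{n=1}^\infty\Sigma_n$ and $\boldsymbol\Sigma_m=\prod_{n=1}^m\Sigma_n$. The integrand $f:\Gamma^\infty\to\mathbb R$ is integrable with respect to the product of the normalized Lebesgue measures $dy/2$ on $\Gamma$. Given a fixed anchor point $\overline{\boldsymbol\psi}\in\Gamma^\infty$, let $f_m(y_1,\ldots,y_m)=f(y_1,\ldots,y_m,\overline\psi_{m+1},\overline\psi_{m+2},\ldots)$. If $f$ is analytically extendable into $\boldsymbol\Sigma(\boldsymbol\tau)$, then $f_m$ is analytically extendable into $\boldsymbol\Sigma_m$; the extension is also denoted $f_m$, and $\|f_m\|_{C(\boldsymbol\Sigma_m)}=\sup_{\mathbf z\in\boldsymbol\Sigma_m}|f_m(\mathbf z)|$. Integral. $\mathbf I f_m=\int_{\Gamma^m}f_m(\mathbf y)\,2^{-m}\,d\mathbf y$. Quadrature. For $j\in\mathbb N$, $\operatorname Q_j$ denotes the $N_j$-point Gauss-Legendre quadrature on $\Gamma$ for the measure $dy/2$ (weights summing to $1$). Put $\operatorname Q_{-1}=0$ and $\Delta_j=\operatorname Q_j-\operatorname Q_{j-1}$.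 A superscript $(n)$ indicates that an operator acts on the $n$-th variable. For a weight vector $\mathbf w=(w_1,\ldots,w_m)$ with positive, ascendingly ordered entries and a level $q\in\mathbb N$, let \[ X_{\mathbf w}(q,m)=\Big\{\boldsymbol\alpha\in\mathbb N^m:\sum_{n=1}^m\alpha_nw_n\le q\Big\}. \] The anisotropic sparse grid quadrature of level $q$ is \[ \mathcal A_{\mathbf w}(q,m)=\sum_{\boldsymbol\alpha\in X_{\mathbf w}(q,m)}\Delta^{(1)}_{\alpha_1}\otimes\cdots\otimes\Delta^{(m)}_{\alpha_m}. \] *)

theory Defs
  imports
    "HOL-Probability.Probability"
    "HOL-Computational_Algebra.Polynomial"
begin

text \<open>
  Variables are numbered from 1, as in the sequences $\tau_1, \tau_2, \ldots$.  Points of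
  $\Gamma^\infty$ and $\Gamma^m$ are elements of the extensional function spaces over
  \<^term>\<open>{1..} :: nat set\<close> and \<^term>\<open>{1..m :: nat}\<close>.
\<close>

abbreviation \<Gamma> :: "real set" where
  "\<Gamma> \<equiv> {-1..1}"

text \<open>
  The measure $dy/2$ on $\Gamma$.  Its underlying space is $\Gamma$ itself, so integrability with
  respect to (products of) it says nothing about values outside $\Gamma$.
\<close>

definition \<Gamma>_measure :: "real measure" where
  "\<Gamma>_measure = uniform_measure (restrict_space lborel \<Gamma>) \<Gamma>"


section \<open>Analytic extension\<close>

definition \<Sigma>_nbhd :: "real \<Rightarrow> complex set" where
  "\<Sigma>_nbhd t = {z. infdist z (complex_of_real ` \<Gamma>) \<le> t}"

text \<open>
  Analyticity on the product of the sets \<open>S n\<close> (\<open>n \<in> J\<close>): with respect to every finite set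
  \<open>I\<close> of variables jointly, \<open>F\<close> has around every point of the product a convergent power series
  expansion in an open polydisc.  For finite \<open>J\<close> this is analyticity on (a neighbourhood of) the
  product, like \<^const>\<open>analytic_on\<close>; for infinite \<open>J\<close> nothing is
  required beyond analyticity in finitely many variables.
\<close>

definition analytic_on_prod ::
    "nat set \<Rightarrow> (nat \<Rightarrow> complex set) \<Rightarrow> ((nat \<Rightarrow> complex) \<Rightarrow> complex) \<Rightarrow> bool" where
  "analytic_on_prod J S F \<longleftrightarrow>
     (\<forall>z \<in> PiE J S. \<forall>I. finite I \<and> I \<subseteq> J \<longrightarrow>
        (\<exists>\<epsilon>>0. \<exists>a :: (nat \<Rightarrow> nat) \<Rightarrow> complex. \<forall>h :: nat \<Rightarrow> complex.
           (\<forall>n\<in>I. cmod (h n) < \<epsilon>) \<longrightarrow>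
             ((\<lambda>\<nu>. a \<nu> * (\<Prod>n\<in>I. h n ^ \<nu> n)) has_sum
                F (\<lambda>n. if n \<in> I then z n + h n else z n)) (PiE I (\<lambda>_. UNIV))))"

definition analytic_extension ::
    "((nat \<Rightarrow> real) \<Rightarrow> real) \<Rightarrow> (nat \<Rightarrow> real) \<Rightarrow> ((nat \<Rightarrow> complex) \<Rightarrow> complex) \<Rightarrow> bool" where
  "analytic_extension f \<tau> F \<longleftrightarrow>
     analytic_on_prod {1..} (\<lambda>n. \<Sigma>_nbhd (\<tau> n)) F \<and>
     (\<forall>y \<in> PiE {1..} (\<lambda>_. \<Gamma>).
        F (restrict (\<lambda>n. complex_of_real (y n)) {1..}) = complex_of_real (f y))"

text \<open>
  Applied to the integrand and an anchor in $\Gamma^\infty$ this is $f_m$; applied to the extension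
  of the integrand and the same (complexified) anchor it is the extension of $f_m$.
\<close>

definition anchored :: "nat \<Rightarrow> (nat \<Rightarrow> 'a) \<Rightarrow> ((nat \<Rightarrow> 'a) \<Rightarrow> 'b) \<Rightarrow> (nat \<Rightarrow> 'a) \<Rightarrow> 'b" where
  "anchored m \<psi> f y = f (restrict (\<lambda>n. if n \<le> m then y n else \<psi> n) {1..})"

definition sup_norm :: "nat \<Rightarrow> (nat \<Rightarrow> real) \<Rightarrow> ((nat \<Rightarrow> complex) \<Rightarrow> complex) \<Rightarrow> real" where
  "sup_norm m \<tau> g = (SUP z \<in> PiE {1..m} (\<lambda>n. \<Sigma>_nbhd (\<tau> n)). cmod (g z))"


section \<open>Integral and quadrature\<close>

definition integral_m :: "nat \<Rightarrow> ((nat \<Rightarrow> real) \<Rightarrow> real) \<Rightarrow> real" where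
  "integral_m m g = (LINT y | PiM {1..m} (\<lambda>_. \<Gamma>_measure). g y)"

text \<open>Rodrigues' formula.\<close>

definition legendre :: "nat \<Rightarrow> real poly" where
  "legendre n = smult (1 / (2 ^ n * fact n)) ((pderiv ^^ n) ([:-1, 0, 1:] ^ n))"

definition gauss_nodes :: "nat \<Rightarrow> real set" where
  "gauss_nodes N = {x. poly (legendre N) x = 0}"

text \<open>The interpolatory weights: integrals of the Lagrange basis polynomials.\<close>

definition gauss_weight :: "nat \<Rightarrow> real \<Rightarrow> real" where
  "gauss_weight N x = (LINT t | \<Gamma>_measure. (\<Prod>y \<in> gauss_nodes N - {x}. (t - y) / (x - y)))"

definition gauss_legendre :: "nat \<Rightarrow> (real \<Rightarrow> real) \<Rightarrow> real" where
  "gauss_legendre N g = (\<Sum>x \<in> gauss_nodes N. gauss_weight N x * g x)"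

definition num_points :: "nat \<Rightarrow> nat" where
  "num_points j = nat \<lceil>(1/2) * (real j + 2)\<rceil>"

definition Quad :: "nat \<Rightarrow> (real \<Rightarrow> real) \<Rightarrow> real" where
  "Quad j = gauss_legendre (num_points j)"

definition Quad_diff :: "nat \<Rightarrow> (real \<Rightarrow> real) \<Rightarrow> real" where
  "Quad_diff j g = Quad j g - (if j = 0 then 0 else Quad (j - 1) g)"

text \<open>
  $U_1^{(1)} \otimes \cdots \otimes U_m^{(m)}$ for univariate functionals: \<open>U n\<close> acts on the
  \<open>n\<close>-th variable.
\<close>

fun tensor :: "(nat \<Rightarrow> (real \<Rightarrow> real) \<Rightarrow> real) \<Rightarrow> nat \<Rightarrow> ((nat \<Rightarrow> real) \<Rightarrow> real) \<Rightarrow> real" where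
  "tensor U 0 g = g (\<lambda>_. undefined)"
| "tensor U (Suc m) g = tensor U m (\<lambda>y. U (Suc m) (\<lambda>x. g (y(Suc m := x))))"

definition index_set :: "(nat \<Rightarrow> real) \<Rightarrow> nat \<Rightarrow> nat \<Rightarrow> (nat \<Rightarrow> nat) set" where
  "index_set w q m = {\<alpha> \<in> PiE {1..m} (\<lambda>_. UNIV). (\<Sum>n=1..m. real (\<alpha> n) * w n) \<le> real q}"

definition sparse_grid :: "(nat \<Rightarrow> real) \<Rightarrow> nat \<Rightarrow> nat \<Rightarrow> ((nat \<Rightarrow> real) \<Rightarrow> real) \<Rightarrow> real" where
  "sparse_grid w q m g = (\<Sum>\<alpha> \<in> index_set w q m. tensor (\<lambda>n. Quad_diff (\<alpha> n)) m g)"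


section \<open>Weights and constants\<close>

definition kappa :: "(nat \<Rightarrow> real) \<Rightarrow> nat \<Rightarrow> real" where
  "kappa \<tau> n = \<tau> n + sqrt (1 + (\<tau> n)\<^sup>2)"

definition weight :: "(nat \<Rightarrow> real) \<Rightarrow> nat \<Rightarrow> real" where
  "weight \<tau> n = ln (kappa \<tau> n)"

definition l1_norm :: "(nat \<Rightarrow> real) \<Rightarrow> real" where
  "l1_norm \<psi> = (\<Sum>\<^sub>\<infinity>n\<in>{1..}. \<bar>\<psi> n\<bar>)"

text \<open>\<open>C\<close> is an admissible constant $c(\delta)$ for the sequence $\psi_1, \psi_2, \ldots$\<close>

definition product_estimate :: "(nat \<Rightarrow> real) \<Rightarrow> real \<Rightarrow> real \<Rightarrow> bool" where
  "product_estimate \<psi> \<delta> C \<longleftrightarrow>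
     (\<forall>q::nat. q \<ge> 1 \<longrightarrow> (\<Prod>n. real q * \<psi> (Suc n) + 1) \<le> C * exp (\<delta> * real q))"

end

theory Submission
  imports Defs "HOL-Complex_Analysis.Complex_Analysis"
begin

text \<open>
  Write $x_n = 1/\tau_n$.  Telescoping over the variables expresses the error as a sum over $n$ of
  $\sum_{\alpha \in X_w(q,n-1)} \Delta_\alpha \otimes (I - Q_j)^{(n)}$, where $j$ is the largest level that
  is still admissible in direction $n$.  Odd functions are annihilated by $I - Q_j$ and $\Delta_j$, and so
  are polynomials of degree at most $j + 1$ and $j$, respectively.  Hence the Chebyshev expansion on the Bernstein ellipse of radius
  $\kappa_n$ bounds the first by $2 x_n \kappa_n^{-j-1}$ and the second by $2 x_n \kappa_n^{-j}$.  This yields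
  the factor $e^{-q}$ in every term, and it remains to show
  $\sum_{\alpha \in X_w(q,m)} \prod_n c_n(\alpha_n) \le 2 \prod_n (1 + q x_n)\,(1 + q \sum_n x_n)$
  for the normalized bounds $c_n$ of the $\Delta_{\alpha_n}$, since the right-hand sides telescope to
  $4\,\|x\|_1 \prod_n (1 + q x_n)$.

  Three points make this work without spurious constants.  Only odd levels contribute, because
  $N_{2i-1} = N_{2i}$.  For small $\tau_n$ the bound $2 x_n$ is too weak and is replaced by a
  bound independent of $\tau_n$, obtained by smoothing with Poisson kernels instead of truncating the
  Chebyshev series.  Finally, multi-indices with a given support are counted with the factor
  $1/s!$ of a simplex, $s$ being the size of the support.
\<close>

section \<open>Polynomial approximation of bounded Laurent sums\<close>

text \<open>Up to level q a direction has about q/(2 w_n) odd levels, so normalized differences of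
  size 2 x_n add up to about q x_n / w_n instead of q x_n: too much where w_n < 1, that is for small
  tau_n. This excess is kept as p_n = min(1/w_n, 43/10), with c_n = x_n (2 w_n) p_n. Estimating one
  direction after the other would lose the factor p_n each time. On a support of size s, however,
  the product of the p_n is at most v^s for their mean v, and the simplex count, of order 1/s!,
  brings it down to 2 (1 + 2s/3 + s v). As p_n <= x_n + 1/3, this is at most 2 (1 + sum (1 + q
  x_n)), a weight whose sum over all supports has a closed form, with only the extra factor 1 + q
  sum x_n. The cap 43/10 lies in a narrow window: the smoothing estimate would fail with 4.25, and
  the inequality for s = 3 fails with 4.33. Joint analyticity enters in two ways: it makes the sup
  norm finite, and it gives holomorphy in each variable separately.\<close>

lemma norm_le_if_Re_le:
  fixes s :: complex
  assumes "\<And>c. cmod c = 1 \<Longrightarrow> Re (c * s) \<le> M"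
  shows "cmod s \<le> M"
proof (cases "s = 0")
  case True
  then show ?thesis using assms[of 1] by simp
next
  case False
  have "cnj s / cmod s * s = of_real (cmod s)"
    using False by (simp add: complex_norm_square[symmetric] power2_eq_square field_simps)
  then show ?thesis
    using assms[of "cnj s / cmod s"] False by (simp add: norm_divide)
qed

text \<open>Damping the k-th coefficient by r^|k| is convolution with the Poisson kernel, which is
  positive with mass 1 and hence a contraction for the sup norm. The proof avoids the kernel: it
  realizes the real part as a harmonic function on the disc and applies the maximum
  principle.\<close>

lemma poisson_contraction:
  fixes b :: "int \<Rightarrow> complex"
  assumes "finite K"
    and bound: "\<And>z. cmod z = 1 \<Longrightarrow> cmod (\<Sum>k\<in>K. b k * z powi k) \<le> M"
    and r: "0 \<le> r" "r \<le> 1" and z: "cmod z = 1"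
  shows "cmod (\<Sum>k\<in>K. b k * of_real (r ^ nat \<bar>k\<bar>) * z powi k) \<le> M"
proof (rule norm_le_if_Re_le)
  fix c :: complex assume c: "cmod c = 1"
  \<comment> \<open>Conjugation folds the negative frequencies onto positive ones without changing
    real parts, so \<open>A\<close> is a polynomial in w whose real part at radius s is that of c
    times the damped sum.\<close>
  define A where "A = (\<lambda>w. \<Sum>k\<in>K. (if k \<ge> 0 then c * b k else cnj (c * b k)) * w ^ nat \<bar>k\<bar>)"
  have Re_A: "Re (A (of_real s * x)) = Re (c * (\<Sum>k\<in>K. b k * of_real (s ^ nat \<bar>k\<bar>) * x powi k))"
    if x: "cmod x = 1" for s x
  proof -
    have "Re ((if k \<ge> 0 then c * b k else cnj (c * b k)) * (of_real s * x) ^ nat \<bar>k\<bar>)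
        = Re (c * (b k * of_real (s ^ nat \<bar>k\<bar>) * x powi k))" for k
    proof (cases "k \<ge> 0")
      case True
      then show ?thesis by (simp add: power_int_def power_mult_distrib mult_ac)
    next
      case False
      have "inverse x = cnj x"
        using x by (simp add: inverse_complex_def complex_eq_iff cmod_def)
      then have "cnj (cnj (c * b k) * (of_real s * x) ^ nat \<bar>k\<bar>) = c * (b k * of_real (s ^ nat \<bar>k\<bar>) * x powi k)"
        using False by (simp add: power_int_def power_mult_distrib mult_ac)
      from arg_cong[OF this, of Re] show ?thesis
        using False by (simp only: cnj.sel(1) if_False)
    qed
    then show ?thesis
      by (simp add: A_def Re_sum sum_distrib_left)
  qed
  \<comment> \<open>Taking exp turns the maximum principle for the harmonic function Re A into the
    maximum modulus principle.\<close>
  have "cmod (exp (A (of_real r * z))) \<le> exp M"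
  proof (rule maximum_modulus_frontier[where S = "cball 0 1" and f = "\<lambda>w. exp (A w)"])
    show "(\<lambda>w. exp (A w)) holomorphic_on interior (cball 0 1)" "continuous_on (closure (cball 0 1)) (\<lambda>w. exp (A w))"
      unfolding A_def by (auto intro!: holomorphic_intros continuous_intros)
    show "bounded (cball 0 1 :: complex set)" by simp
    show "of_real r * z \<in> cball 0 1"
      using r z by (simp add: norm_mult)
    fix x :: complex assume "x \<in> frontier (cball 0 1)"
    then have x: "cmod x = 1" by simp
    have "Re (A x) \<le> M"
      using Re_A[OF x, of 1] bound[OF x] c complex_Re_le_cmod[of "c * (\<Sum>k\<in>K. b k * x powi k)"]
      by (simp add: norm_mult)
    then show "cmod (exp (A x)) \<le> exp M" by simp
  qed
  then show "Re (c * (\<Sum>k\<in>K. b k * of_real (r ^ nat \<bar>k\<bar>) * z powi k)) \<le> M"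
    using Re_A[OF z, of r] by simp
qed

section \<open>Chebyshev polynomials\<close>

fun chebyshev :: "nat \<Rightarrow> real poly" where
  "chebyshev 0 = 1"
| "chebyshev (Suc 0) = [:0, 1:]"
| "chebyshev (Suc (Suc n)) = [:0, 2:] * chebyshev (Suc n) - chebyshev n"

lemma poly_chebyshev_cos: "poly (chebyshev n) (cos t) = cos (real n * t)"
proof (induction n rule: chebyshev.induct)
  case (3 n)
  have "cos (real (Suc (Suc n)) * t) + cos (real n * t) = 2 * cos t * cos (real (Suc n) * t)"
    using cos_plus_cos[of "real (Suc (Suc n)) * t" "real n * t"]
    by (simp add: algebra_simps add_divide_distrib)
  then show ?case using 3 by simp
qed auto

lemma degree_chebyshev: "degree (chebyshev n) \<le> n"
proof (induction n rule: chebyshev.induct)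
  case (3 n)
  have "degree ([:0, 2:] * chebyshev (Suc n)) \<le> Suc (Suc n)"
    using degree_mult_le[of "[:0, 2:]" "chebyshev (Suc n)"] 3(1) by simp
  then show ?case
    using degree_diff_le[of "[:0, 2:] * chebyshev (Suc n)" "Suc (Suc n)" "chebyshev n"] 3(2) by simp
qed auto

lemma degree_smult_chebyshev: "j < n \<Longrightarrow> degree (smult c (chebyshev j)) \<le> n - 1"
  by (rule order_trans[OF degree_smult_le], rule order_trans[OF degree_chebyshev]) simp

lemma poly_chebyshev_minus: "poly (chebyshev n) (- x) = (-1) ^ n * poly (chebyshev n) x"
  by (induction n rule: chebyshev.induct) (auto simp: algebra_simps)

lemma poly_chebyshev_bound:
  assumes "\<bar>x\<bar> \<le> 1"
  shows "\<bar>poly (chebyshev n) x\<bar> \<le> 1"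
  using poly_chebyshev_cos[of n "arccos x"] assms by (simp add: abs_le_iff)

text \<open>Multiplication by z^m changes no modulus on the unit circle, but moves frequency k to k
  + m, where the damping is then applied.\<close>

lemma poisson_contraction_shift:
  fixes b :: "int \<Rightarrow> complex"
  assumes K: "finite K"
    and bound: "\<And>z. cmod z = 1 \<Longrightarrow> cmod (\<Sum>k\<in>K. b k * z powi k) \<le> M"
    and r: "0 \<le> r" "r \<le> 1" and z: "cmod z = 1"
  shows "cmod (\<Sum>k\<in>K. b k * of_real (r ^ nat \<bar>k + m\<bar>) * z powi k) \<le> M"
proof -
  have shift: "(\<Sum>k\<in>(\<lambda>k. k + m) ` K. b (k - m) * c k * x powi k) = x powi m * (\<Sum>k\<in>K. b k * c (k + m) * x powi k)"
    if "cmod x = 1" for c and x :: complex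
  proof -
    have "x \<noteq> 0" using that by auto
    then show ?thesis
      by (subst sum.reindex) (auto simp: power_int_add sum_distrib_left mult_ac)
  qed
  have "cmod (\<Sum>k\<in>(\<lambda>k. k + m) ` K. b (k - m) * of_real (r ^ nat \<bar>k\<bar>) * z powi k) \<le> M"
  proof (rule poisson_contraction[OF _ _ r z])
    fix x :: complex assume x: "cmod x = 1"
    show "cmod (\<Sum>k\<in>(\<lambda>k. k + m) ` K. b (k - m) * x powi k) \<le> M"
      using shift[OF x, of "\<lambda>_. 1"] bound[OF x] x by (simp add: norm_mult norm_power_int)
  qed (use K in auto)
  then show ?thesis
    using shift[OF z, of "\<lambda>k. of_real (r ^ nat \<bar>k\<bar>)"] z by (simp add: norm_mult norm_power_int)
qed

section \<open>Symmetric Laurent sums and their polynomial approximation\<close>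

definition laurent_sum :: "nat \<Rightarrow> (nat \<Rightarrow> complex) \<Rightarrow> complex \<Rightarrow> complex" where
  "laurent_sum N a w = (\<Sum>k\<in>{- int N..int N}. a (nat \<bar>k\<bar>) * w powi k)"

lemma sum_int_reflect: "(\<Sum>k\<in>{- int N..int N}. g (- k)) = (\<Sum>k\<in>{- int N..int N}. g k)"
  by (rule sum.reindex_bij_witness[where i = uminus and j = uminus]) auto

text \<open>The coefficients depend on |k| only, so the sine parts of k and -k cancel. The remaining
  cosine sum is a polynomial in cos t, which is how estimates on circles become polynomial
  approximations on the interval.\<close>

lemma Re_even_laurent:
  fixes c :: "nat \<Rightarrow> complex"
  shows "Re (laurent_sum N c (cis t)) = (\<Sum>k\<in>{- int N..int N}. Re (c (nat \<bar>k\<bar>)) * poly (chebyshev (nat \<bar>k\<bar>)) (cos t))"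
proof -
  have "cos (real (nat \<bar>k\<bar>) * t) = cos (of_int k * t)" for k
    by (cases "k \<ge> 0") auto
  moreover have "(\<Sum>k\<in>{- int N..int N}. Im (c (nat \<bar>k\<bar>)) * sin (of_int k * t)) = 0"
    using sum_int_reflect[of "\<lambda>k. Im (c (nat \<bar>k\<bar>)) * sin (of_int k * t)" N] by (simp add: sum_negf)
  ultimately show ?thesis
    by (simp add: laurent_sum_def poly_chebyshev_cos cis_power_int Re_sum sum_subtractf)
qed

lemma laurent_sum_inverse: "laurent_sum N a (inverse w) = laurent_sum N a w"
  using sum_int_reflect[of "\<lambda>k. a (nat \<bar>k\<bar>) * w powi k" N]
  by (simp add: laurent_sum_def power_int_minus power_int_inverse)

text \<open>With y = r^n, this is 2 \<open>C1\<close> + 2 \<open>C2\<close> for the weights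
  \<open>C1\<close>, \<open>C2\<close> of the two smoothings in the next proof: each smoothing
  applies two shifted Poisson kernels to values bounded by M.\<close>

abbreviation smooth_rate :: "real \<Rightarrow> real" where
  "smooth_rate y \<equiv> 4 * y / (1 + y\<^sup>2) + 2 * y\<^sup>2 / (1 + y ^ 4)"

text \<open>
  The coefficients $a_k$ with $|k| \ge n$ are written as $a_k (1 + r^{2|k|}) - a_k r^{2|k|}$, where $r = 1/\rho$.
  Up to coefficients of lower index, the first part is a Poisson smoothing of the values on the circle of
  radius $\rho$, and the second one of those on the unit circle.  Multiplication of the Poisson kernel by
  $\cos (n t)$ shifts its coefficients.
\<close>
lemma laurent_sum_smooth_bound:
  fixes a :: "nat \<Rightarrow> complex" and \<rho> :: real and n :: nat
  assumes bound: "\<And>w. 1 \<le> cmod w \<Longrightarrow> cmod w \<le> \<rho> \<Longrightarrow> cmod (laurent_sum N a w) \<le> M"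
    and \<rho>: "\<rho> > 1"
  defines "y \<equiv> 1 / \<rho> ^ n"
  obtains p where "p = 0 \<or> degree p < n"
    and "\<And>x. \<bar>x\<bar> \<le> 1 \<Longrightarrow> \<bar>Re (laurent_sum N a (cis (arccos x))) - poly p x\<bar> \<le> smooth_rate y * M"
proof -
  define r where "r = 1 / \<rho>"
  have r: "0 < r" "r < 1" using \<rho> by (auto simp: r_def)
  have y: "y = r ^ n" "y > 0" using r by (auto simp: y_def r_def power_divide)
  define K where "K = {- int N..int N}"
  \<comment> \<open>For |k| >= n the two shifts damp by r^|k-n| + r^|k+n| = r^|k| (1 + y^2)/y.
    \<open>C1\<close> is the factor that turns the damped coefficient \<open>b k\<close> into a_k (1
    + r^(2|k|)). \<open>C2\<close> does the same for a_k r^(2|k|), with r^2 and y^2 in place of r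
    and y.\<close>
  define C1 where "C1 = 2 * y / (1 + y\<^sup>2)"
  define C2 where "C2 = y\<^sup>2 / (1 + y ^ 4)"
  define b where "b k = a (nat \<bar>k\<bar>) * of_real ((\<rho> powi k + \<rho> powi (- k)) / 2)" for k
  define A where "A k = a (nat \<bar>k\<bar>)" for k :: int
  define s where "s q k = q ^ nat \<bar>k - int n\<bar> + q ^ nat \<bar>k + int n\<bar>" for q :: real and k :: int
  define d where "d k = of_real C1 * (b k * of_real (s r k)) - of_real C2 * (A k * of_real (s (r\<^sup>2) k))" for k
  define e where "e j = a j - d (int j)" for j
  have s_even: "s q (- k) = s q k" for q k
  proof -
    have "\<bar>- k - int n\<bar> = \<bar>k + int n\<bar>" "\<bar>- k + int n\<bar> = \<bar>k - int n\<bar>" by auto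
    then show ?thesis by (simp add: s_def)
  qed
  have d_even: "d \<bar>k\<bar> = d k" for k
  proof -
    have "b (- k) = b k" "A (- k) = A k" by (auto simp: b_def A_def add.commute)
    then have "d (- k) = d k" by (simp add: d_def s_even)
    then show ?thesis by (cases "k \<ge> 0") auto
  qed
  have e_high: "e j = 0" if nj: "n \<le> j" for j
  proof -
    obtain i where j: "j = n + i" using le_Suc_ex[OF nj] ..
    define X where "X = r ^ i"
    have X: "X > 0" using r by (simp add: X_def)
    have abs_simps: "nat \<bar>int j - int n\<bar> = i" "nat \<bar>int j + int n\<bar> = i + (n + n)"
      unfolding j by auto
    have s_eq: "s q (int j) = q ^ i + q ^ i * (q ^ n)\<^sup>2" for q
      unfolding s_def abs_simps by (simp only: power_add power2_eq_square)
    have "s r (int j) = X + X * y\<^sup>2"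
      unfolding s_eq X_def y(1) ..
    moreover have "s (r\<^sup>2) (int j) = X\<^sup>2 + X\<^sup>2 * y ^ 4"
      unfolding s_eq X_def y(1) by (simp add: power_mult[symmetric] mult.commute)
    moreover have "\<rho> powi (- int j) = X * y"
      unfolding X_def y(1) j r_def by (simp only: power_int_minus power_int_of_nat power_add inverse_mult_distrib)
        (simp add: power_divide inverse_eq_divide)
    moreover have "\<rho> powi int j = 1 / (X * y)"
      unfolding X_def y(1) j r_def by (simp only: power_int_of_nat power_add) (simp add: power_divide)
    ultimately have "d (int j) = a j * of_real (C1 * ((1 / (X * y) + X * y) / 2) * (X + X * y\<^sup>2) - C2 * (X\<^sup>2 + X\<^sup>2 * y ^ 4))"
      by (simp add: d_def b_def A_def algebra_simps)
    also have "C1 * ((1 / (X * y) + X * y) / 2) * (X + X * y\<^sup>2) = 1 + X\<^sup>2 * y\<^sup>2"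
    proof -
      have "1 + y\<^sup>2 \<noteq> 0" by (metis power_one sum_power2_eq_zero_iff zero_neq_one)
      then have "C1 * (X + X * y\<^sup>2) = 2 * y * X"
        unfolding C1_def by (simp add: divide_simps) algebra
      then have "(C1 * (X + X * y\<^sup>2)) * ((1 / (X * y) + X * y) / 2) = (2 * y * X) * ((1 / (X * y) + X * y) / 2)"
        by simp
      then have "C1 * ((1 / (X * y) + X * y) / 2) * (X + X * y\<^sup>2) = (1 / (X * y) + X * y) * (y * X)"
        by (simp only: mult.commute mult.left_commute mult.assoc times_divide_eq_left times_divide_eq_right) simp
      also have "\<dots> = 1 + X\<^sup>2 * y\<^sup>2"
        using X y(2) by (simp add: field_simps power2_eq_square)
      finally show ?thesis .
    qed
    also have "C2 * (X\<^sup>2 + X\<^sup>2 * y ^ 4) = X\<^sup>2 * y\<^sup>2"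
    proof -
      have "1 + y ^ 4 > 0" using y(2) by (simp add: add_pos_pos)
      then have "1 + y ^ 4 \<noteq> 0" by linarith
      then show ?thesis
        unfolding C2_def by (simp add: divide_simps) algebra
    qed
    finally show ?thesis by (simp add: e_def)
  qed
  have D: "cmod (\<Sum>k\<in>K. d k * z powi k) \<le> smooth_rate y * M"
    if z: "cmod z = 1" for z
  proof -
    have b_bound: "cmod (\<Sum>k\<in>K. b k * x powi k) \<le> M" if x: "cmod x = 1" for x
    proof -
      have x0: "x \<noteq> 0" using x by auto
      \<comment> \<open>By the symmetry under inversion, values on the circle of radius 1/rho are
        also values on that of radius rho, so the average of both is still bounded by M.\<close>
      have "(\<Sum>k\<in>K. b k * x powi k) = (laurent_sum N a (of_real \<rho> * x) + laurent_sum N a (of_real \<rho> * inverse x)) / 2"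
      proof -
        have "laurent_sum N a (of_real \<rho> * inverse x) = laurent_sum N a (inverse (of_real \<rho>) * x)"
          using laurent_sum_inverse[of N a "inverse (of_real \<rho>) * x"] by simp
        then show ?thesis
          unfolding laurent_sum_def K_def
          by (simp add: sum.distrib[symmetric] sum_divide_distrib b_def power_int_mult_distrib power_int_minus power_int_inverse
               algebra_simps add_divide_distrib)
      qed
      then have "cmod (\<Sum>k\<in>K. b k * x powi k) = cmod (laurent_sum N a (of_real \<rho> * x) + laurent_sum N a (of_real \<rho> * inverse x)) / 2"
        by (simp only: norm_divide norm_numeral)
      moreover have "cmod (laurent_sum N a (of_real \<rho> * x)) \<le> M" "cmod (laurent_sum N a (of_real \<rho> * inverse x)) \<le> M"
        using bound x \<rho> by (auto simp: norm_mult norm_inverse)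
      ultimately show ?thesis
        using norm_triangle_ineq[of "laurent_sum N a (of_real \<rho> * x)" "laurent_sum N a (of_real \<rho> * inverse x)"]
        by linarith
    qed
    have A_bound: "cmod (\<Sum>k\<in>K. A k * x powi k) \<le> M" if x: "cmod x = 1" for x
      using bound[of x] x \<rho> by (simp add: laurent_sum_def K_def A_def)
    have fin: "finite K" by (simp add: K_def)
    define P where "P g q = (\<Sum>k\<in>K. g k * of_real (s q k) * z powi k)" for g :: "int \<Rightarrow> complex" and q
    have P_bound: "cmod (P g q) \<le> 2 * M"
      if g: "\<And>x. cmod x = 1 \<Longrightarrow> cmod (\<Sum>k\<in>K. g k * x powi k) \<le> M" and q: "0 \<le> q" "q \<le> 1" for g q
    proof -
      have "P g q = (\<Sum>k\<in>K. g k * of_real (q ^ nat \<bar>k + - int n\<bar>) * z powi k) + (\<Sum>k\<in>K. g k * of_real (q ^ nat \<bar>k + int n\<bar>) * z powi k)"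
        by (simp add: P_def s_def sum.distrib[symmetric] algebra_simps)
      then show ?thesis
        using poisson_contraction_shift[OF fin g q z, of "- int n"] poisson_contraction_shift[OF fin g q z, of "int n"]
          norm_triangle_ineq[of "\<Sum>k\<in>K. g k * of_real (q ^ nat \<bar>k + - int n\<bar>) * z powi k"]
        by (smt (verit))
    qed
    have C_nonneg: "C1 \<ge> 0" "C2 \<ge> 0" using y(2) by (auto simp: C1_def C2_def)
    have "(\<Sum>k\<in>K. d k * z powi k) = of_real C1 * P b r - of_real C2 * P A (r\<^sup>2)"
      by (simp add: d_def P_def sum_distrib_left sum_subtractf algebra_simps)
    then have "cmod (\<Sum>k\<in>K. d k * z powi k) \<le> C1 * cmod (P b r) + C2 * cmod (P A (r\<^sup>2))"
      using norm_triangle_ineq4[of "of_real C1 * P b r" "of_real C2 * P A (r\<^sup>2)"] C_nonneg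
      by (simp add: norm_mult)
    also have "\<dots> \<le> C1 * (2 * M) + C2 * (2 * M)"
      using P_bound[OF b_bound, of r] P_bound[OF A_bound, of "r\<^sup>2"] r y(2)
      by (intro add_mono mult_left_mono) (auto simp: C1_def C2_def power_le_one)
    finally show ?thesis by (simp add: C1_def C2_def algebra_simps)
  qed
  \<comment> \<open>By \<open>e_high\<close>, nothing is lost by dropping the indices from n on. For
    n = 0 all terms are dropped, so that p is the zero polynomial.\<close>
  define p where "p = (\<Sum>k\<in>K. if nat \<bar>k\<bar> < n then smult (Re (e (nat \<bar>k\<bar>))) (chebyshev (nat \<bar>k\<bar>)) else 0)"
  show ?thesis
  proof
    show "p = 0 \<or> degree p < n"
    proof (cases "n = 0")
      case False
      have "degree p \<le> n - 1"
        unfolding p_def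
      proof (rule degree_sum_le)
        fix k
        show "degree (if nat \<bar>k\<bar> < n then smult (Re (e (nat \<bar>k\<bar>))) (chebyshev (nat \<bar>k\<bar>)) else 0) \<le> n - 1"
          using degree_smult_chebyshev[of "nat \<bar>k\<bar>" n] by simp
      qed (simp add: K_def)
      then show ?thesis using False by auto
    qed (simp add: p_def)
    fix x :: real assume x: "\<bar>x\<bar> \<le> 1"
    have "poly p x = (\<Sum>k\<in>K. Re (e (nat \<bar>k\<bar>)) * poly (chebyshev (nat \<bar>k\<bar>)) x)"
      unfolding p_def poly_sum by (intro sum.cong) (use e_high in auto)
    then have p: "poly p x = Re (laurent_sum N e (cis (arccos x)))"
      using x by (simp add: Re_even_laurent K_def abs_le_iff)
    have "laurent_sum N a z - laurent_sum N e z = (\<Sum>k\<in>K. d k * z powi k)" for z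
      by (simp add: laurent_sum_def e_def d_even K_def sum_subtractf[symmetric] algebra_simps)
    then have "\<bar>Re (laurent_sum N a (cis (arccos x))) - poly p x\<bar> = \<bar>Re (\<Sum>k\<in>K. d k * cis (arccos x) powi k)\<bar>"
      by (simp add: p flip: minus_complex.sel)
    also have "\<dots> \<le> cmod (\<Sum>k\<in>K. d k * cis (arccos x) powi k)" by (rule abs_Re_le_cmod)
    also have "\<dots> \<le> smooth_rate y * M" by (rule D) simp
    finally show "\<bar>Re (laurent_sum N a (cis (arccos x))) - poly p x\<bar> \<le> smooth_rate y * M" .
  qed
qed

text \<open>Truncation of the Chebyshev series, with the odd part of the tail moved into q because
  the functionals of interest annihilate odd functions. The even part decays with ratio 1/rho^2; as
  rho tends to kappa, this ratio is what produces the factor 1/tau through kappa - 1/kappa = 2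
  tau.\<close>

lemma laurent_sum_tail_bound:
  fixes a :: "nat \<Rightarrow> complex" and \<rho> :: real
  assumes coeff: "\<And>k. cmod (a k) \<le> M / \<rho> ^ k" and \<rho>: "\<rho> > 1" and "even n"
  obtains p q where "p = 0 \<or> degree p < n" "\<And>x. poly q (- x) = - poly q x"
    and "\<And>x. \<bar>x\<bar> \<le> 1 \<Longrightarrow> \<bar>Re (laurent_sum N a (cis (arccos x))) - poly p x - poly q x\<bar>
            \<le> 2 * M / (\<rho> ^ n * (1 - 1 / \<rho>\<^sup>2))"
proof -
  define K where "K = {- int N..int N}"
  have finite_K: "finite K" by (simp add: K_def)
  define t where "t k = smult (Re (a (nat \<bar>k\<bar>))) (chebyshev (nat \<bar>k\<bar>))" for k :: int
  define p where "p = (\<Sum>k\<in>K. if nat \<bar>k\<bar> < n then t k else 0)"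
  define q where "q = (\<Sum>k\<in>K. if n \<le> nat \<bar>k\<bar> \<and> odd k then t k else 0)"
  show ?thesis
  proof
    show "p = 0 \<or> degree p < n"
    proof (cases "n = 0")
      case False
      have "degree p \<le> n - 1"
        unfolding p_def
      proof (rule degree_sum_le)
        fix k
        show "degree (if nat \<bar>k\<bar> < n then t k else 0) \<le> n - 1"
          unfolding t_def using degree_smult_chebyshev[of "nat \<bar>k\<bar>" n] by simp
      qed (simp add: K_def)
      then show ?thesis using False by auto
    qed (simp add: p_def)
    show "poly q (- x) = - poly q x" for x
      unfolding q_def poly_sum sum_negf[symmetric] t_def
      by (intro sum.cong) (auto simp: poly_chebyshev_minus even_nat_iff)
    fix x :: real assume x: "\<bar>x\<bar> \<le> 1"
    have M: "M \<ge> 0" using order_trans[OF norm_ge_zero coeff[of 0]] by simp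
    define g where "g j = M / \<rho> ^ (n + 2 * j)" for j
    have "Re (laurent_sum N a (cis (arccos x))) - poly p x - poly q x
        = (\<Sum>k\<in>K. if n \<le> nat \<bar>k\<bar> \<and> even k then poly (t k) x else 0)"
      using x unfolding Re_even_laurent p_def q_def poly_sum K_def[symmetric] sum_subtractf[symmetric]
      by (intro sum.cong) (auto simp: t_def abs_le_iff)
    also have "\<bar>\<dots>\<bar> \<le> (\<Sum>k\<in>K. if n \<le> nat \<bar>k\<bar> \<and> even k then M / \<rho> ^ nat \<bar>k\<bar> else 0)"
    proof (rule order_trans[OF sum_abs], rule sum_mono)
      fix k
      have "\<bar>poly (t k) x\<bar> \<le> cmod (a (nat \<bar>k\<bar>)) * 1"
        unfolding t_def poly_smult abs_mult
        by (intro mult_mono abs_Re_le_cmod poly_chebyshev_bound x) auto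
      then show "\<bar>if n \<le> nat \<bar>k\<bar> \<and> even k then poly (t k) x else 0\<bar> \<le> (if n \<le> nat \<bar>k\<bar> \<and> even k then M / \<rho> ^ nat \<bar>k\<bar> else 0)"
        using coeff[of "nat \<bar>k\<bar>"] by auto
    qed
    also have "\<dots> = (\<Sum>k\<in>{k\<in>K. n \<le> nat \<bar>k\<bar> \<and> even k}. M / \<rho> ^ nat \<bar>k\<bar>)"
      by (rule sum.inter_filter[symmetric]) (simp add: K_def)
    \<comment> \<open>As n is even, every even |k| >= n has the form n + 2 j; b records the sign of
      k.\<close>
    also have "\<dots> \<le> (\<Sum>(b, j)\<in>(UNIV :: bool set) \<times> {..N}. g j)"
    proof (rule sum_le_included[where i = "\<lambda>(b, j). if b then int (n + 2 * j) else - int (n + 2 * j)"])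
      show "\<forall>k\<in>{k \<in> K. n \<le> nat \<bar>k\<bar> \<and> even k}. \<exists>bj\<in>UNIV \<times> {..N}.
          (case bj of (b, j) \<Rightarrow> if b then int (n + 2 * j) else - int (n + 2 * j)) = k \<and> M / \<rho> ^ nat \<bar>k\<bar> \<le> (case bj of (b, j) \<Rightarrow> g j)"
      proof
        fix k assume k: "k \<in> {k \<in> K. n \<le> nat \<bar>k\<bar> \<and> even k}"
        have "even (nat \<bar>k\<bar>)" using k by (auto simp: even_nat_iff)
        then have "even (nat \<bar>k\<bar> - n)" using \<open>even n\<close> k by auto
        then obtain j where "nat \<bar>k\<bar> - n = 2 * j" by (rule evenE)
        moreover have "n \<le> nat \<bar>k\<bar>" using k by blast
        ultimately have j: "nat \<bar>k\<bar> = n + 2 * j" by linarith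
        have "j \<le> N" using j k by (auto simp: K_def)
        then show "\<exists>bj\<in>UNIV \<times> {..N}. (case bj of (b, j) \<Rightarrow> if b then int (n + 2 * j) else - int (n + 2 * j)) = k \<and> M / \<rho> ^ nat \<bar>k\<bar> \<le> (case bj of (b, j) \<Rightarrow> g j)"
          using j by (intro bexI[of _ "(k \<ge> 0, j)"]) (auto simp: g_def)
      qed
    qed (use M \<rho> finite_K in \<open>auto simp: g_def\<close>)
    also have "\<dots> = 2 * (\<Sum>j\<le>N. g j)"
      by (simp add: sum.cartesian_product[symmetric] UNIV_bool)
    also have "(\<Sum>j\<le>N. g j) \<le> M / (\<rho> ^ n * (1 - 1 / \<rho>\<^sup>2))"
    proof -
      have q: "0 \<le> 1 / \<rho>\<^sup>2" "1 / \<rho>\<^sup>2 < 1" using \<rho> by (auto simp: one_less_power)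
      have "(\<Sum>j\<le>N. (1 / \<rho>\<^sup>2) ^ j) \<le> 1 / (1 - 1 / \<rho>\<^sup>2)"
        using sum_le_suminf[OF summable_geometric, of "1 / \<rho>\<^sup>2" "{..N}"] suminf_geometric[of "1 / \<rho>\<^sup>2"] q by simp
      then have "M / \<rho> ^ n * (\<Sum>j\<le>N. (1 / \<rho>\<^sup>2) ^ j) \<le> M / \<rho> ^ n * (1 / (1 - 1 / \<rho>\<^sup>2))"
        using M \<rho> by (intro mult_left_mono) auto
      moreover have "(\<Sum>j\<le>N. g j) = M / \<rho> ^ n * (\<Sum>j\<le>N. (1 / \<rho>\<^sup>2) ^ j)"
        by (simp add: g_def sum_distrib_left power_add power_mult power_divide)
      ultimately have "(\<Sum>j\<le>N. g j) \<le> M / \<rho> ^ n * (1 / (1 - 1 / \<rho>\<^sup>2))" by simp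
      then show ?thesis by simp
    qed
    finally show "\<bar>Re (laurent_sum N a (cis (arccos x))) - poly p x - poly q x\<bar> \<le> 2 * M / (\<rho> ^ n * (1 - 1 / \<rho>\<^sup>2))"
      by simp
  qed
qed

section \<open>Gauss-Legendre quadrature\<close>

lemma Gamma_measure_eq: "\<Gamma>_measure = density (restrict_space lborel \<Gamma>) (\<lambda>_. ennreal (1 / 2))"
proof -
  have em: "emeasure (restrict_space lborel \<Gamma>) \<Gamma> = 2"
    by (subst emeasure_restrict_space) auto
  show ?thesis
    unfolding \<Gamma>_measure_def uniform_measure_def em
  proof (rule density_cong)
    show "AE x in restrict_space lborel \<Gamma>. indicator \<Gamma> x / 2 = ennreal (1 / 2)"
      using divide_ennreal[of 1 2] by (intro AE_I2) simp
  qed (auto intro!: borel_measurable_divide_ennreal borel_measurable_indicator simp: sets_restrict_space_iff)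
qed

lemma space_Gamma_measure [simp]: "space \<Gamma>_measure = \<Gamma>"
  by (simp add: \<Gamma>_measure_def space_restrict_space)

lemma sets_Gamma_measure [measurable_cong]: "sets \<Gamma>_measure = sets (restrict_space borel \<Gamma>)"
  by (simp add: \<Gamma>_measure_def sets_restrict_space)

lemma prob_space_Gamma_measure: "prob_space \<Gamma>_measure"
  unfolding \<Gamma>_measure_def
  by (rule prob_space_uniform_measure; subst emeasure_restrict_space) auto

lemma continuous_on_Gamma_measurable:
  fixes g :: "real \<Rightarrow> real"
  shows "continuous_on \<Gamma> g \<Longrightarrow> g \<in> borel_measurable \<Gamma>_measure"
  using borel_measurable_continuous_on_restrict[of \<Gamma> g] by (simp add: measurable_cong_sets[OF sets_Gamma_measure refl])

lemma integrable_Gamma_measure: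
  fixes g :: "real \<Rightarrow> real"
  assumes "continuous_on \<Gamma> g"
  shows "integrable \<Gamma>_measure g"
proof -
  interpret prob_space \<Gamma>_measure by (rule prob_space_Gamma_measure)
  obtain B where "\<forall>x\<in>\<Gamma>. \<bar>g x\<bar> \<le> B"
    using compact_imp_bounded[OF compact_continuous_image[OF assms compact_Icc]] by (auto simp: bounded_iff)
  then show ?thesis
    by (intro integrable_const_bound[of _ B] continuous_on_Gamma_measurable assms) auto
qed

lemma integral_Gamma_measure:
  fixes g :: "real \<Rightarrow> real"
  assumes "continuous_on \<Gamma> g"
  shows "(LINT t|\<Gamma>_measure. g t) = (LINT t:\<Gamma>|lborel. g t) / 2"
proof -
  have g: "g \<in> borel_measurable (restrict_space lborel \<Gamma>)"
  proof -
    have "sets (restrict_space lborel \<Gamma>) = sets (restrict_space borel \<Gamma>)"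
      by (rule sets_restrict_space_cong) simp
    from measurable_cong_sets[OF this refl] show ?thesis
      using borel_measurable_continuous_on_restrict[OF assms] by blast
  qed
  have "(LINT t|\<Gamma>_measure. g t) = (LINT t|restrict_space lborel \<Gamma>. (1 / 2) *\<^sub>R g t)"
    unfolding Gamma_measure_eq by (rule integral_density[OF g]) auto
  then show ?thesis
    by (simp add: integral_restrict_space set_lebesgue_integral_def)
qed

lemma integral_Gamma_pderiv: "(LINT t|\<Gamma>_measure. poly (pderiv p) t) = (poly p 1 - poly p (- 1)) / 2"
proof -
  have "(LINT t:\<Gamma>|lborel. poly (pderiv p) t) = poly p 1 - poly p (- 1)"
    unfolding set_lebesgue_integral_def
    by (intro integral_FTC_atLeastAtMost continuous_intros)
      (auto intro!: DERIV_subset[OF poly_DERIV] simp: has_real_derivative_iff_has_vector_derivative[symmetric])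
  then show ?thesis by (subst integral_Gamma_measure) (auto intro!: continuous_intros)
qed

lemma integral_Gamma_reflect:
  fixes g :: "real \<Rightarrow> real"
  assumes "continuous_on \<Gamma> g"
  shows "(LINT t|\<Gamma>_measure. g (- t)) = (LINT t|\<Gamma>_measure. g t)"
proof -
  have "{x. - x \<in> \<Gamma>} = \<Gamma>" by auto
  then have "(LINT t:\<Gamma>|lborel. g (- t)) = (LINT t:\<Gamma>|lborel. g t)"
    using set_integral_reflect[of \<Gamma> g] by simp
  moreover have "continuous_on \<Gamma> (\<lambda>t. g (- t))"
    by (intro continuous_on_compose2[OF assms] continuous_intros) auto
  ultimately show ?thesis using assms by (simp add: integral_Gamma_measure)
qed

lemma integral_Gamma_poly_parts:
  assumes "poly a 1 = 0" "poly a (- 1) = 0"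
  shows "(LINT t|\<Gamma>_measure. poly (pderiv a * b) t) = - (LINT t|\<Gamma>_measure. poly (a * pderiv b) t)"
proof -
  have "(LINT t|\<Gamma>_measure. poly (pderiv a * b) t) + (LINT t|\<Gamma>_measure. poly (a * pderiv b) t)
      = (LINT t|\<Gamma>_measure. poly (pderiv (a * b)) t)"
    by (subst Bochner_Integration.integral_add[symmetric])
      (auto intro!: integrable_Gamma_measure continuous_intros Bochner_Integration.integral_cong simp: pderiv_mult algebra_simps)
  also have "\<dots> = 0" using assms by (simp add: integral_Gamma_pderiv)
  finally show ?thesis by simp
qed

section \<open>Legendre polynomials: orthogonality and zeros\<close>

abbreviation rodrigues :: "nat \<Rightarrow> nat \<Rightarrow> real poly" where
  "rodrigues k n \<equiv> (pderiv ^^ k) ([:-1, 0, 1:] ^ n)"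

lemma dvd_pderiv_power:
  fixes B :: "real poly"
  assumes "B ^ Suc m dvd p"
  shows "B ^ m dvd pderiv p"
proof -
  obtain r where p: "p = B ^ Suc m * r" using assms by (rule dvdE)
  have "pderiv p = B ^ m * (B * pderiv r) + B ^ m * (smult (of_nat (Suc m)) (r * pderiv B))"
    unfolding p pderiv_mult pderiv_power_Suc by (simp add: mult_ac)
  then show ?thesis by (simp only: dvd_add dvd_triv_left)
qed

text \<open>Each differentiation costs at most one power of x^2 - 1, so all derivatives of order
  below n vanish at both endpoints. This removes the boundary terms in the integration by parts and
  supplies two additional zeros for Rolle's theorem.\<close>

lemma rodrigues_dvd:
  "k \<le> n \<Longrightarrow> [:-1, 0, 1:] ^ (n - k) dvd rodrigues k n"
proof (induction k)
  case (Suc k)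
  then have "[:-1, 0, 1:] ^ Suc (n - Suc k) dvd rodrigues k n"
    by (simp only: Suc_diff_Suc Suc_le_eq less_imp_le_nat)
  then show ?case by (simp only: funpow.simps o_apply dvd_pderiv_power)
qed simp

lemma rodrigues_endpoints:
  assumes "k < n"
  shows "poly (rodrigues k n) 1 = 0" "poly (rodrigues k n) (- 1) = 0"
proof -
  obtain r where "rodrigues k n = [:-1, 0, 1:] ^ (n - k) * r"
    using rodrigues_dvd[of k n] assms by (auto elim: dvdE)
  then show "poly (rodrigues k n) 1 = 0" "poly (rodrigues k n) (- 1) = 0"
    using assms by auto
qed

lemma degree_rodrigues: "degree (rodrigues k n) = 2 * n - k"
proof (induction k)
  case 0
  show ?case by (simp add: degree_power_eq)
qed (simp add: degree_pderiv)

text \<open>Integrating by parts n times moves all derivatives to q, whose n-th derivative is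
  zero.\<close>

lemma legendre_orthogonal:
  assumes "q = 0 \<or> degree q < n"
  shows "(LINT t|\<Gamma>_measure. poly (legendre n * q) t) = 0"
proof -
  define W :: "real poly" where "W = [:-1, 0, 1:] ^ n"
  have "(LINT t|\<Gamma>_measure. poly ((pderiv ^^ n) W * q) t)
      = (-1) ^ k * (LINT t|\<Gamma>_measure. poly ((pderiv ^^ (n - k)) W * (pderiv ^^ k) q) t)" if "k \<le> n" for k
    using that
  proof (induction k)
    case (Suc k)
    have "n - k = Suc (n - Suc k)" using Suc by simp
    moreover have "(LINT t|\<Gamma>_measure. poly (pderiv ((pderiv ^^ (n - Suc k)) W) * (pderiv ^^ k) q) t)
        = - (LINT t|\<Gamma>_measure. poly ((pderiv ^^ (n - Suc k)) W * pderiv ((pderiv ^^ k) q)) t)"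
      using Suc by (intro integral_Gamma_poly_parts) (auto simp: W_def rodrigues_endpoints)
    ultimately show ?case using Suc by simp
  qed simp
  from this[of n] have eq: "(LINT t|\<Gamma>_measure. poly ((pderiv ^^ n) W * q) t) = (-1) ^ n * (LINT t|\<Gamma>_measure. poly (W * (pderiv ^^ n) q) t)"
    by simp
  have "(pderiv ^^ n) q = 0"
  proof -
    have "degree ((pderiv ^^ k) q) = degree q - k" for k
      by (induction k) (auto simp: degree_pderiv)
    moreover have "(pderiv ^^ Suc (degree q)) q = 0"
      using \<open>\<And>k. degree ((pderiv ^^ k) q) = degree q - k\<close>[of "degree q"] by (simp add: pderiv_eq_0_iff)
    moreover have "(pderiv ^^ k) 0 = (0 :: real poly)" for k by (induction k) auto
    moreover have "q \<noteq> 0 \<Longrightarrow> (pderiv ^^ n) q = (pderiv ^^ (n - Suc (degree q))) ((pderiv ^^ Suc (degree q)) q)"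
      using assms by (metis Suc_leI comp_apply funpow_add le_add_diff_inverse2)
    ultimately show ?thesis by (cases "q = 0") auto
  qed
  then have "(LINT t|\<Gamma>_measure. poly ((pderiv ^^ n) W * q) t) = 0" using eq by simp
  then show ?thesis by (simp add: legendre_def W_def[symmetric])
qed

lemma rolle_roots:
  fixes p :: "real poly"
  assumes "finite S" "card S = Suc k" "\<And>x. x \<in> S \<Longrightarrow> poly p x = 0" "S \<subseteq> {a..b}"
  obtains S' where "finite S'" "card S' = k" "\<And>x. x \<in> S' \<Longrightarrow> poly (pderiv p) x = 0" "S' \<subseteq> {a<..<b}"
proof -
  define l where "l = sorted_list_of_set S"
  have len: "length l = Suc k" and set_l: "set l = S" and sorted: "sorted_wrt (<) l"
    using assms by (auto simp: l_def)
  have lt: "l ! i < l ! j" if "i < j" "j < Suc k" for i j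
    using sorted_wrt_nth_less[OF sorted that(1)] that len by simp
  have mem: "l ! i \<in> S" if "i < Suc k" for i using that len set_l by (metis nth_mem)
  have "\<exists>x. l ! i < x \<and> x < l ! Suc i \<and> poly (pderiv p) x = 0" if i: "i < k" for i
    using poly_MVT[OF lt[of i "Suc i"], of p] assms(3)[OF mem] lt[of i "Suc i"] i by force
  then obtain \<xi> where \<xi>: "\<And>i. i < k \<Longrightarrow> l ! i < \<xi> i \<and> \<xi> i < l ! Suc i \<and> poly (pderiv p) (\<xi> i) = 0" by metis
  have mono: "\<xi> i < \<xi> j" if "i < j" "j < k" for i j
  proof -
    have "l ! Suc i \<le> l ! j" using lt[of "Suc i" j] that by (cases "Suc i = j") auto
    then show ?thesis using \<xi>[of i] \<xi>[of j] that by auto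
  qed
  have inj: "inj_on \<xi> {..<k}"
    by (intro inj_onI) (metis lessThan_iff linorder_neqE_nat mono order_less_irrefl)
  show ?thesis
  proof
    show "card (\<xi> ` {..<k}) = k" using card_image[OF inj] by simp
    show "\<xi> ` {..<k} \<subseteq> {a<..<b}"
    proof
      fix x assume "x \<in> \<xi> ` {..<k}"
      then obtain i where i: "i < k" "x = \<xi> i" by auto
      have "l ! i \<in> {a..b}" "l ! Suc i \<in> {a..b}" using mem[of i] mem[of "Suc i"] i assms(4) by auto
      then show "x \<in> {a<..<b}" using \<xi>[OF i(1)] i(2) by auto
    qed
  qed (use \<xi> in auto)
qed

text \<open>The k interior zeros and the two endpoints are k + 2 zeros in all, and Rolle's theorem
  places k + 1 zeros of the next derivative strictly between them.\<close>

lemma rodrigues_roots: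
  "k \<le> n \<Longrightarrow> \<exists>S. finite S \<and> card S = k \<and> (\<forall>x\<in>S. poly (rodrigues k n) x = 0) \<and> S \<subseteq> {-1<..<1}"
proof (induction k)
  case (Suc k)
  then obtain S where S: "finite S" "card S = k" "\<forall>x\<in>S. poly (rodrigues k n) x = 0" "S \<subseteq> {-1<..<1}"
    by auto
  define T where "T = insert (-1) (insert 1 S)"
  have "finite T" "card T = Suc (Suc k)" "T \<subseteq> {-1..1}"
    using S by (auto simp: T_def card_insert_if)
  moreover have "poly (rodrigues k n) x = 0" if "x \<in> T" for x
    using that S(3) rodrigues_endpoints[of k n] Suc by (auto simp: T_def)
  ultimately obtain S' where "finite S'" "card S' = Suc k"
    "\<And>x. x \<in> S' \<Longrightarrow> poly (pderiv (rodrigues k n)) x = 0" "S' \<subseteq> {-1<..<1}"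
    using rolle_roots[of T "Suc k" "rodrigues k n" "-1" 1] by metis
  then show ?case by (intro exI[of _ S']) auto
qed auto

lemma legendre_nonzero: "legendre n \<noteq> 0" and degree_legendre: "degree (legendre n) = n"
proof -
  have deg: "degree (rodrigues n n) = n" by (simp add: degree_rodrigues)
  then show "degree (legendre n) = n" by (simp add: legendre_def)
  then show "legendre n \<noteq> 0"
    by (cases "n = 0") (auto simp: legendre_def)
qed

lemma finite_gauss_nodes: "finite (gauss_nodes n)"
  unfolding gauss_nodes_def using legendre_nonzero by (rule poly_roots_finite)

text \<open>Rolle's theorem supplies n zeros in the open interval, and the degree leaves room for no
  others.\<close>

lemma gauss_nodes:
  shows card_gauss_nodes: "card (gauss_nodes n) = n" and gauss_nodes_subset: "gauss_nodes n \<subseteq> {-1<..<1}"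
proof -
  obtain S where S: "finite S" "card S = n" "\<forall>x\<in>S. poly (rodrigues n n) x = 0" "S \<subseteq> {-1<..<1}"
    using rodrigues_roots[of n n] by auto
  have sub: "S \<subseteq> gauss_nodes n" using S(3) by (auto simp: gauss_nodes_def legendre_def)
  have "card (gauss_nodes n) \<le> n"
    using card_poly_roots_bound[OF legendre_nonzero[of n]] by (simp add: gauss_nodes_def degree_legendre)
  then have "S = gauss_nodes n" using sub S(2) finite_gauss_nodes by (metis card_seteq)
  then show "card (gauss_nodes n) = n" "gauss_nodes n \<subseteq> {-1<..<1}" using S by auto
qed

lemma gauss_node_bound: "x \<in> gauss_nodes n \<Longrightarrow> x \<in> \<Gamma>"
  using gauss_nodes_subset[of n] by (auto simp: subset_iff)

lemma poly_pderiv_minus: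
  fixes p :: "real poly"
  assumes "\<And>x. poly p (- x) = c * poly p x"
  shows "poly (pderiv p) (- x) = - c * poly (pderiv p) x"
proof -
  have "poly (pcompose p [:0, -1:]) y = poly (smult c p) y" for y by (simp add: poly_pcompose assms)
  then have "pcompose p [:0, -1:] = smult c p" by (simp add: poly_eq_poly_eq_iff[symmetric] fun_eq_iff)
  from arg_cong[OF this, of "\<lambda>p. poly (pderiv p) x"] show ?thesis
    by (simp add: pderiv_pcompose poly_pcompose pderiv_smult pderiv_pCons)
qed

lemma legendre_minus: "poly (legendre n) (- x) = (-1) ^ n * poly (legendre n) x"
proof -
  have "poly (rodrigues k n) (- x) = (-1) ^ k * poly (rodrigues k n) x" for k x
  proof (induction k arbitrary: x)
    case (Suc k)
    show ?case using poly_pderiv_minus[OF Suc] by simp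
  qed simp
  then show ?thesis by (simp add: legendre_def)
qed

lemma gauss_nodes_minus [simp]: "- x \<in> gauss_nodes n \<longleftrightarrow> x \<in> gauss_nodes n"
  by (simp add: gauss_nodes_def legendre_minus)

section \<open>Lagrange interpolation, exactness and positivity of the rule\<close>

definition lagrange_basis :: "real set \<Rightarrow> real \<Rightarrow> real poly" where
  "lagrange_basis X x = (\<Prod>y\<in>X - {x}. smult (1 / (x - y)) [:- y, 1:])"

lemma poly_lagrange_basis: "poly (lagrange_basis X x) t = (\<Prod>y\<in>X - {x}. (t - y) / (x - y))"
  by (simp add: lagrange_basis_def poly_prod diff_divide_distrib)

lemma lagrange_basis_node:
  assumes "finite X" "x \<in> X" "z \<in> X"
  shows "poly (lagrange_basis X x) z = (if z = x then 1 else 0)"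
  unfolding poly_lagrange_basis using assms by (auto intro!: prod.neutral prod_zero)

lemma degree_lagrange_basis:
  assumes "finite X" "x \<in> X"
  shows "degree (lagrange_basis X x) \<le> card X - 1"
proof -
  have "degree (lagrange_basis X x) \<le> (\<Sum>y\<in>X - {x}. degree (smult (1 / (x - y)) [:- y, 1:]))"
    unfolding lagrange_basis_def using assms by (intro order_trans[OF degree_prod_sum_le]) auto
  also have "\<dots> \<le> (\<Sum>y\<in>X - {x}. 1)" by (intro sum_mono) auto
  also have "\<dots> = card X - 1" using assms by simp
  finally show ?thesis .
qed

lemma lagrange_interpolation:
  assumes "finite X" "degree p < card X"
  shows "poly p t = (\<Sum>x\<in>X. poly p x * poly (lagrange_basis X x) t)"
proof -
  define q where "q = (\<Sum>x\<in>X. smult (poly p x) (lagrange_basis X x))"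
  have "p = q"
  proof (rule poly_eqI_degree[of X])
    fix z assume z: "z \<in> X"
    have "poly q z = (\<Sum>x\<in>X. if z = x then poly p x else 0)"
      unfolding q_def poly_sum poly_smult using z assms(1)
      by (intro sum.cong) (auto simp: lagrange_basis_node)
    then show "poly p z = poly q z" using z assms(1) by simp
  next
    have "degree q \<le> card X - 1"
      unfolding q_def using assms(1) degree_lagrange_basis[OF assms(1)]
      by (intro degree_sum_le) (auto intro: order_trans[OF degree_smult_le])
    then show "degree q < card X" using assms(2) by linarith
  qed (use assms in auto)
  then have "poly p t = poly q t" by simp
  then show ?thesis by (simp add: q_def poly_sum)
qed

lemma gauss_weight_eq: "gauss_weight n x = (LINT t|\<Gamma>_measure. poly (lagrange_basis (gauss_nodes n) x) t)"
  by (simp add: gauss_weight_def poly_lagrange_basis)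

lemma gauss_legendre_exact_low:
  assumes "degree p < n"
  shows "gauss_legendre n (poly p) = (LINT t|\<Gamma>_measure. poly p t)"
proof -
  have "(LINT t|\<Gamma>_measure. poly p t) = (LINT t|\<Gamma>_measure. (\<Sum>x\<in>gauss_nodes n. poly p x * poly (lagrange_basis (gauss_nodes n) x) t))"
    by (intro Bochner_Integration.integral_cong refl lagrange_interpolation finite_gauss_nodes)
      (simp add: assms card_gauss_nodes)
  also have "\<dots> = gauss_legendre n (poly p)"
    by (subst Bochner_Integration.integral_sum)
      (auto intro!: integrable_Gamma_measure continuous_intros simp: gauss_legendre_def gauss_weight_eq mult.commute)
  finally show ?thesis ..
qed

text \<open>Division by the Legendre polynomial leaves a multiple of it that vanishes at the nodes
  and integrates to zero by orthogonality, and a remainder of degree below n, for which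
  interpolation is exact.\<close>

theorem gauss_legendre_exact:
  assumes "degree p < 2 * n"
  shows "gauss_legendre n (poly p) = (LINT t|\<Gamma>_measure. poly p t)"
proof -
  define q r where "q = p div legendre n" and "r = p mod legendre n"
  have p: "p = legendre n * q + r" unfolding q_def r_def by (rule mult_div_mod_eq[symmetric])
  have r: "r = 0 \<or> degree r < n"
    using degree_mod_less[OF legendre_nonzero[of n], of p] by (auto simp: r_def degree_legendre)
  have n: "n > 0" using assms by simp
  then have r': "degree r < n" using r by auto
  have q: "q = 0 \<or> degree q < n"
  proof (cases "q = 0")
    case False
    have "degree (legendre n * q) \<le> max (degree p) (degree r)"
      using degree_diff_le_max[of p r] p by (metis add_diff_cancel_right')
    then have "n + degree q < 2 * n"
      using False legendre_nonzero assms r' by (simp add: degree_mult_eq degree_legendre)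
    then show ?thesis by simp
  qed simp
  have "gauss_legendre n (poly p) = gauss_legendre n (poly r)"
    unfolding gauss_legendre_def by (rule sum.cong) (auto simp: p gauss_nodes_def)
  also have "\<dots> = (LINT t|\<Gamma>_measure. poly r t)" by (rule gauss_legendre_exact_low[OF r'])
  also have "\<dots> = (LINT t|\<Gamma>_measure. poly (legendre n * q) t) + (LINT t|\<Gamma>_measure. poly r t)"
    by (simp only: legendre_orthogonal[OF q])
  also have "\<dots> = (LINT t|\<Gamma>_measure. poly (legendre n * q) t + poly r t)"
    by (rule Bochner_Integration.integral_add[symmetric]) (auto intro!: integrable_Gamma_measure continuous_intros)
  also have "\<dots> = (LINT t|\<Gamma>_measure. poly p t)" by (simp add: p)
  finally show ?thesis .
qed

text \<open>The squared Lagrange basis polynomial has degree at most 2n - 2, so the rule integrates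
  it exactly; at the nodes it is 1 at x and 0 elsewhere. The weight is thus the integral of a
  square.\<close>

lemma gauss_weight_nonneg:
  assumes "x \<in> gauss_nodes n"
  shows "gauss_weight n x \<ge> 0"
proof -
  define l where "l = lagrange_basis (gauss_nodes n) x"
  have n: "n > 0" using assms card_gauss_nodes[of n] finite_gauss_nodes[of n] by (metis card_gt_0_iff empty_iff)
  have "degree (l\<^sup>2) \<le> 2 * (n - 1)"
    using degree_lagrange_basis[OF finite_gauss_nodes assms] degree_power_le[of l 2] by (simp add: card_gauss_nodes l_def)
  then have "degree (l\<^sup>2) < 2 * n" using n by simp
  then have "gauss_legendre n (poly (l\<^sup>2)) = (LINT t|\<Gamma>_measure. poly (l\<^sup>2) t)" by (rule gauss_legendre_exact)
  moreover have "gauss_legendre n (poly (l\<^sup>2)) = (\<Sum>z\<in>gauss_nodes n. if z = x then gauss_weight n x else 0)"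
    unfolding gauss_legendre_def l_def
    by (intro sum.cong) (auto simp: lagrange_basis_node[OF finite_gauss_nodes assms])
  ultimately have "gauss_weight n x = (LINT t|\<Gamma>_measure. (poly l t)\<^sup>2)"
    using assms finite_gauss_nodes by simp
  then show ?thesis by simp
qed

lemma sum_gauss_weight:
  assumes "n > 0"
  shows "(\<Sum>x\<in>gauss_nodes n. gauss_weight n x) = 1"
proof -
  have "pderiv [:0, 1:] = (1 :: real poly)" by (simp add: pderiv_pCons)
  then have "(LINT t|\<Gamma>_measure. poly 1 t) = 1"
    using integral_Gamma_pderiv[of "[:0, 1:]"] by simp
  moreover have "gauss_legendre n (poly 1) = (LINT t|\<Gamma>_measure. poly 1 t)"
    using assms by (intro gauss_legendre_exact) simp
  ultimately show ?thesis by (simp add: gauss_legendre_def)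
qed

section \<open>Reflection symmetry\<close>

lemma gauss_weight_minus: "gauss_weight n (- x) = gauss_weight n x"
proof -
  have "poly (lagrange_basis (gauss_nodes n) (- x)) t = poly (lagrange_basis (gauss_nodes n) x) (- t)" for t
  proof -
    have eq: "(- t - - y) / (x - - y) = (t - y) / (- x - y)" for y
    proof -
      have "- t - - y = - (t - y)" "x - - y = - (- x - y)" by simp_all
      then show ?thesis by (simp only: minus_divide_divide)
    qed
    have "gauss_nodes n - {x} = uminus ` (gauss_nodes n - {- x})"
    proof (intro equalityI subsetI)
      fix y assume "y \<in> gauss_nodes n - {x}"
      then show "y \<in> uminus ` (gauss_nodes n - {- x})" by (intro image_eqI[of y uminus "- y"]) auto
    qed auto
    then have "(\<Prod>y\<in>gauss_nodes n - {x}. (- t - y) / (x - y)) = (\<Prod>y\<in>gauss_nodes n - {- x}. (- t - - y) / (x - - y))"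
      by (simp only:) (subst prod.reindex, auto)
    then show ?thesis unfolding poly_lagrange_basis by (simp only: eq)
  qed
  then show ?thesis
    using integral_Gamma_reflect[of "poly (lagrange_basis (gauss_nodes n) x)"]
    by (simp add: gauss_weight_eq continuous_on_poly continuous_on_id)
qed

lemma gauss_legendre_odd:
  assumes "\<And>x. g (- x) = - g x"
  shows "gauss_legendre n g = 0"
proof -
  have "gauss_legendre n g = (\<Sum>x\<in>gauss_nodes n. gauss_weight n (- x) * g (- x))"
    unfolding gauss_legendre_def
    by (rule sum.reindex_bij_witness[where i = uminus and j = uminus]) auto
  also have "\<dots> = - gauss_legendre n g"
    by (simp add: gauss_legendre_def gauss_weight_minus assms sum_negf)
  finally show ?thesis by simp
qed

lemma integral_Gamma_odd:
  fixes g :: "real \<Rightarrow> real"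
  assumes "continuous_on \<Gamma> g" "\<And>x. g (- x) = - g x"
  shows "(LINT t|\<Gamma>_measure. g t) = 0"
  using integral_Gamma_reflect[OF assms(1)] by (simp add: assms(2))

section \<open>Chebyshev expansion of functions analytic near the interval\<close>

definition tube :: "real \<Rightarrow> complex set" where
  "tube t = {z. infdist z (complex_of_real ` \<Gamma>) < t}"

lemma tube_eq_sums: "tube t = {x + y | x y. x \<in> complex_of_real ` \<Gamma> \<and> y \<in> ball 0 t}"
proof (intro equalityI subsetI)
  fix z assume "z \<in> tube t"
  moreover have "closed (complex_of_real ` \<Gamma>)"
    by (intro compact_imp_closed compact_continuous_image continuous_intros) auto
  then obtain a where a: "a \<in> complex_of_real ` \<Gamma>" "infdist z (complex_of_real ` \<Gamma>) = dist z a"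
    using infdist_attains_inf[of "complex_of_real ` \<Gamma>" z] by auto
  ultimately have "z = a + (z - a)" "z - a \<in> ball 0 t"
    by (auto simp: tube_def dist_norm norm_minus_commute)
  then show "z \<in> {x + y | x y. x \<in> complex_of_real ` \<Gamma> \<and> y \<in> ball 0 t}"
    using a(1) by blast
next
  fix z assume "z \<in> {x + y | x y. x \<in> complex_of_real ` \<Gamma> \<and> y \<in> ball 0 t}"
  then obtain x y where "z = x + y" "x \<in> complex_of_real ` \<Gamma>" "cmod y < t" by auto
  then show "z \<in> tube t"
    using infdist_le[of x "complex_of_real ` \<Gamma>" z] by (simp add: tube_def dist_norm)
qed

lemma open_tube: "open (tube t)"
  unfolding tube_def by (intro open_Collect_less continuous_intros)

text \<open>A Minkowski sum of a segment and a disc. Convexity gives Cauchy's formula for every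
  closed path in the tube, without considerations on homology.\<close>

lemma convex_tube: "convex (tube t)"
proof -
  have "tube t = (\<Union>x\<in>complex_of_real ` \<Gamma>. \<Union>y\<in>ball 0 t. {x + y})"
    unfolding tube_eq_sums by blast
  moreover have "linear complex_of_real" by (auto simp: linear_iff scaleR_conv_of_real)
  ultimately show ?thesis
    using convex_sums[OF convex_linear_image[OF _ convex_real_interval(5)] convex_ball] by metis
qed

lemma real_in_tube: "t > 0 \<Longrightarrow> \<bar>x\<bar> \<le> 1 \<Longrightarrow> complex_of_real x \<in> tube t"
  by (auto simp: tube_def abs_le_iff)

section \<open>The Joukowski map and Bernstein ellipses\<close>

definition joukowski :: "complex \<Rightarrow> complex" where
  "joukowski w = (w + inverse w) / 2"

lemma joukowski_cis: "joukowski (cis t) = of_real (cos t)"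
  by (simp add: joukowski_def complex_eq_iff)

lemma joukowski_eq_iff:
  assumes "w \<noteq> 0" "z \<noteq> 0"
  shows "joukowski w = joukowski z \<longleftrightarrow> w = z \<or> w = inverse z"
proof -
  have "joukowski w - joukowski z = (w - z) * (w - inverse z) / (2 * w)"
    using assms by (simp add: joukowski_def field_simps)
  then show ?thesis using assms by auto
qed

text \<open>The circle of radius s is mapped to the ellipse with semi-axes a and b, where a^2 - b^2
  = 1. Its point with parameter theta is within b of cos theta, because a >= 1 implies (a - 1)^2 <=
  b^2. Finally, b < t follows from s < t + sqrt (1 + t^2), which is where kappa comes from.\<close>

lemma joukowski_in_tube:
  assumes "1 \<le> cmod w" "cmod w < t + sqrt (1 + t\<^sup>2)"
  shows "joukowski w \<in> tube t"
proof -
  define s where "s = cmod w"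
  obtain \<theta> where w: "w = of_real s * cis \<theta>"
    unfolding s_def using rcis_cmod_Arg[of w] by (metis rcis_def)
  have s: "s \<ge> 1" using assms s_def by simp
  define a b where "a = (s + 1 / s) / 2" and "b = (s - 1 / s) / 2"
  have ab: "a\<^sup>2 - b\<^sup>2 = 1" using s by (simp add: a_def b_def field_simps power2_eq_square)
  have a1: "a \<ge> 1"
  proof -
    have "2 * s \<le> s * s + 1" using sum_squares_bound[of s 1] by (simp add: power2_eq_square)
    then show ?thesis using s by (simp add: a_def field_simps)
  qed
  have "1 / s \<le> 1" using s by simp
  then have "1 / s \<le> s" using s by linarith
  then have b0: "b \<ge> 0" by (simp add: b_def)
  have bt: "b < t"
  proof -
    have "sqrt (1 + t\<^sup>2) > \<bar>t\<bar>" by (rule real_less_rsqrt) simp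
    then have pos: "t + sqrt (1 + t\<^sup>2) > 0" by linarith
    have "(sqrt (1 + t\<^sup>2) - t) * (t + sqrt (1 + t\<^sup>2)) = 1"
      by (simp add: algebra_simps power2_eq_square)
    then have "sqrt (1 + t\<^sup>2) - t = 1 / (t + sqrt (1 + t\<^sup>2))" using pos by (simp add: field_simps)
    also have "\<dots> < 1 / s"
    proof (rule frac_less2)
      show "0 < s" "s < t + sqrt (1 + t\<^sup>2)" using s assms(2) by (simp_all only: s_def)
    qed auto
    finally show ?thesis using assms(2) by (simp add: b_def s_def)
  qed
  have inv: "inverse w = of_real (1 / s) * cis (- \<theta>)"
    by (simp add: w cis_inverse inverse_eq_divide[of "complex_of_real s"])
  have J: "joukowski w = Complex (a * cos \<theta>) (b * sin \<theta>)"
    unfolding joukowski_def inv by (simp add: w a_def b_def complex_eq_iff algebra_simps)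
  have "(a - 1)\<^sup>2 \<le> b\<^sup>2" using ab a1 by (simp add: power2_eq_square algebra_simps)
  then have "(a - 1)\<^sup>2 * (cos \<theta>)\<^sup>2 + b\<^sup>2 * (sin \<theta>)\<^sup>2 \<le> b\<^sup>2 * (cos \<theta>)\<^sup>2 + b\<^sup>2 * (sin \<theta>)\<^sup>2"
    by (intro add_mono mult_right_mono) auto
  also have "\<dots> = b\<^sup>2" by (simp flip: distrib_left)
  finally have le: "(a - 1)\<^sup>2 * (cos \<theta>)\<^sup>2 + b\<^sup>2 * (sin \<theta>)\<^sup>2 \<le> b\<^sup>2" .
  have "dist (joukowski w) (of_real (cos \<theta>)) = sqrt ((a * cos \<theta> - cos \<theta>)\<^sup>2 + (b * sin \<theta>)\<^sup>2)"
    by (simp add: J dist_norm cmod_def)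
  also have "(a * cos \<theta> - cos \<theta>)\<^sup>2 + (b * sin \<theta>)\<^sup>2 = (a - 1)\<^sup>2 * (cos \<theta>)\<^sup>2 + b\<^sup>2 * (sin \<theta>)\<^sup>2"
    by (simp add: power2_eq_square algebra_simps)
  also have "sqrt \<dots> \<le> b" using le b0 by (simp add: real_le_lsqrt)
  finally have "infdist (joukowski w) (complex_of_real ` \<Gamma>) \<le> b"
    by (intro infdist_le2[of "of_real (cos \<theta>)"]) auto
  then show ?thesis using bt by (simp add: tube_def)
qed

text \<open>Cauchy's formula along the ellipse, pulled back to the circle by the identity J'(w) /
  (J(w) - J(z)) = 1/(w - z) + 1/(w - 1/z) - 1/w.\<close>

lemma joukowski_cauchy:
  assumes hol: "u holomorphic_on tube t" and \<rho>: "1 < \<rho>" "\<rho> < t + sqrt (1 + t\<^sup>2)"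
    and z: "1 \<le> cmod z" "cmod z < \<rho>"
  shows "contour_integral (circlepath 0 \<rho>) (\<lambda>w. u (joukowski w) * (1 / (w - z) + 1 / (w - inverse z) - 1 / w))
         = 2 * pi * \<i> * u (joukowski z)"
proof -
  define \<gamma> where "\<gamma> = circlepath 0 \<rho>"
  have z0: "z \<noteq> 0" using z by auto
  have iz: "cmod (inverse z) < \<rho>"
  proof -
    have "inverse (cmod z) \<le> 1" using z(1) by (simp add: inverse_le_1_iff)
    then show ?thesis using \<rho>(1) by (simp add: norm_inverse)
  qed
  have img: "path_image \<gamma> = sphere 0 \<rho>" using \<rho> by (simp add: \<gamma>_def)
  have w0: "w \<noteq> 0" if "w \<in> path_image \<gamma>" for w using that \<rho> by (auto simp: img)
  have J_hol: "joukowski holomorphic_on - {0}"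
    unfolding joukowski_def by (auto intro!: holomorphic_intros)
  have vp: "valid_path (joukowski \<circ> \<gamma>)"
    using w0 by (intro valid_path_compose_holomorphic[OF _ J_hol]) (auto simp: \<gamma>_def)
  have J_ne: "joukowski w \<noteq> joukowski z" if "w \<in> path_image \<gamma>" for w
    using that z iz by (subst joukowski_eq_iff[OF w0[OF that] z0]) (auto simp: img)
  have pi: "path_image (joukowski \<circ> \<gamma>) \<subseteq> tube t - {joukowski z}"
    unfolding path_image_compose using J_ne joukowski_in_tube \<rho> by (auto simp: img)
  have comp: "contour_integral (joukowski \<circ> \<gamma>) (\<lambda>w. f w / (w - joukowski z))
     = contour_integral \<gamma> (\<lambda>w. f (joukowski w) * (1 / (w - z) + 1 / (w - inverse z) - 1 / w))" for f
  proof -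
    have "contour_integral (joukowski \<circ> \<gamma>) (\<lambda>w. f w / (w - joukowski z))
       = contour_integral \<gamma> (\<lambda>w. deriv joukowski w * (f (joukowski w) / (joukowski w - joukowski z)))"
      using w0 analytic_on_open[of "- {0}" joukowski] J_hol
      by (intro contour_integral_comp_analyticW[of _ "- {0}"]) (auto simp: \<gamma>_def open_Compl)
    also have "\<dots> = contour_integral \<gamma> (\<lambda>w. f (joukowski w) * (1 / (w - z) + 1 / (w - inverse z) - 1 / w))"
    proof (rule contour_integral_eq)
      fix w assume w: "w \<in> path_image \<gamma>"
      have "w \<noteq> z" "w \<noteq> inverse z" using w z iz by (auto simp: img)
      have "(joukowski has_field_derivative (1 - 1 / w\<^sup>2) / 2) (at w)"
        unfolding joukowski_def using w0[OF w]
        by (auto intro!: derivative_eq_intros simp: power2_eq_square inverse_eq_divide)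
      then have "deriv joukowski w = (1 - 1 / w\<^sup>2) / 2" by (rule DERIV_imp_deriv)
      moreover have "joukowski w - joukowski z = (w - z) * (w - inverse z) / (2 * w)"
        using w0[OF w] z0 by (simp add: joukowski_def field_simps)
      moreover have "(1 - 1 / w\<^sup>2) / 2 / ((w - z) * (w - inverse z) / (2 * w)) = 1 / (w - z) + 1 / (w - inverse z) - 1 / w"
      proof -
        have *: "(1 - 1 / w\<^sup>2) / 2 / ((w - z) * (w - i) / (2 * w)) = 1 / (w - z) + 1 / (w - i) - 1 / w"
          if "w - z \<noteq> 0" "w - i \<noteq> 0" "z * i = 1" for i
          using w0[OF w] that by (simp add: divide_simps power2_eq_square) algebra
        show ?thesis using \<open>w \<noteq> z\<close> \<open>w \<noteq> inverse z\<close> z0 by (intro *) auto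
      qed
      ultimately show "deriv joukowski w * (f (joukowski w) / (joukowski w - joukowski z)) =
          f (joukowski w) * (1 / (w - z) + 1 / (w - inverse z) - 1 / w)"
        by (metis (no_types, opaque_lifting) mult.commute times_divide_eq_left times_divide_eq_right)
    qed
    finally show ?thesis .
  qed
  have Jz: "joukowski z \<in> tube t" using z \<rho> by (intro joukowski_in_tube) auto
  have closed: "pathfinish (joukowski \<circ> \<gamma>) = pathstart (joukowski \<circ> \<gamma>)"
    by (simp add: \<gamma>_def pathfinish_compose pathstart_compose)
  have cauchy: "contour_integral \<gamma> (\<lambda>w. f (joukowski w) * (1 / (w - z) + 1 / (w - inverse z) - 1 / w))
      = 2 * pi * \<i> * winding_number (joukowski \<circ> \<gamma>) (joukowski z) * f (joukowski z)"
    if "f holomorphic_on tube t" for f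
    using Cauchy_integral_formula_convex_simple[OF convex_tube that _ vp pi closed] Jz open_tube[of t] comp[of f]
    by (simp add: contour_integral_unique interior_open)
  have circ: "((\<lambda>w. 1 / (w - x)) has_contour_integral 2 * pi * \<i>) \<gamma>" if "cmod x < \<rho>" for x
    unfolding \<gamma>_def using Cauchy_integral_circlepath[of 0 \<rho> "\<lambda>_. 1" x] that by simp
  \<comment> \<open>The winding number of the ellipse is not determined geometrically, but by
    applying the formula to the constant function 1: both z and 1/z lie inside the circle, and the
    three kernels contribute 1 + 1 - 1.\<close>
  have "((\<lambda>w. 1 / (w - z) + 1 / (w - inverse z) - 1 / (w - 0)) has_contour_integral
      (2 * pi * \<i> + 2 * pi * \<i> - 2 * pi * \<i>)) \<gamma>"
    using z iz \<rho> by (intro has_contour_integral_add has_contour_integral_diff circ) auto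
  then have "2 * pi * \<i> * winding_number (joukowski \<circ> \<gamma>) (joukowski z) = 2 * pi * \<i>"
    using cauchy[of "\<lambda>_. 1"] by (simp add: contour_integral_unique)
  then show ?thesis using cauchy[OF hol] by (simp add: \<gamma>_def)
qed


section \<open>Expansion of the Cauchy kernels\<close>

lemma cauchy_integral_remainder:
  fixes v :: "complex \<Rightarrow> complex"
  assumes cont: "continuous_on (sphere 0 \<rho>) v" and bound: "\<And>w. cmod w = \<rho> \<Longrightarrow> cmod (v w) \<le> M"
    and \<rho>: "\<rho> > 0" and x: "cmod x < \<rho>"
  shows "cmod (contour_integral (circlepath 0 \<rho>) (\<lambda>w. v w / (w - x))
       - (\<Sum>k<n. contour_integral (circlepath 0 \<rho>) (\<lambda>w. v w / w ^ Suc k) * x ^ k))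
     \<le> 2 * pi * (M * \<rho> / (\<rho> - cmod x) * (cmod x / \<rho>) ^ n)"
proof -
  define \<gamma> where "\<gamma> = circlepath 0 \<rho>"
  have img: "path_image \<gamma> = sphere 0 \<rho>" using \<rho> by (simp add: \<gamma>_def)
  have ne: "w \<noteq> 0" "w - x \<noteq> 0" if "w \<in> sphere 0 \<rho>" for w using that \<rho> x by auto
  have 1: "((\<lambda>w. v w / (w - x)) has_contour_integral contour_integral \<gamma> (\<lambda>w. v w / (w - x))) \<gamma>"
    unfolding \<gamma>_def using ne cont img
    by (intro has_contour_integral_integral contour_integrable_continuous_circlepath continuous_intros) (auto simp: \<gamma>_def)
  have 2: "((\<lambda>w. v w / w ^ Suc k) has_contour_integral contour_integral \<gamma> (\<lambda>w. v w / w ^ Suc k)) \<gamma>" for k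
    unfolding \<gamma>_def using ne cont img
    by (intro has_contour_integral_integral contour_integrable_continuous_circlepath continuous_intros) (auto simp: \<gamma>_def)
  have rem: "v w / (w - x) - (\<Sum>k<n. v w / w ^ Suc k * x ^ k) = v w * (x / w) ^ n / (w - x)"
    if w: "w \<in> sphere 0 \<rho>" for w
  proof (induction n)
    case (Suc n)
    have "v w * (x / w) ^ n / (w - x) - v w / w ^ Suc n * x ^ n = v w * (x / w) ^ Suc n / (w - x)"
      using ne[OF w] by (simp add: field_simps power_divide)
    then show ?case using Suc by (simp add: algebra_simps)
  qed simp
  have "((\<lambda>w. v w / (w - x) - (\<Sum>k<n. v w / w ^ Suc k * x ^ k)) has_contour_integral
      (contour_integral \<gamma> (\<lambda>w. v w / (w - x)) - (\<Sum>k<n. contour_integral \<gamma> (\<lambda>w. v w / w ^ Suc k) * x ^ k))) \<gamma>"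
    by (intro has_contour_integral_diff has_contour_integral_sum has_contour_integral_rmul 1 2) auto
  then have "((\<lambda>w. v w * (x / w) ^ n / (w - x)) has_contour_integral
      (contour_integral \<gamma> (\<lambda>w. v w / (w - x)) - (\<Sum>k<n. contour_integral \<gamma> (\<lambda>w. v w / w ^ Suc k) * x ^ k))) \<gamma>"
    by (rule has_contour_integral_eq) (use rem img in auto)
  then have "cmod (contour_integral \<gamma> (\<lambda>w. v w / (w - x)) - (\<Sum>k<n. contour_integral \<gamma> (\<lambda>w. v w / w ^ Suc k) * x ^ k))
      \<le> (M * (cmod x / \<rho>) ^ n / (\<rho> - cmod x)) * (2 * pi * \<rho>)"
    unfolding \<gamma>_def
  proof (rule has_contour_integral_bound_circlepath)
    have M: "M \<ge> 0" using bound[of "of_real \<rho>"] \<rho> order_trans[OF norm_ge_zero, of "v (of_real \<rho>)"] by simp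
    then show "0 \<le> M * (cmod x / \<rho>) ^ n / (\<rho> - cmod x)" using x \<rho> by simp
    fix w :: complex assume w: "cmod (w - 0) = \<rho>"
    have "\<rho> - cmod x \<le> cmod (w - x)" using w norm_triangle_ineq2[of w x] by simp
    then show "cmod (v w * (x / w) ^ n / (w - x)) \<le> M * (cmod x / \<rho>) ^ n / (\<rho> - cmod x)"
      using bound[of w] w x \<rho> M unfolding norm_divide norm_mult norm_power
      by (intro frac_le mult_mono) auto
  qed (use \<rho> in auto)
  then show ?thesis by (simp add: \<gamma>_def mult_ac)
qed

lemma laurent_sum_eq:
  "laurent_sum N a w = (\<Sum>k<Suc N. a k * w ^ k) + (\<Sum>k<Suc N. a k * inverse w ^ k) - a 0"
proof (induction N)
  case (Suc N)
  have "{- int (Suc N)..int (Suc N)} = insert (- int (Suc N)) (insert (int (Suc N)) {- int N..int N})" by auto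
  then have "laurent_sum (Suc N) a w = laurent_sum N a w + a (Suc N) * w ^ Suc N + a (Suc N) * inverse w ^ Suc N"
    unfolding laurent_sum_def
    by (simp add: power_int_minus power_inverse algebra_simps del: of_nat_Suc power_Suc)
  then show ?case using Suc by simp
qed (simp add: laurent_sum_def)

text \<open>The kernels 1/(w - z) and 1/(w - 1/z) expand into powers of z and of 1/z with the same
  coefficients, and the kernel 1/w removes the constant term that is counted twice. The partial sums
  are therefore symmetric Laurent sums.\<close>

lemma chebyshev_expansion:
  assumes hol: "u holomorphic_on tube t" and bound: "\<And>z. z \<in> tube t \<Longrightarrow> cmod (u z) \<le> M"
    and \<rho>: "1 < \<rho>" "\<rho> < t + sqrt (1 + t\<^sup>2)"
  obtains a where "\<And>k. cmod (a k) \<le> M / \<rho> ^ k"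
    and "\<And>z r N. 1 \<le> cmod z \<Longrightarrow> cmod z \<le> r \<Longrightarrow> r < \<rho> \<Longrightarrow>
           cmod (u (joukowski z) - laurent_sum N a z) \<le> 2 * (M * \<rho> / (\<rho> - r) * (r / \<rho>) ^ Suc N)"
proof
  define v where "v = (\<lambda>w. u (joukowski w))"
  define \<gamma> where "\<gamma> = circlepath 0 \<rho>"
  define a where "a k = contour_integral \<gamma> (\<lambda>w. v w / w ^ Suc k) / (2 * pi * \<i>)" for k
  have v_bound: "cmod (v w) \<le> M" if "cmod w = \<rho>" for w
    unfolding v_def using that \<rho> by (intro bound joukowski_in_tube) auto
  have M: "M \<ge> 0" using v_bound[of "of_real \<rho>"] \<rho> order_trans[OF norm_ge_zero, of "v (of_real \<rho>)"] by simp
  have v_cont: "continuous_on (sphere 0 \<rho>) v"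
  proof -
    have "continuous_on (sphere 0 \<rho>) joukowski"
      unfolding joukowski_def using \<rho> by (auto intro!: continuous_intros)
    moreover have "joukowski ` sphere 0 \<rho> \<subseteq> tube t" using \<rho> by (auto intro!: joukowski_in_tube)
    ultimately show ?thesis
      unfolding v_def using continuous_on_compose2[OF holomorphic_on_imp_continuous_on[OF hol]] by blast
  qed
  have integrable: "(\<lambda>w. v w / w ^ k) contour_integrable_on \<gamma>" for k
    unfolding \<gamma>_def using \<rho> v_cont
    by (intro contour_integrable_continuous_circlepath continuous_intros) auto
  show "cmod (a k) \<le> M / \<rho> ^ k" for k
  proof -
    have "cmod (contour_integral \<gamma> (\<lambda>w. v w / w ^ Suc k)) \<le> (M / \<rho> ^ Suc k) * (2 * pi * \<rho>)"
      using has_contour_integral_integral[OF integrable[of "Suc k"]] unfolding \<gamma>_def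
    proof (rule has_contour_integral_bound_circlepath)
      fix w :: complex assume "cmod (w - 0) = \<rho>"
      then show "cmod (v w / w ^ Suc k) \<le> M / \<rho> ^ Suc k"
        using v_bound[of w] \<rho> by (simp add: norm_divide norm_mult norm_power divide_right_mono)
    qed (use M \<rho> in auto)
    also have "\<dots> = 2 * pi * (M / \<rho> ^ k)" using \<rho> by simp
    finally show ?thesis unfolding a_def by (simp add: norm_divide norm_mult field_simps)
  qed
  fix z :: complex and r :: real and N :: nat
  assume z: "1 \<le> cmod z" "cmod z \<le> r" and r: "r < \<rho>"
  have iz: "cmod (inverse z) \<le> r"
  proof -
    have "inverse (cmod z) \<le> 1" using z(1) by (simp add: inverse_le_1_iff)
    then show ?thesis using z by (simp add: norm_inverse)
  qed
  define H where "H x = contour_integral \<gamma> (\<lambda>w. v w / (w - x)) / (2 * pi * \<i>)" for x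
  have int_H: "(\<lambda>w. v w / (w - x)) contour_integrable_on \<gamma>" if "cmod x \<le> r" for x
    unfolding \<gamma>_def using \<rho> v_cont that r
    by (intro contour_integrable_continuous_circlepath continuous_intros) auto
  have H: "cmod (H x - (\<Sum>k<Suc N. a k * x ^ k)) \<le> M * \<rho> / (\<rho> - r) * (r / \<rho>) ^ Suc N" if x: "cmod x \<le> r" for x
  proof -
    let ?E = "contour_integral \<gamma> (\<lambda>w. v w / (w - x)) - (\<Sum>k<Suc N. contour_integral \<gamma> (\<lambda>w. v w / w ^ Suc k) * x ^ k)"
    have "H x - (\<Sum>k<Suc N. a k * x ^ k) = ?E / (2 * pi * \<i>)"
      unfolding H_def a_def by (simp only: diff_divide_distrib sum_divide_distrib times_divide_eq_left)
    then have "cmod (H x - (\<Sum>k<Suc N. a k * x ^ k)) = cmod ?E / (2 * pi)"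
      by (simp only: norm_divide norm_mult) simp
    also have "\<dots> \<le> M * \<rho> / (\<rho> - cmod x) * (cmod x / \<rho>) ^ Suc N"
      using cauchy_integral_remainder[OF v_cont v_bound, of x "Suc N"] x r \<rho>
      by (simp only: \<gamma>_def) (simp add: field_simps del: sum.lessThan_Suc power_Suc)
    also have "\<dots> \<le> M * \<rho> / (\<rho> - r) * (r / \<rho>) ^ Suc N"
      using x r \<rho> M by (intro mult_mono divide_left_mono power_mono divide_right_mono mult_pos_pos) auto
    finally show ?thesis .
  qed
  have "2 * pi * \<i> * u (joukowski z) = contour_integral \<gamma> (\<lambda>w. v w / (w - z) + v w / (w - inverse z) - v w / w ^ Suc 0)"
    using joukowski_cauchy[OF hol \<rho> z(1)] z(2) r unfolding v_def \<gamma>_def by (simp add: algebra_simps)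
  also have "\<dots> = contour_integral \<gamma> (\<lambda>w. v w / (w - z)) + contour_integral \<gamma> (\<lambda>w. v w / (w - inverse z))
      - contour_integral \<gamma> (\<lambda>w. v w / w ^ Suc 0)"
    using int_H[OF z(2)] int_H[OF iz] integrable[of "Suc 0"]
    by (simp only: contour_integral_add contour_integral_diff contour_integrable_add)
  finally have eq: "2 * pi * \<i> * u (joukowski z) = contour_integral \<gamma> (\<lambda>w. v w / (w - z))
      + contour_integral \<gamma> (\<lambda>w. v w / (w - inverse z)) - contour_integral \<gamma> (\<lambda>w. v w / w ^ Suc 0)" .
  have "u (joukowski z) = (2 * pi * \<i> * u (joukowski z)) / (2 * pi * \<i>)" by simp
  then have "u (joukowski z) = H z + H (inverse z) - a 0"
    unfolding eq H_def a_def by (simp only: add_divide_distrib diff_divide_distrib)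
  then have "u (joukowski z) - laurent_sum N a z = (H z - (\<Sum>k<Suc N. a k * z ^ k)) + (H (inverse z) - (\<Sum>k<Suc N. a k * inverse z ^ k))"
    by (simp add: laurent_sum_eq)
  then show "cmod (u (joukowski z) - laurent_sum N a z) \<le> 2 * (M * \<rho> / (\<rho> - r) * (r / \<rho>) ^ Suc N)"
    using H[OF z(2)] H[OF iz] norm_triangle_ineq[of "H z - (\<Sum>k<Suc N. a k * z ^ k)" "H (inverse z) - (\<Sum>k<Suc N. a k * inverse z ^ k)"]
    by simp
qed

section \<open>Approximation of holomorphic functions by polynomials on the interval\<close>

lemma approximation_smooth:
  assumes hol: "u holomorphic_on tube t" and bound: "\<And>z. z \<in> tube t \<Longrightarrow> cmod (u z) \<le> M"
    and \<rho>: "1 < \<rho>" "\<rho> < t + sqrt (1 + t\<^sup>2)" and \<epsilon>: "\<epsilon> > 0"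
  obtains p where "p = 0 \<or> degree p < n"
    and "\<And>x. \<bar>x\<bar> \<le> 1 \<Longrightarrow> \<bar>Re (u (of_real x)) - poly p x\<bar>
        \<le> smooth_rate (1 / \<rho> ^ n) * M + \<epsilon>"
proof -
  define B where "B = smooth_rate (1 / \<rho> ^ n)"
  have B: "B \<ge> 0" using \<rho> by (simp add: B_def)
  \<comment> \<open>The smoothing needs values up to radius rho inclusive, whereas the expansion
    converges only inside its own circle; hence the coefficients are taken from a larger
    radius.\<close>
  obtain R where R: "\<rho> < R" "R < t + sqrt (1 + t\<^sup>2)" using dense \<rho>(2) by blast
  obtain a where a: "\<And>z r N. 1 \<le> cmod z \<Longrightarrow> cmod z \<le> r \<Longrightarrow> r < R \<Longrightarrow>
      cmod (u (joukowski z) - laurent_sum N a z) \<le> 2 * (M * R / (R - r) * (r / R) ^ Suc N)"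
    using chebyshev_expansion[OF hol bound, of R] R \<rho>(1) by (metis order.strict_trans)
  \<comment> \<open>The truncation error enters once directly and once, multiplied by B, through the
    bound M + eta of the truncated sum; so eta (B + 1) is the available epsilon.\<close>
  define \<eta> where "\<eta> = \<epsilon> / (B + 1)"
  have \<eta>: "\<eta> > 0" using \<epsilon> B by (simp add: \<eta>_def)
  have "(\<lambda>N. 2 * (M * R / (R - \<rho>) * (\<rho> / R) ^ Suc N)) \<longlonglongrightarrow> 2 * (M * R / (R - \<rho>) * 0)"
    using \<rho> R by (intro tendsto_intros LIMSEQ_Suc LIMSEQ_power_zero) auto
  then have "\<forall>\<^sub>F N in sequentially. 2 * (M * R / (R - \<rho>) * (\<rho> / R) ^ Suc N) < \<eta>"
    using \<eta> by (intro order_tendstoD(2)) auto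
  then obtain N where N: "2 * (M * R / (R - \<rho>) * (\<rho> / R) ^ Suc N) < \<eta>"
    unfolding eventually_sequentially by blast
  have close: "cmod (u (joukowski z) - laurent_sum N a z) \<le> \<eta>" if "1 \<le> cmod z" "cmod z \<le> \<rho>" for z
    using a[OF that R(1), of N] N by simp
  have "cmod (laurent_sum N a z) \<le> M + \<eta>" if z: "1 \<le> cmod z" "cmod z \<le> \<rho>" for z
  proof -
    have "cmod (u (joukowski z)) \<le> M" using z \<rho> by (intro bound joukowski_in_tube) auto
    then show ?thesis
      using close[OF z] norm_triangle_ineq3[of "u (joukowski z)" "laurent_sum N a z"] by linarith
  qed
  then obtain p where p: "p = 0 \<or> degree p < n"
    "\<And>x. \<bar>x\<bar> \<le> 1 \<Longrightarrow> \<bar>Re (laurent_sum N a (cis (arccos x))) - poly p x\<bar> \<le> B * (M + \<eta>)"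
    unfolding B_def using laurent_sum_smooth_bound[of \<rho> N a "M + \<eta>" n] \<rho>(1) by blast
  show ?thesis
  proof (rule that[OF p(1)])
    fix x :: real assume x: "\<bar>x\<bar> \<le> 1"
    have "\<bar>Re (u (of_real x)) - Re (laurent_sum N a (cis (arccos x)))\<bar> \<le> \<eta>"
      using close[of "cis (arccos x)"] \<rho>(1) x abs_Re_le_cmod[of "u (of_real x) - laurent_sum N a (cis (arccos x))"]
      by (simp add: joukowski_cis abs_le_iff)
    moreover have "B * (M + \<eta>) + \<eta> = B * M + \<epsilon>"
    proof -
      have "\<eta> * (B + 1) = \<epsilon>" using B by (simp add: \<eta>_def)
      then show ?thesis by (simp add: algebra_simps)
    qed
    ultimately show "\<bar>Re (u (of_real x)) - poly p x\<bar>
        \<le> smooth_rate (1 / \<rho> ^ n) * M + \<epsilon>"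
      using p(2)[OF x] unfolding B_def[symmetric] by linarith
  qed
qed

lemma approximation_even:
  assumes hol: "u holomorphic_on tube t" and bound: "\<And>z. z \<in> tube t \<Longrightarrow> cmod (u z) \<le> M"
    and \<rho>: "1 < \<rho>" "\<rho> < t + sqrt (1 + t\<^sup>2)" and \<epsilon>: "\<epsilon> > 0" and "even n"
  obtains p q where "p = 0 \<or> degree p < n" "\<And>x. poly q (- x) = - poly q x"
    and "\<And>x. \<bar>x\<bar> \<le> 1 \<Longrightarrow> \<bar>Re (u (of_real x)) - poly p x - poly q x\<bar> \<le> 2 * M / (\<rho> ^ n * (1 - 1 / \<rho>\<^sup>2)) + \<epsilon>"
proof -
  obtain a where a: "\<And>k. cmod (a k) \<le> M / \<rho> ^ k" "\<And>z r N. 1 \<le> cmod z \<Longrightarrow> cmod z \<le> r \<Longrightarrow> r < \<rho> \<Longrightarrow>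
      cmod (u (joukowski z) - laurent_sum N a z) \<le> 2 * (M * \<rho> / (\<rho> - r) * (r / \<rho>) ^ Suc N)"
    using chebyshev_expansion[OF hol bound \<rho>] by metis
  \<comment> \<open>Here the truncated sum is compared with u on the unit circle only, so r = 1
    suffices and rho itself serves as the radius of the expansion.\<close>
  have "(\<lambda>N. 2 * (M * \<rho> / (\<rho> - 1) * (1 / \<rho>) ^ Suc N)) \<longlonglongrightarrow> 2 * (M * \<rho> / (\<rho> - 1) * 0)"
    using \<rho> by (intro tendsto_intros LIMSEQ_Suc LIMSEQ_power_zero) auto
  then have "\<forall>\<^sub>F N in sequentially. 2 * (M * \<rho> / (\<rho> - 1) * (1 / \<rho>) ^ Suc N) < \<epsilon>"
    using \<epsilon> by (intro order_tendstoD(2)) auto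
  then obtain N where N: "2 * (M * \<rho> / (\<rho> - 1) * (1 / \<rho>) ^ Suc N) < \<epsilon>"
    unfolding eventually_sequentially by blast
  obtain p q where pq: "p = 0 \<or> degree p < n" "\<And>x. poly q (- x) = - poly q x"
    "\<And>x. \<bar>x\<bar> \<le> 1 \<Longrightarrow> \<bar>Re (laurent_sum N a (cis (arccos x))) - poly p x - poly q x\<bar> \<le> 2 * M / (\<rho> ^ n * (1 - 1 / \<rho>\<^sup>2))"
    using laurent_sum_tail_bound[OF a(1) \<rho>(1) \<open>even n\<close>] by metis
  show ?thesis
  proof (rule that[OF pq(1,2)])
    fix x :: real assume x: "\<bar>x\<bar> \<le> 1"
    have "\<bar>Re (u (of_real x)) - Re (laurent_sum N a (cis (arccos x)))\<bar> \<le> \<epsilon>"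
      using a(2)[of "cis (arccos x)" 1 N] N \<rho>(1) x abs_Re_le_cmod[of "u (of_real x) - laurent_sum N a (cis (arccos x))"]
      by (simp add: joukowski_cis abs_le_iff)
    then show "\<bar>Re (u (of_real x)) - poly p x - poly q x\<bar> \<le> 2 * M / (\<rho> ^ n * (1 - 1 / \<rho>\<^sup>2)) + \<epsilon>"
      using pq(3)[OF x] by linarith
  qed
qed

section \<open>Counting odd multi-indices in a simplex\<close>

text \<open>The first inequality is the midpoint rule for the convex function t^p on [x - h, x + h].
  The second one is the midpoint inequality for the endpoint values; both are proved together
  because the induction step of the first uses it.\<close>

lemma power_diff_lower:
  fixes x h :: real
  assumes "0 \<le> h" "h \<le> x"
  shows "2 * h * real (Suc p) * x ^ p \<le> (x + h) ^ Suc p - (x - h) ^ Suc p"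
    and "2 * x ^ p \<le> (x + h) ^ p + (x - h) ^ p"
proof (induction p)
  case 0
  {
    case 1 show ?case by simp
  next
    case 2 show ?case by simp
  }
next
  case (Suc p)
  have s: "2 * x ^ Suc p \<le> (x + h) ^ Suc p + (x - h) ^ Suc p"
  proof -
    have "(x + h) ^ Suc p + (x - h) ^ Suc p = x * ((x + h) ^ p + (x - h) ^ p) + h * ((x + h) ^ p - (x - h) ^ p)"
      by (simp add: algebra_simps)
    moreover have "x * (2 * x ^ p) \<le> x * ((x + h) ^ p + (x - h) ^ p)"
      using Suc(2) assms by (intro mult_left_mono) auto
    moreover have "0 \<le> h * ((x + h) ^ p - (x - h) ^ p)"
      using assms by (intro mult_nonneg_nonneg) (auto intro!: power_mono)
    ultimately show ?thesis by simp
  qed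
  {
    case 1
    have "(x + h) ^ Suc (Suc p) - (x - h) ^ Suc (Suc p)
        = x * ((x + h) ^ Suc p - (x - h) ^ Suc p) + h * ((x + h) ^ Suc p + (x - h) ^ Suc p)"
      by (simp add: algebra_simps)
    moreover have "x * (2 * h * real (Suc p) * x ^ p) \<le> x * ((x + h) ^ Suc p - (x - h) ^ Suc p)"
      using Suc(1) assms by (intro mult_left_mono) auto
    moreover have "h * (2 * x ^ Suc p) \<le> h * ((x + h) ^ Suc p + (x - h) ^ Suc p)"
      using s assms by (intro mult_left_mono) auto
    moreover have "2 * h * real (Suc (Suc p)) * x ^ Suc p = x * (2 * h * real (Suc p) * x ^ p) + h * (2 * x ^ Suc p)"
      by (simp add: algebra_simps)
    ultimately show ?case by linarith
  next
    case 2 show ?case by (rule s)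
  }
qed

text \<open>The midpoint rule when [x - h, x + h] extends below 0, where the truncated power
  vanishes. The exponent of x starts at 1 because for exponent 0 the inequality 2h <= x + h is false
  for x < h; this is why indicator functions cannot be compared directly.\<close>

lemma power_lower:
  fixes x h :: real
  assumes "0 \<le> x" "x \<le> h"
  shows "2 * h * real (Suc (Suc p)) * x ^ Suc p \<le> (x + h) ^ Suc (Suc p)"
proof (induction p)
  case 0
  show ?case using zero_le_power2[of "x - h"] by (simp add: power2_eq_square algebra_simps)
next
  case (Suc p)
  have "(x + h) * (2 * h * real (Suc (Suc p)) * x ^ Suc p) \<le> (x + h) * (x + h) ^ Suc (Suc p)"
    using Suc assms by (intro mult_left_mono) auto
  moreover have "x * real (Suc (Suc (Suc p))) \<le> (x + h) * real (Suc (Suc p))"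
    using assms by (simp add: algebra_simps) (smt (verit) mult_nonneg_nonneg of_nat_0_le_iff)
  then have "x * real (Suc (Suc (Suc p))) * (2 * h * x ^ Suc p) \<le> (x + h) * real (Suc (Suc p)) * (2 * h * x ^ Suc p)"
    using assms by (intro mult_right_mono) auto
  moreover have "2 * h * real (Suc (Suc (Suc p))) * x ^ Suc (Suc p) = x * real (Suc (Suc (Suc p))) * (2 * h * x ^ Suc p)"
    "(x + h) * real (Suc (Suc p)) * (2 * h * x ^ Suc p) = (x + h) * (2 * h * real (Suc (Suc p)) * x ^ Suc p)"
    by simp_all
  ultimately show ?case by (simp only: power_Suc[of "x + h" "Suc (Suc p)"])
qed

lemma sum_midpoints_le:
  fixes a w :: real
  assumes w: "w > 0" and p: "p > 0"
  shows "2 * w * real (Suc p) * (\<Sum>i<N. max 0 (a - real (2 * i + 1) * w) ^ p) \<le> max 0 a ^ Suc p"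
proof (induction N arbitrary: a)
  case (Suc N)
  have shift: "(\<Sum>i<Suc N. max 0 (a - real (2 * i + 1) * w) ^ p)
      = max 0 (a - w) ^ p + (\<Sum>i<N. max 0 (a - 2 * w - real (2 * i + 1) * w) ^ p)"
    by (subst sum.lessThan_Suc_shift) (simp add: algebra_simps)
  have "2 * w * real (Suc p) * max 0 (a - w) ^ p + max 0 (a - 2 * w) ^ Suc p \<le> max 0 a ^ Suc p"
  proof -
    \<comment> \<open>The interval [a - 2w, a] has its midpoint at most 0, or contains 0 to the left
      of its midpoint, or lies in the nonnegative axis.\<close>
    consider "a \<le> w" | "w < a" "a < 2 * w" | "2 * w \<le> a" by linarith
    then show ?thesis
    proof cases
      case 1
      then have "max 0 (a - w) = 0" "max 0 (a - 2 * w) = 0" using w by auto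
      then show ?thesis using p by (simp only: zero_power) simp
    next
      case 2
      obtain p' where p': "p = Suc p'" using p by (cases p) auto
      show ?thesis using power_lower[of "a - w" w p'] 2 w by (simp add: max_def p')
    next
      case 3
      show ?thesis using power_diff_lower(1)[of w "a - w" p] 3 w by (simp add: max_def)
    qed
  qed
  moreover note Suc[of "a - 2 * w"]
  ultimately show ?case unfolding shift by (simp only: distrib_left)
qed simp

text \<open>
  Summing the convex function $t \mapsto \max(0, a - t)$ instead of an indicator function allows for the
  comparison with an integral by the midpoint rule; the count then follows with $a = q (1 + 1/s)$.
\<close>
lemma sum_simplex_excess:
  fixes w :: "'a \<Rightarrow> real"
  assumes "finite S" "\<And>k. k \<in> S \<Longrightarrow> w k > 0"
  shows "(\<Sum>\<beta>\<in>PiE S (\<lambda>_. {..<N}). max 0 (a - (\<Sum>k\<in>S. real (2 * \<beta> k + 1) * w k)))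
      * (fact (Suc (card S)) * (\<Prod>k\<in>S. 2 * w k)) \<le> max 0 a ^ Suc (card S)"
  using assms
proof (induction S arbitrary: a rule: finite_induct)
  case (insert k S)
  define E where "E S a = (\<Sum>\<beta>\<in>PiE S (\<lambda>_. {..<N}). max 0 (a - (\<Sum>k\<in>S. real (2 * \<beta> k + 1) * w k)))" for S and a :: real
  define c where "c = fact (Suc (card S)) * (\<Prod>k\<in>S. 2 * w k)"
  have "E (insert k S) a = (\<Sum>(i, \<beta>)\<in>{..<N} \<times> PiE S (\<lambda>_. {..<N}).
      max 0 (a - (\<Sum>j\<in>insert k S. real (2 * (\<beta>(k := i)) j + 1) * w j)))"
    unfolding E_def PiE_insert_eq
    by (subst sum.reindex[OF inj_combinator[OF insert(2)]]) (simp add: case_prod_unfold)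
  also have "\<dots> = (\<Sum>(i, \<beta>)\<in>{..<N} \<times> PiE S (\<lambda>_. {..<N}).
      max 0 ((a - real (2 * i + 1) * w k) - (\<Sum>j\<in>S. real (2 * \<beta> j + 1) * w j)))"
  proof (intro sum.cong refl, clarify)
    fix i \<beta>
    have "(\<Sum>j\<in>S. real (2 * (\<beta>(k := i)) j + 1) * w j) = (\<Sum>j\<in>S. real (2 * \<beta> j + 1) * w j)"
      using insert(2) by (intro sum.cong) auto
    then show "max 0 (a - (\<Sum>j\<in>insert k S. real (2 * (\<beta>(k := i)) j + 1) * w j))
        = max 0 ((a - real (2 * i + 1) * w k) - (\<Sum>j\<in>S. real (2 * \<beta> j + 1) * w j))"
      using insert(1,2) by (simp add: algebra_simps)
  qed
  also have "\<dots> = (\<Sum>i<N. E S (a - real (2 * i + 1) * w k))"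
    by (simp add: E_def sum.cartesian_product)
  finally have E: "E (insert k S) a = (\<Sum>i<N. E S (a - real (2 * i + 1) * w k))" .
  have wk: "w k > 0" using insert by auto
  have "E (insert k S) a * c = (\<Sum>i<N. E S (a - real (2 * i + 1) * w k) * c)"
    by (simp add: E sum_distrib_right)
  also have "\<dots> \<le> (\<Sum>i<N. max 0 (a - real (2 * i + 1) * w k) ^ Suc (card S))"
    unfolding E_def c_def using insert by (intro sum_mono) auto
  finally have "E (insert k S) a * c * (2 * w k * real (Suc (Suc (card S))))
      \<le> (\<Sum>i<N. max 0 (a - real (2 * i + 1) * w k) ^ Suc (card S)) * (2 * w k * real (Suc (Suc (card S))))"
    using wk by (intro mult_right_mono) auto
  also have "\<dots> \<le> max 0 a ^ Suc (Suc (card S))"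
    using sum_midpoints_le[OF wk zero_less_Suc[of "card S"], where N = N and a = a] by (simp only: mult_ac)
  finally have le: "E (insert k S) a * c * (2 * w k * real (Suc (Suc (card S)))) \<le> max 0 a ^ Suc (Suc (card S))" .
  have eq: "E (insert k S) a * (fact (Suc (card (insert k S))) * (\<Prod>j\<in>insert k S. 2 * w j))
      = E (insert k S) a * c * (2 * w k * real (Suc (Suc (card S))))"
    using insert(1,2) by (simp add: c_def)
  have "E (insert k S) a * (fact (Suc (card (insert k S))) * (\<Prod>j\<in>insert k S. 2 * w j))
      \<le> max 0 a ^ Suc (card (insert k S))"
    by (subst eq) (subst card_insert_disjoint[OF insert(1,2)], rule le)
  then show ?case by (simp only: E_def)
qed (simp add: PiE_empty_domain)

text \<open>Odd levels are encoded by their halves, as 2 beta + 1, and N is a cutoff that makes the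
  set finite.\<close>

abbreviation odd_simplex :: "'a set \<Rightarrow> ('a \<Rightarrow> real) \<Rightarrow> nat \<Rightarrow> real \<Rightarrow> ('a \<Rightarrow> nat) set" where
  "odd_simplex S w N q \<equiv> {\<beta> \<in> PiE S (\<lambda>_. {..<N}). (\<Sum>k\<in>S. real (2 * \<beta> k + 1) * w k) \<le> q}"

lemma card_odd_simplex_le:
  fixes w :: "'a \<Rightarrow> real"
  assumes "finite S" "S \<noteq> {}" "\<And>k. k \<in> S \<Longrightarrow> w k > 0" and q: "q > 0"
  defines "s \<equiv> card S"
  shows "real (card (odd_simplex S w N q)) * (\<Prod>k\<in>S. 2 * w k)
      \<le> q ^ s * (1 + 1 / real s) ^ s / fact s"
proof -
  define X where "X = odd_simplex S w N q"
  define P where "P = (\<Prod>k\<in>S. 2 * w k)"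
  have P: "P > 0" using assms by (auto simp: P_def intro!: prod_pos)
  have s: "s > 0" using assms by (simp add: s_def card_gt_0_iff)
  \<comment> \<open>Every counted point has excess at least a - q, so the count is bounded by a
    multiple of a^(s+1) / (a - q); this a minimizes the quotient.\<close>
  define a where "a = q * (1 + 1 / real s)"
  have aq: "a - q = q / real s" by (simp add: a_def algebra_simps)
  have a: "a > 0" using q by (simp add: a_def add_pos_nonneg)
  have fin: "finite (PiE S (\<lambda>_. {..<N}))" using assms by (intro finite_PiE) auto
  have "real (card X) * (q / real s) = (\<Sum>\<beta>\<in>X. a - q)" by (simp add: aq)
  also have "\<dots> \<le> (\<Sum>\<beta>\<in>X. max 0 (a - (\<Sum>k\<in>S. real (2 * \<beta> k + 1) * w k)))"
    by (intro sum_mono) (auto simp: X_def)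
  also have "\<dots> \<le> (\<Sum>\<beta>\<in>PiE S (\<lambda>_. {..<N}). max 0 (a - (\<Sum>k\<in>S. real (2 * \<beta> k + 1) * w k)))"
    using fin by (intro sum_mono2) (auto simp: X_def)
  finally have "real (card X) * (q / real s) * (fact (Suc s) * P) \<le> a ^ Suc s"
    using sum_simplex_excess[of S w, where N = N and a = a] assms a P
    by (smt (verit, best) P_def fact_gt_zero mult_pos_pos mult_right_mono s_def)
  then have "real (card X) * (q / real s) * (fact (Suc s) * P) \<le> q * (1 + 1 / real s) * (q ^ s * (1 + 1 / real s) ^ s)"
    by (simp add: a_def power_mult_distrib)
  moreover have eq: "(q / real s) * (fact (Suc s) * P) = q * (1 + 1 / real s) * (fact s * P)"
    using s by (simp add: field_simps)
  have "real (card X) * (q / real s) * (fact (Suc s) * P) = q * (1 + 1 / real s) * (real (card X) * (fact s * P))"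
    unfolding mult.assoc[of "real (card X)"] eq by simp
  ultimately have "q * (1 + 1 / real s) * (real (card X) * (fact s * P)) \<le> q * (1 + 1 / real s) * (q ^ s * (1 + 1 / real s) ^ s)"
    by simp
  then have "real (card X) * (fact s * P) \<le> q ^ s * (1 + 1 / real s) ^ s"
    using a by (simp add: a_def del: mult_le_cancel_left) (simp add: mult_le_cancel_left_pos)
  then have "real (card X) * P \<le> q ^ s * (1 + 1 / real s) ^ s / fact s"
    by (simp add: pos_le_divide_eq mult_ac)
  then show ?thesis by (simp add: X_def P_def)
qed

section \<open>Weighing powers of the mean against the volume of the simplex\<close>

lemma one_plus_inverse_power_le: "n > 0 \<Longrightarrow> (1 + 1 / real n) ^ n \<le> 3"
proof -
  assume n: "n > 0"
  have "(1 + 1 / real n) ^ n \<le> exp (1 / real n) ^ n"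
    by (intro power_mono exp_ge_add_one_self) auto
  also have "\<dots> = exp 1" using n by (simp add: exp_of_nat_mult[symmetric])
  also have "\<dots> \<le> 3" by (rule exp_le)
  finally show ?thesis .
qed

text \<open>The bound 43/10 is about the largest one for which the case \<open>s = 3\<close> still holds.\<close>
lemma simplex_scalar_inequality:
  fixes v :: real
  assumes v: "0 \<le> v" "v \<le> 43 / 10" and s: "s > 0"
  shows "v ^ s * ((1 + 1 / real s) ^ s / fact s) \<le> 2 * (1 + 2 / 3 * real s + real s * v)"
proof -
  have pow: "v ^ Suc k \<le> v * (43 / 10) ^ k" for k
    using v by (simp add: mult_left_mono power_mono)
  consider "s = 1" | "s = 2" | "s = 3" | "s = 4" | "s \<ge> 5" using s by linarith
  then show ?thesis
  proof cases
    case 1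
    then show ?thesis by simp
  next
    case 2
    show ?thesis using pow[of 1] v by (simp add: 2 fact_numeral power2_eq_square)
  next
    case 3
    show ?thesis using pow[of 2] v by (simp add: 3 fact_numeral eval_nat_numeral)
  next
    case 4
    show ?thesis using pow[of 3] v by (simp add: 4 fact_numeral eval_nat_numeral)
  next
    case 5
    \<comment> \<open>From s = 5 on, the term 2 s v alone absorbs the left-hand side, with (1 +
      1/s)^s replaced by 3; the induction step works since 43/10 < 5.\<close>
    have "3 * (43 / 10) ^ (s - 1) \<le> (2 * real s * fact s :: real)"
      using 5
    proof (induction s rule: dec_induct)
      case base
      show ?case by (simp add: fact_numeral eval_nat_numeral)
    next
      case (step k)
      have "3 * (43 / 10) ^ (Suc k - 1) = 43 / 10 * (3 * (43 / 10 :: real) ^ (k - 1))"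
        using step by (cases k) auto
      also have "\<dots> \<le> 43 / 10 * (2 * real k * fact k)" using step by (simp add: mult_ac)
      also have "\<dots> \<le> real (Suc k) * (2 * real (Suc k) * fact k)"
        using step by (intro order_trans[OF mult_right_mono[of "43 / 10" "real (Suc k)"]]) (auto intro!: mult_left_mono mult_right_mono)
      also have "\<dots> = 2 * real (Suc k) * fact (Suc k)" by simp
      finally show ?case .
    qed
    then have "v * (3 * (43 / 10) ^ (s - 1)) \<le> v * (2 * real s * fact s)"
      using v by (intro mult_left_mono)
    moreover have "v ^ s * (1 + 1 / real s) ^ s \<le> v * (43 / 10) ^ (s - 1) * 3"
      using pow[of "s - 1"] s v one_plus_inverse_power_le[OF s] by (intro mult_mono) auto
    ultimately have "v ^ s * (1 + 1 / real s) ^ s \<le> 2 * (real s * v) * fact s"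
      by (simp add: mult_ac)
    then have "v ^ s * ((1 + 1 / real s) ^ s / fact s) \<le> 2 * (real s * v)"
      by (simp add: pos_divide_le_eq)
    then show ?thesis by (simp add: add_nonneg_nonneg)
  qed
qed

lemma prod_le_mean_power:
  fixes p :: "'a \<Rightarrow> real"
  assumes "finite S" "S \<noteq> {}" "\<And>k. k \<in> S \<Longrightarrow> p k \<ge> 0"
  shows "(\<Prod>k\<in>S. p k) \<le> (sum p S / real (card S)) ^ card S"
proof -
  define n where "n = card S"
  have n: "n > 0" using assms by (simp add: n_def card_gt_0_iff)
  have nn: "0 \<le> (\<Prod>k\<in>S. p k)" using assms by (intro prod_nonneg) auto
  have "(\<Prod>k\<in>S. p k) powr (1 / n) \<le> sum p S / n"
    using arith_geom_mean[OF assms] by (simp add: n_def sum_divide_distrib)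
  then have "((\<Prod>k\<in>S. p k) powr (1 / n)) ^ n \<le> (sum p S / n) ^ n"
    by (intro power_mono) auto
  moreover have "((\<Prod>k\<in>S. p k) powr (1 / n)) ^ n = (\<Prod>k\<in>S. p k)"
    using n nn by (cases "(\<Prod>k\<in>S. p k) = 0") (auto simp: powr_realpow[symmetric] powr_powr)
  ultimately show ?thesis by (simp add: n_def)
qed

text \<open>The factors 2 w cancel against the volume of the simplex, and the p_k are replaced by
  their mean. The slack 1/3 in the bound of p_k and the 2/3 per variable in
  \<open>simplex_scalar_inequality\<close> add up to the summand 1 per variable on the
  right.\<close>

lemma support_term_bound:
  fixes w x p c :: "'a \<Rightarrow> real"
  assumes S: "finite S" and q: "q \<ge> 1"
    and pos: "\<And>k. k \<in> S \<Longrightarrow> w k > 0" "\<And>k. k \<in> S \<Longrightarrow> x k > 0"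
    and p: "\<And>k. k \<in> S \<Longrightarrow> 0 \<le> p k" "\<And>k. k \<in> S \<Longrightarrow> p k \<le> 43 / 10" "\<And>k. k \<in> S \<Longrightarrow> p k \<le> x k + 1 / 3"
  shows "(\<Prod>k\<in>S. x k * (2 * w k) * p k) * real (card (odd_simplex S w N q))
      \<le> 2 * ((\<Prod>k\<in>S. q * x k) * (1 + (\<Sum>k\<in>S. 1 + q * x k)))"
proof (cases "S = {}")
  case True
  have "card (odd_simplex S w N q) \<le> card {\<lambda>x :: 'a. undefined :: nat}"
    by (rule card_mono) (auto simp: True PiE_empty_domain)
  then show ?thesis by (simp add: True)
next
  case False
  define s where "s = card S"
  define C where "C = real (card (odd_simplex S w N q))"
  define v where "v = sum p S / real s"
  have s: "s > 0" using S False by (simp add: s_def card_gt_0_iff)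
  have X: "(\<Prod>k\<in>S. x k) \<ge> 0" using pos by (intro prod_nonneg) (auto intro: less_imp_le)
  have P: "(\<Prod>k\<in>S. p k) \<ge> 0" using p by (intro prod_nonneg) auto
  have v: "0 \<le> v" "v \<le> 43 / 10"
    using p(1) sum_bounded_above[of S p "43 / 10"] p(2) s by (auto simp: v_def s_def sum_nonneg field_simps)
  have count: "C * (\<Prod>k\<in>S. 2 * w k) \<le> q ^ s * ((1 + 1 / real s) ^ s / fact s)"
    using card_odd_simplex_le[OF S False pos(1), where q = q and N = N] q by (simp add: C_def s_def)
  have "(\<Prod>k\<in>S. x k * (2 * w k) * p k) * C = (\<Prod>k\<in>S. x k) * (\<Prod>k\<in>S. p k) * (C * (\<Prod>k\<in>S. 2 * w k))"
    by (simp add: prod.distrib mult_ac)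
  also have "\<dots> \<le> (\<Prod>k\<in>S. x k) * (\<Prod>k\<in>S. p k) * (q ^ s * ((1 + 1 / real s) ^ s / fact s))"
    using count X P by (intro mult_left_mono) auto
  also have "\<dots> \<le> (\<Prod>k\<in>S. x k) * v ^ s * (q ^ s * ((1 + 1 / real s) ^ s / fact s))"
    using prod_le_mean_power[OF S False p(1)] X q
    by (intro mult_right_mono mult_left_mono) (auto simp: v_def s_def)
  also have "\<dots> = (\<Prod>k\<in>S. q * x k) * (v ^ s * ((1 + 1 / real s) ^ s / fact s))"
    by (simp add: prod.distrib s_def mult_ac)
  also have "\<dots> \<le> (\<Prod>k\<in>S. q * x k) * (2 * (1 + 2 / 3 * real s + real s * v))"
    using simplex_scalar_inequality[OF v s] pos q by (intro mult_left_mono prod_nonneg) (auto intro: less_imp_le)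
  also have "\<dots> \<le> (\<Prod>k\<in>S. q * x k) * (2 * (1 + (\<Sum>k\<in>S. 1 + q * x k)))"
  proof (intro mult_left_mono prod_nonneg)
    have "real s * v = sum p S" using s by (simp add: v_def)
    moreover have "sum p S \<le> (\<Sum>k\<in>S. q * x k + 1 / 3)"
    proof (rule sum_mono)
      fix k assume k: "k \<in> S"
      have "x k \<le> q * x k" using pos(2)[OF k] q by simp
      then show "p k \<le> q * x k + 1 / 3" using p(3)[OF k] by linarith
    qed
    ultimately show "1 + 2 / 3 * real s + real s * v \<le> 1 + (\<Sum>k\<in>S. 1 + q * x k)"
      by (simp add: sum.distrib s_def)
  qed (use pos q in \<open>auto intro: less_imp_le\<close>)
  finally show ?thesis by (simp only: C_def mult.left_commute[of "2 :: real"])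
qed

section \<open>Summation over supports and multi-indices\<close>

lemma sum_Pow_prod_insert:
  fixes F :: "'a set \<Rightarrow> real"
  assumes "finite A" "k \<notin> A"
  shows "(\<Sum>S\<in>Pow (insert k A). F S) = (\<Sum>S\<in>Pow A. F S + F (insert k S))"
proof -
  have "(\<Sum>S\<in>Pow (insert k A). F S) = (\<Sum>S\<in>Pow A. F S) + (\<Sum>S\<in>insert k ` Pow A. F S)"
    unfolding Pow_insert using assms by (intro sum.union_disjoint) auto
  also have "(\<Sum>S\<in>insert k ` Pow A. F S) = (\<Sum>S\<in>Pow A. F (insert k S))"
    using assms by (subst sum.reindex) (auto simp: inj_on_def insert_ident subset_iff)
  finally show ?thesis by (simp add: sum.distrib)
qed

text \<open>For u \<ge> 0, think of a random subset that contains each k independently with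
  probability u_k / (1 + u_k). Then k contributes (1 + u_k) u_k / (1 + u_k) = u_k to the mean of the
  weight, and normalization gives the product of the 1 + u_k.\<close>

lemma sum_Pow_prod_weighted:
  fixes u :: "'a \<Rightarrow> real"
  assumes "finite A"
  shows "(\<Sum>S\<in>Pow A. (\<Prod>k\<in>S. u k) * (1 + (\<Sum>k\<in>S. 1 + u k))) = (\<Prod>k\<in>A. 1 + u k) * (1 + (\<Sum>k\<in>A. u k))"
  using assms
proof (induction A rule: finite_induct)
  case (insert k A)
  let ?G = "\<lambda>S. \<Prod>k\<in>S. u k" and ?H = "\<lambda>S. \<Sum>k\<in>S. 1 + u k"
  have G: "(\<Sum>S\<in>Pow A. ?G S) = (\<Prod>k\<in>A. 1 + u k)"
    using prod_add[OF insert(1), of u "\<lambda>_. 1"] by (simp add: add.commute)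
  have "(\<Sum>S\<in>Pow (insert k A). ?G S * (1 + ?H S))
      = (\<Sum>S\<in>Pow A. ?G S * (1 + ?H S) + ?G (insert k S) * (1 + ?H (insert k S)))"
    by (rule sum_Pow_prod_insert[OF insert(1,2)])
  also have "\<dots> = (\<Sum>S\<in>Pow A. (1 + u k) * (?G S * (1 + ?H S)) + (1 + u k) * u k * ?G S)"
  proof (rule sum.cong[OF refl])
    fix S assume "S \<in> Pow A"
    then have "finite S" "k \<notin> S" using insert finite_subset by auto
    then show "?G S * (1 + ?H S) + ?G (insert k S) * (1 + ?H (insert k S))
        = (1 + u k) * (?G S * (1 + ?H S)) + (1 + u k) * u k * ?G S"
      by (simp add: algebra_simps)
  qed
  also have "\<dots> = (1 + u k) * (\<Sum>S\<in>Pow A. ?G S * (1 + ?H S)) + (1 + u k) * u k * (\<Sum>S\<in>Pow A. ?G S)"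
    by (simp only: sum.distrib[of "\<lambda>S. (1 + u k) * (?G S * (1 + ?H S))"] sum_distrib_left)
  also have "\<dots> = (1 + u k) * ((\<Prod>k\<in>A. 1 + u k) * (1 + (\<Sum>k\<in>A. u k))) + (1 + u k) * u k * (\<Prod>k\<in>A. 1 + u k)"
    by (simp only: insert.IH G)
  also have "\<dots> = (\<Prod>k\<in>insert k A. 1 + u k) * (1 + (\<Sum>k\<in>insert k A. u k))"
    using insert(1,2) by (simp add: algebra_simps)
  finally show ?case .
qed simp

lemma index_set_bound:
  assumes "\<And>n. n \<in> {1..m} \<Longrightarrow> w n > 0" "\<alpha> \<in> index_set w q m" "n \<in> {1..m}"
  shows "real (\<alpha> n) * w n \<le> real q"
proof -
  have "real (\<alpha> n) * w n \<le> (\<Sum>n=1..m. real (\<alpha> n) * w n)"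
    using assms(3) less_imp_le[OF assms(1)] by (intro member_le_sum) (auto intro!: mult_nonneg_nonneg)
  then show ?thesis using assms(2) by (simp add: index_set_def)
qed

lemma index_set_subset_bounded:
  assumes "\<And>n. n \<in> {1..m} \<Longrightarrow> w n > 0"
  shows "\<exists>N. \<forall>\<alpha>\<in>index_set w q m. \<forall>n\<in>{1..m}. \<alpha> n < N"
proof -
  \<comment> \<open>A sum instead of a maximum serves as the common bound, which also covers m =
    0.\<close>
  define N where "N = Suc (nat \<lfloor>\<Sum>n=1..m. real q / w n\<rfloor>)"
  show ?thesis
  proof (intro exI[of _ N] ballI)
    fix \<alpha> n assume \<alpha>: "\<alpha> \<in> index_set w q m" and n: "n \<in> {1..m}"
    have "real (\<alpha> n) \<le> real q / w n"
      using index_set_bound[OF assms \<alpha> n] assms[OF n] by (simp add: pos_le_divide_eq)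
    also have "\<dots> \<le> (\<Sum>n=1..m. real q / w n)"
      using n less_imp_le[OF assms] by (intro member_le_sum) (auto intro!: divide_nonneg_nonneg)
    finally have "\<alpha> n \<le> nat \<lfloor>\<Sum>n=1..m. real q / w n\<rfloor>" by linarith
    then show "\<alpha> n < N" by (simp add: N_def)
  qed
qed

lemma finite_index_set:
  assumes "\<And>n. n \<in> {1..m} \<Longrightarrow> w n > 0"
  shows "finite (index_set w q m)"
proof -
  obtain N where N: "\<And>\<alpha> n. \<alpha> \<in> index_set w q m \<Longrightarrow> n \<in> {1..m} \<Longrightarrow> \<alpha> n < N"
    using index_set_subset_bounded[of m w q] assms by blast
  have "index_set w q m \<subseteq> PiE {1..m} (\<lambda>_. {..<N})"
  proof
    fix \<alpha> assume "\<alpha> \<in> index_set w q m"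
    then show "\<alpha> \<in> PiE {1..m} (\<lambda>_. {..<N})"
      using N[of \<alpha>] by (auto simp: index_set_def PiE_iff)
  qed
  then show ?thesis by (rule finite_subset) (intro finite_PiE, auto)
qed

text \<open>Even levels other than 0 do not contribute, because they use as many points as the level before.\<close>
definition level_factor :: "(nat \<Rightarrow> real) \<Rightarrow> nat \<Rightarrow> nat \<Rightarrow> real" where
  "level_factor c n j = (if j = 0 then 1 else if even j then 0 else c n)"

lemma sum_level_factor_bound:
  fixes w x p c :: "nat \<Rightarrow> real"
  assumes q: "q \<ge> 1"
    and pos: "\<And>k. k \<in> {1..m} \<Longrightarrow> w k > 0" "\<And>k. k \<in> {1..m} \<Longrightarrow> x k > 0"
    and p: "\<And>k. k \<in> {1..m} \<Longrightarrow> 0 \<le> p k" "\<And>k. k \<in> {1..m} \<Longrightarrow> p k \<le> 43 / 10" "\<And>k. k \<in> {1..m} \<Longrightarrow> p k \<le> x k + 1 / 3"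
    and c: "\<And>k. k \<in> {1..m} \<Longrightarrow> c k = x k * (2 * w k) * p k"
  shows "(\<Sum>\<alpha>\<in>index_set w q m. \<Prod>n=1..m. level_factor c n (\<alpha> n))
      \<le> 2 * ((\<Prod>k=1..m. 1 + real q * x k) * (1 + real q * (\<Sum>k=1..m. x k)))"
proof -
  obtain N where N: "\<And>\<alpha> n. \<alpha> \<in> index_set w q m \<Longrightarrow> n \<in> {1..m} \<Longrightarrow> \<alpha> n < N"
    using index_set_subset_bounded[of m w q] pos(1) by blast
  have fin: "finite (index_set w q m)" by (rule finite_index_set[OF pos(1)])
  define Y where "Y = {\<alpha> \<in> index_set w q m. \<forall>n\<in>{1..m}. \<alpha> n = 0 \<or> odd (\<alpha> n)}"
  define B where "B S = odd_simplex S w N (real q)" for S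
  have finB: "finite (B S)" if "S \<in> Pow {1..m}" for S
  proof -
    have "finite S" using that finite_subset by auto
    then show ?thesis
      by (intro finite_subset[of "B S" "PiE S (\<lambda>_. {..<N})"] finite_PiE) (auto simp: B_def)
  qed
  have c_nonneg: "c k \<ge> 0" if "k \<in> {1..m}" for k using c[OF that] pos[OF that] p(1)[OF that] by simp
  have "(\<Sum>\<alpha>\<in>index_set w q m. \<Prod>n=1..m. level_factor c n (\<alpha> n)) = (\<Sum>\<alpha>\<in>Y. \<Prod>n=1..m. level_factor c n (\<alpha> n))"
  proof (rule sum.mono_neutral_right[OF fin])
    show "\<forall>\<alpha>\<in>index_set w q m - Y. (\<Prod>n=1..m. level_factor c n (\<alpha> n)) = 0"
      by (auto simp: Y_def level_factor_def)
  qed (auto simp: Y_def)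
  also have "\<dots> \<le> (\<Sum>(S, \<beta>)\<in>(SIGMA S:Pow {1..m}. B S). \<Prod>k\<in>S. c k)"
  \<comment> \<open>A multi-index without positive even levels is determined by its support S and
    the halves beta of its odd levels on S.\<close>
  proof (rule sum_le_included[where i = "\<lambda>(S, \<beta>). \<lambda>n\<in>{1..m}. if n \<in> S then 2 * \<beta> n + 1 else 0"])
    show "finite Y" using fin by (simp add: Y_def)
    show "finite (SIGMA S:Pow {1..m}. B S)" using finB by (intro finite_SigmaI) auto
    show "\<forall>y\<in>SIGMA S:Pow {1..m}. B S. 0 \<le> (case y of (S, \<beta>) \<Rightarrow> \<Prod>k\<in>S. c k)"
      using c_nonneg by (auto intro!: prod_nonneg)
    show "\<forall>\<alpha>\<in>Y. \<exists>y\<in>SIGMA S:Pow {1..m}. B S. (case y of (S, \<beta>) \<Rightarrow> \<lambda>n\<in>{1..m}. if n \<in> S then 2 * \<beta> n + 1 else 0) = \<alpha>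
        \<and> (\<Prod>n=1..m. level_factor c n (\<alpha> n)) \<le> (case y of (S, \<beta>) \<Rightarrow> \<Prod>k\<in>S. c k)"
    proof
      fix \<alpha> assume \<alpha>: "\<alpha> \<in> Y"
      then have \<alpha>': "\<alpha> \<in> index_set w q m" by (simp add: Y_def)
      define S where "S = {n \<in> {1..m}. \<alpha> n \<noteq> 0}"
      define \<beta> where "\<beta> = (\<lambda>n\<in>S. \<alpha> n div 2)"
      have odd_S: "odd (\<alpha> n)" if "n \<in> S" for n
      proof -
        have "n \<in> {1..m}" "\<alpha> n \<noteq> 0" using that by (auto simp: S_def)
        moreover have "\<forall>n\<in>{1..m}. \<alpha> n = 0 \<or> odd (\<alpha> n)" using \<alpha> unfolding Y_def by simp
        ultimately show ?thesis by metis
      qed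
      have \<alpha>_S: "\<alpha> n = 2 * \<beta> n + 1" if "n \<in> S" for n
        using odd_S[OF that] that by (simp add: \<beta>_def odd_two_times_div_two_succ)
      have "\<beta> \<in> PiE S (\<lambda>_. {..<N})"
        using N[OF \<alpha>'] by (auto simp: \<beta>_def S_def intro: le_less_trans[OF div_le_dividend])
      moreover have "(\<Sum>k\<in>S. real (2 * \<beta> k + 1) * w k) = (\<Sum>k=1..m. real (\<alpha> k) * w k)"
        using \<alpha>_S by (intro sum.mono_neutral_cong_left) (auto simp: S_def)
      ultimately have "\<beta> \<in> B S" using \<alpha>' by (simp add: B_def index_set_def)
      moreover have "S \<in> Pow {1..m}" by (auto simp: S_def)
      moreover have "(\<lambda>n\<in>{1..m}. if n \<in> S then 2 * \<beta> n + 1 else 0) = \<alpha>"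
      proof
        fix n
        show "(\<lambda>n\<in>{1..m}. if n \<in> S then 2 * \<beta> n + 1 else 0) n = \<alpha> n"
          using \<alpha>_S[of n] \<alpha>' by (auto simp: S_def index_set_def PiE_iff extensional_def)
      qed
      moreover have "(\<Prod>n=1..m. level_factor c n (\<alpha> n)) = (\<Prod>k\<in>S. c k)"
      proof (rule prod.mono_neutral_cong_right)
        show "level_factor c n (\<alpha> n) = c n" if "n \<in> S" for n
          using odd_S[OF that] by (auto simp: level_factor_def)
      qed (auto simp: S_def level_factor_def)
      ultimately show "\<exists>y\<in>SIGMA S:Pow {1..m}. B S. (case y of (S, \<beta>) \<Rightarrow> \<lambda>n\<in>{1..m}. if n \<in> S then 2 * \<beta> n + 1 else 0) = \<alpha>
        \<and> (\<Prod>n=1..m. level_factor c n (\<alpha> n)) \<le> (case y of (S, \<beta>) \<Rightarrow> \<Prod>k\<in>S. c k)"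
        by (intro bexI[of _ "(S, \<beta>)"]) auto
    qed
  qed
  also have "\<dots> = (\<Sum>S\<in>Pow {1..m}. (\<Prod>k\<in>S. c k) * real (card (B S)))"
    using finB by (subst sum.Sigma[symmetric]) (auto simp: mult.commute)
  also have "\<dots> \<le> (\<Sum>S\<in>Pow {1..m}. 2 * ((\<Prod>k\<in>S. real q * x k) * (1 + (\<Sum>k\<in>S. 1 + real q * x k))))"
  proof (rule sum_mono)
    fix S assume "S \<in> Pow {1..m}"
    then have S: "finite S" "k \<in> S \<Longrightarrow> k \<in> {1..m}" for k using finite_subset by auto
    have "(\<Prod>k\<in>S. c k) = (\<Prod>k\<in>S. x k * (2 * w k) * p k)" using S c by (intro prod.cong) auto
    then show "(\<Prod>k\<in>S. c k) * real (card (B S)) \<le> 2 * ((\<Prod>k\<in>S. real q * x k) * (1 + (\<Sum>k\<in>S. 1 + real q * x k)))"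
      unfolding B_def using S pos p q support_term_bound[of S "real q" w x p N] by simp
  qed
  also have "\<dots> = 2 * ((\<Prod>k=1..m. 1 + real q * x k) * (1 + real q * (\<Sum>k=1..m. x k)))"
    by (simp only: sum_distrib_left[symmetric] sum_Pow_prod_weighted finite_atLeastAtMost)
  finally show ?thesis .
qed

section \<open>Univariate error bounds\<close>

lemma num_points_eq: "num_points j = (j + 1) div 2 + 1"
proof -
  have "\<lceil>(1 / 2) * (real j + 2)\<rceil> = int ((j + 1) div 2 + 1)"
  proof (cases "even j")
    case True
    then obtain i where "j = 2 * i" by (rule evenE)
    then show ?thesis by (intro ceiling_unique) auto
  next
    case False
    then obtain i where "j = 2 * i + 1" by (rule oddE)
    then show ?thesis by (intro ceiling_unique) auto
  qed
  then show ?thesis by (simp add: num_points_def)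
qed

lemma gauss_legendre_bound:
  assumes "n > 0" and "\<And>x. x \<in> \<Gamma> \<Longrightarrow> \<bar>g x\<bar> \<le> B"
  shows "\<bar>gauss_legendre n g\<bar> \<le> B"
proof -
  have "\<bar>gauss_legendre n g\<bar> \<le> (\<Sum>x\<in>gauss_nodes n. gauss_weight n x * B)"
    unfolding gauss_legendre_def
    using assms(2) gauss_node_bound gauss_weight_nonneg
    by (intro order_trans[OF sum_abs] sum_mono) (auto simp: abs_mult intro!: mult_left_mono)
  also have "\<dots> = B" using sum_gauss_weight[OF assms(1)] by (simp add: sum_distrib_right[symmetric])
  finally show ?thesis .
qed

lemma integral_Gamma_bound:
  fixes g :: "real \<Rightarrow> real"
  assumes "\<And>x. x \<in> \<Gamma> \<Longrightarrow> \<bar>g x\<bar> \<le> B"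
  shows "\<bar>LINT t|\<Gamma>_measure. g t\<bar> \<le> B"
proof -
  interpret prob_space \<Gamma>_measure by (rule prob_space_Gamma_measure)
  have B: "0 \<le> B" using assms[of 0] by auto
  show ?thesis
  proof (cases "integrable \<Gamma>_measure g")
    case True
    have "\<bar>LINT t|\<Gamma>_measure. g t\<bar> \<le> (LINT t|\<Gamma>_measure. \<bar>g t\<bar>)" by (rule integral_abs_bound)
    also have "\<dots> \<le> (LINT t|\<Gamma>_measure. B)"
      using True assms by (intro integral_mono) auto
    finally show ?thesis using prob_space by simp
  qed (use B in \<open>simp add: not_integrable_integral_eq\<close>)
qed

lemma gauss_legendre_diff: "gauss_legendre n (\<lambda>x. f x - g x) = gauss_legendre n f - gauss_legendre n g"
  by (simp add: gauss_legendre_def sum_subtractf right_diff_distrib)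

text \<open>The common features of I - Q_j and of the nonzero differences with j > 0: norm at most
  2, and blindness to polynomials of low degree and to odd polynomials. The odd part q has
  unrestricted degree because symmetry, not exactness, removes it. Invariance under the subtraction
  is stated directly in place of linearity.\<close>

definition annihilating :: "nat \<Rightarrow> ((real \<Rightarrow> real) \<Rightarrow> real) \<Rightarrow> bool" where
  "annihilating n E \<longleftrightarrow>
     (\<forall>g B. continuous_on \<Gamma> g \<and> (\<forall>x\<in>\<Gamma>. \<bar>g x\<bar> \<le> B) \<longrightarrow> \<bar>E g\<bar> \<le> 2 * B) \<and>
     (\<forall>g p q. continuous_on \<Gamma> g \<and> (p = 0 \<or> degree p < n) \<and> (\<forall>x. poly q (- x) = - poly q x) \<longrightarrow>
        E (\<lambda>x. g x - poly p x - poly q x) = E g)"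

lemma gauss_legendre_exact_or_zero:
  "p = 0 \<or> degree p < 2 * n \<Longrightarrow> gauss_legendre n (poly p) = (LINT t|\<Gamma>_measure. poly p t)"
  using gauss_legendre_exact[of p n] by (auto simp: gauss_legendre_def)

lemma integral_Gamma_odd_poly: "\<forall>x. poly q (- x) = - poly q x \<Longrightarrow> (LINT t|\<Gamma>_measure. poly q t) = 0"
  by (intro integral_Gamma_odd continuous_intros) auto

lemma annihilating_error:
  assumes "n > 0"
  shows "annihilating (2 * n) (\<lambda>g. (LINT t|\<Gamma>_measure. g t) - gauss_legendre n g)"
  unfolding annihilating_def
proof (intro conjI allI impI; elim conjE)
  fix g :: "real \<Rightarrow> real" and B assume "\<forall>x\<in>\<Gamma>. \<bar>g x\<bar> \<le> B"
  then show "\<bar>(LINT t|\<Gamma>_measure. g t) - gauss_legendre n g\<bar> \<le> 2 * B"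
    using integral_Gamma_bound[of g B] gauss_legendre_bound[OF assms, of g B] by force
next
  fix g :: "real \<Rightarrow> real" and p q :: "real poly"
  assume g: "continuous_on \<Gamma> g" and p: "p = 0 \<or> degree p < 2 * n" and q: "\<forall>x. poly q (- x) = - poly q x"
  have "(LINT t|\<Gamma>_measure. g t - poly p t - poly q t)
      = (LINT t|\<Gamma>_measure. g t) - (LINT t|\<Gamma>_measure. poly p t) - (LINT t|\<Gamma>_measure. poly q t)"
    using integrable_Gamma_measure[OF g] integrable_Gamma_measure[of "poly p"] integrable_Gamma_measure[of "poly q"]
    by (simp add: continuous_on_poly continuous_on_id)
  then show "(LINT t|\<Gamma>_measure. g t - poly p t - poly q t) - gauss_legendre n (\<lambda>x. g x - poly p x - poly q x)
      = (LINT t|\<Gamma>_measure. g t) - gauss_legendre n g"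
    using gauss_legendre_exact_or_zero[OF p] integral_Gamma_odd_poly[OF q] gauss_legendre_odd[of "poly q" n] q
    by (simp add: gauss_legendre_diff)
qed

lemma annihilating_difference:
  assumes "n > 0" "n \<le> n'"
  shows "annihilating (2 * n) (\<lambda>g. gauss_legendre n' g - gauss_legendre n g)"
  unfolding annihilating_def
proof (intro conjI allI impI; elim conjE)
  fix g :: "real \<Rightarrow> real" and B assume "\<forall>x\<in>\<Gamma>. \<bar>g x\<bar> \<le> B"
  then show "\<bar>gauss_legendre n' g - gauss_legendre n g\<bar> \<le> 2 * B"
    using gauss_legendre_bound[of n' g B] gauss_legendre_bound[of n g B] assms by force
next
  fix g :: "real \<Rightarrow> real" and p q :: "real poly"
  assume p: "p = 0 \<or> degree p < 2 * n" and q: "\<forall>x. poly q (- x) = - poly q x"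
  then have p': "p = 0 \<or> degree p < 2 * n'" using assms by auto
  show "gauss_legendre n' (\<lambda>x. g x - poly p x - poly q x) - gauss_legendre n (\<lambda>x. g x - poly p x - poly q x)
      = gauss_legendre n' g - gauss_legendre n g"
    using gauss_legendre_exact_or_zero[OF p] gauss_legendre_exact_or_zero[OF p'] gauss_legendre_odd[of "poly q" n]
      gauss_legendre_odd[of "poly q" n'] q
    by (simp add: gauss_legendre_diff)
qed

lemma continuous_on_Re_tube:
  assumes "u holomorphic_on tube t" "t > 0"
  shows "continuous_on \<Gamma> (\<lambda>x. Re (u (of_real x)))"
  using assms real_in_tube
  by (intro continuous_intros continuous_on_compose2[OF holomorphic_on_imp_continuous_on[OF assms(1)]])
    (auto simp: abs_le_iff)

lemma tube_radius_gt_1: "t > 0 \<Longrightarrow> 1 < t + sqrt (1 + t\<^sup>2)"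
  using real_sqrt_ge_1_iff[of "1 + t\<^sup>2"] zero_le_power2[of t] by linarith

text \<open>Approximations are available for all radii below kappa, where the function is
  holomorphic around the closed ellipse; the rate at kappa itself follows by continuity, after
  letting epsilon tend to 0.\<close>

lemma bound_at_radius:
  fixes f :: "real \<Rightarrow> real"
  assumes t: "t > 0" and cont: "isCont f (t + sqrt (1 + t\<^sup>2))"
    and le: "\<And>\<rho> \<epsilon>. 1 < \<rho> \<Longrightarrow> \<rho> < t + sqrt (1 + t\<^sup>2) \<Longrightarrow> \<epsilon> > 0 \<Longrightarrow> y \<le> f \<rho> + \<epsilon>"
  shows "y \<le> f (t + sqrt (1 + t\<^sup>2))"
proof (rule tendsto_lowerbound)
  show "(f \<longlongrightarrow> f (t + sqrt (1 + t\<^sup>2))) (at_left (t + sqrt (1 + t\<^sup>2)))"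
    using cont by (simp add: isCont_def filterlim_at_split)
  have "\<forall>\<^sub>F \<rho> in at_left (t + sqrt (1 + t\<^sup>2)). \<rho> \<in> {1<..<t + sqrt (1 + t\<^sup>2)}"
    by (rule eventually_at_left_real[OF tube_radius_gt_1[OF t]])
  then show "\<forall>\<^sub>F \<rho> in at_left (t + sqrt (1 + t\<^sup>2)). y \<le> f \<rho>"
  proof (rule eventually_mono)
    fix \<rho> assume "\<rho> \<in> {1<..<t + sqrt (1 + t\<^sup>2)}"
    then have "y \<le> f \<rho> + \<epsilon>" if "\<epsilon> > 0" for \<epsilon> using le[of \<rho> \<epsilon>] that by simp
    then show "y \<le> f \<rho>" by (rule field_le_epsilon)
  qed
qed simp

text \<open>At the limit radius the geometric tail has denominator kappa^n (1 - 1/kappa^2) =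
  kappa^(n-1) (kappa - 1/kappa) = 2 t kappa^(n-1). One power of kappa is thus exchanged for the
  factor 1/t, which is small for large t.\<close>

lemma annihilating_bound_even:
  assumes E: "annihilating n E" and n: "even n" "n > 0" and t: "t > 0"
    and hol: "u holomorphic_on tube t" and bound: "\<And>z. z \<in> tube t \<Longrightarrow> cmod (u z) \<le> M"
  shows "\<bar>E (\<lambda>x. Re (u (of_real x)))\<bar> \<le> 2 * M / (t * (t + sqrt (1 + t\<^sup>2)) ^ (n - 1))"
proof -
  define \<kappa> where "\<kappa> = t + sqrt (1 + t\<^sup>2)"
  define f where "f = (\<lambda>\<rho>. 2 * (2 * M / (\<rho> ^ n * (1 - 1 / \<rho>\<^sup>2))))"
  have \<kappa>: "\<kappa> > 1" using tube_radius_gt_1[OF t] by (simp add: \<kappa>_def)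
  have "\<bar>E (\<lambda>x. Re (u (of_real x)))\<bar> \<le> f (t + sqrt (1 + t\<^sup>2))"
  proof (rule bound_at_radius[OF t])
    have "1 - 1 / \<kappa>\<^sup>2 \<noteq> 0" using \<kappa> by (simp add: field_simps power2_eq_1_iff)
    then show "isCont f (t + sqrt (1 + t\<^sup>2))"
      unfolding f_def \<kappa>_def[symmetric] using \<kappa> by (intro continuous_intros) auto
    fix \<rho> \<epsilon> :: real assume \<rho>: "1 < \<rho>" "\<rho> < t + sqrt (1 + t\<^sup>2)" and \<epsilon>: "\<epsilon> > 0"
    obtain p q where pq: "p = 0 \<or> degree p < n" "\<And>x. poly q (- x) = - poly q x"
      "\<And>x. \<bar>x\<bar> \<le> 1 \<Longrightarrow> \<bar>Re (u (of_real x)) - poly p x - poly q x\<bar> \<le> 2 * M / (\<rho> ^ n * (1 - 1 / \<rho>\<^sup>2)) + \<epsilon> / 2"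
      using approximation_even[OF hol bound \<rho>, of "\<epsilon> / 2" n] \<epsilon> n by auto
    have "E (\<lambda>x. Re (u (of_real x)) - poly p x - poly q x) = E (\<lambda>x. Re (u (of_real x)))"
      using E pq continuous_on_Re_tube[OF hol t] unfolding annihilating_def by blast
    moreover have close: "\<forall>x\<in>\<Gamma>. \<bar>Re (u (of_real x)) - poly p x - poly q x\<bar> \<le> 2 * M / (\<rho> ^ n * (1 - 1 / \<rho>\<^sup>2)) + \<epsilon> / 2"
      by (intro ballI pq(3)) (simp add: abs_le_iff)
    have "continuous_on \<Gamma> (\<lambda>x. Re (u (of_real x)) - poly p x - poly q x)"
      by (intro continuous_intros continuous_on_Re_tube[OF hol t])
    then have "\<bar>E (\<lambda>x. Re (u (of_real x)) - poly p x - poly q x)\<bar> \<le> 2 * (2 * M / (\<rho> ^ n * (1 - 1 / \<rho>\<^sup>2)) + \<epsilon> / 2)"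
      using E close unfolding annihilating_def by blast
    ultimately show "\<bar>E (\<lambda>x. Re (u (of_real x)))\<bar> \<le> f \<rho> + \<epsilon>"
      by (simp add: f_def distrib_left)
  qed
  also have "\<dots> = 2 * M / (t * (t + sqrt (1 + t\<^sup>2)) ^ (n - 1))"
  proof -
    have "(sqrt (1 + t\<^sup>2) - t) * \<kappa> = 1" by (simp add: \<kappa>_def algebra_simps power2_eq_square)
    then have "1 / \<kappa> = sqrt (1 + t\<^sup>2) - t" using \<kappa> by (simp add: field_simps)
    then have "\<kappa> - 1 / \<kappa> = 2 * t" by (simp add: \<kappa>_def)
    moreover have "\<kappa> ^ n * (1 - 1 / \<kappa>\<^sup>2) = \<kappa> ^ (n - 1) * (\<kappa> - 1 / \<kappa>)"
    proof -
      obtain k where "n = Suc k" using n(2) by (cases n) auto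
      then show ?thesis using \<kappa> by (simp add: field_simps power2_eq_square)
    qed
    ultimately have "\<kappa> ^ n * (1 - 1 / \<kappa>\<^sup>2) = \<kappa> ^ (n - 1) * (2 * t)" by simp
    then show ?thesis unfolding f_def \<kappa>_def[symmetric] using t \<kappa> by (simp add: field_simps)
  qed
  finally show ?thesis .
qed

text \<open>The restriction of y is no loss: beyond 10/43 the linear bound exceeds 1, and
  approximation by zero is already good enough.\<close>

lemma smooth_bound_constant:
  fixes y :: real
  assumes "0 < y" "y \<le> 10 / 43"
  shows "smooth_rate y \<le> 43 / 10 * y"
proof -
  have "4 * y / (1 + y\<^sup>2) + 2 * y\<^sup>2 \<le> 43 / 10 * y"
  proof -
    have "2 * y * (1 + y\<^sup>2) + 4 \<le> 43 / 10 * (1 + y\<^sup>2)"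
    proof -
      have "2 * y * y\<^sup>2 \<le> 2 * (10 / 43) * y\<^sup>2" using assms by (intro mult_right_mono) auto
      moreover have "0 \<le> 3 / 10 - 2 * y + (43 / 10 - 20 / 43) * y\<^sup>2"
      proof -
        \<comment> \<open>Completion of the square around the minimum at 1 / (43/10 - 20/43) =
          430/1649, which is below 3/10.\<close>
        have "3 / 10 - 2 * y + (43 / 10 - 20 / 43) * y\<^sup>2 = (43 / 10 - 20 / 43) * (y - 430 / 1649)\<^sup>2 + (3 / 10 - 430 / 1649)"
          by (simp add: power2_eq_square algebra_simps)
        then show ?thesis by (simp add: add_nonneg_nonneg)
      qed
      ultimately show ?thesis by (simp add: algebra_simps)
    qed
    then have "y * (2 * y * (1 + y\<^sup>2) + 4) \<le> y * (43 / 10 * (1 + y\<^sup>2))"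
      using assms by (intro mult_left_mono) auto
    moreover have "1 + y\<^sup>2 > 0" by (simp add: add_pos_nonneg)
    ultimately show ?thesis by (simp add: divide_simps) (simp add: algebra_simps power2_eq_square)
  qed
  moreover have "2 * y\<^sup>2 / (1 + y ^ 4) \<le> 2 * y\<^sup>2 / 1"
    using assms by (intro divide_left_mono) (auto simp: add_pos_pos)
  ultimately show ?thesis by simp
qed

lemma annihilating_bound_smooth:
  assumes E: "annihilating n E" and t: "t > 0"
    and hol: "u holomorphic_on tube t" and bound: "\<And>z. z \<in> tube t \<Longrightarrow> cmod (u z) \<le> M"
  shows "\<bar>E (\<lambda>x. Re (u (of_real x)))\<bar> \<le> 43 / 5 * M / (t + sqrt (1 + t\<^sup>2)) ^ n"
proof -
  have M: "M \<ge> 0"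
    using bound[OF real_in_tube[OF t, of 0]] norm_ge_zero[of "u 0"] by (simp del: norm_ge_zero)
  define f where "f = (\<lambda>\<rho>. 43 / 5 * M / \<rho> ^ n)"
  have cont: "continuous_on \<Gamma> (\<lambda>x. Re (u (of_real x)))" by (rule continuous_on_Re_tube[OF hol t])
  have "\<bar>E (\<lambda>x. Re (u (of_real x)))\<bar> \<le> f (t + sqrt (1 + t\<^sup>2))"
  proof (rule bound_at_radius[OF t])
    show "isCont f (t + sqrt (1 + t\<^sup>2))"
      unfolding f_def using tube_radius_gt_1[OF t] by (intro continuous_intros) auto
    fix \<rho> \<epsilon> :: real assume \<rho>: "1 < \<rho>" "\<rho> < t + sqrt (1 + t\<^sup>2)" and \<epsilon>: "\<epsilon> > 0"
    define y where "y = 1 / \<rho> ^ n"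
    have y: "y > 0" using \<rho> by (simp add: y_def)
    show "\<bar>E (\<lambda>x. Re (u (of_real x)))\<bar> \<le> f \<rho> + \<epsilon>"
    \<comment> \<open>At this threshold the smoothing rate 43/5 y meets the trivial bound 2 coming
      from the norm of E.\<close>
    proof (cases "y \<le> 10 / 43")
      case True
      obtain p where p: "p = 0 \<or> degree p < n"
        "\<And>x. \<bar>x\<bar> \<le> 1 \<Longrightarrow> \<bar>Re (u (of_real x)) - poly p x\<bar> \<le> smooth_rate y * M + \<epsilon> / 2"
        using approximation_smooth[OF hol bound \<rho>, of "\<epsilon> / 2" n] \<epsilon> by (auto simp: y_def)
      have le: "smooth_rate y * M \<le> 43 / 10 * y * M"
        using smooth_bound_constant[OF y True] M by (rule mult_right_mono)
      have close: "\<forall>x\<in>\<Gamma>. \<bar>Re (u (of_real x)) - poly p x - poly 0 x\<bar> \<le> 43 / 10 * y * M + \<epsilon> / 2"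
      proof (intro ballI)
        fix x :: real assume "x \<in> \<Gamma>"
        then have "\<bar>x\<bar> \<le> 1" by (simp add: abs_le_iff)
        from p(2)[OF this] show "\<bar>Re (u (of_real x)) - poly p x - poly 0 x\<bar> \<le> 43 / 10 * y * M + \<epsilon> / 2"
          using le by simp
      qed
      have "E (\<lambda>x. Re (u (of_real x)) - poly p x - poly 0 x) = E (\<lambda>x. Re (u (of_real x)))"
      proof -
        have "\<forall>x :: real. poly 0 (- x) = - poly 0 x" by simp
        then show ?thesis using E p(1) cont unfolding annihilating_def by blast
      qed
      moreover have "continuous_on \<Gamma> (\<lambda>x. Re (u (of_real x)) - poly p x - poly 0 x)"
        by (intro continuous_intros cont)
      then have "\<bar>E (\<lambda>x. Re (u (of_real x)) - poly p x - poly 0 x)\<bar> \<le> 2 * (43 / 10 * y * M + \<epsilon> / 2)"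
        using E close unfolding annihilating_def by blast
      ultimately show ?thesis by (simp add: f_def y_def)
    next
      case False
      have "\<forall>x\<in>\<Gamma>. \<bar>Re (u (of_real x))\<bar> \<le> M"
        using bound real_in_tube[OF t] order_trans[OF abs_Re_le_cmod] by (auto simp: abs_le_iff[of _ 1])
      then have "\<bar>E (\<lambda>x. Re (u (of_real x)))\<bar> \<le> 2 * M"
        using E cont unfolding annihilating_def by blast
      also have "2 * M \<le> 43 / 5 * y * M" using False M by (intro mult_right_mono) auto
      finally show ?thesis using \<epsilon> by (simp add: f_def y_def)
    qed
  qed
  then show ?thesis by (simp add: f_def)
qed

lemma quadrature_error_bound:
  assumes t: "t > 0" and hol: "u holomorphic_on tube t" and bound: "\<And>z. z \<in> tube t \<Longrightarrow> cmod (u z) \<le> M"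
  shows "\<bar>(LINT x|\<Gamma>_measure. Re (u (of_real x))) - Quad j (\<lambda>x. Re (u (of_real x)))\<bar>
       \<le> 2 * M / (t * (t + sqrt (1 + t\<^sup>2)) ^ Suc j)"
proof -
  define \<kappa> where "\<kappa> = t + sqrt (1 + t\<^sup>2)"
  have \<kappa>: "\<kappa> > 1" using tube_radius_gt_1[OF t] by (simp add: \<kappa>_def)
  have M: "M \<ge> 0"
    using bound[OF real_in_tube[OF t, of 0]] norm_ge_zero[of "u 0"] by (simp del: norm_ge_zero)
  have "\<bar>(LINT x|\<Gamma>_measure. Re (u (of_real x))) - Quad j (\<lambda>x. Re (u (of_real x)))\<bar> \<le> 2 * M / (t * \<kappa> ^ (2 * num_points j - 1))"
    unfolding Quad_def \<kappa>_def
    by (rule annihilating_bound_even[OF annihilating_error _ _ t hol bound]) (auto simp: num_points_eq)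
  also have "\<dots> \<le> 2 * M / (t * \<kappa> ^ Suc j)"
  proof (intro divide_left_mono mult_left_mono power_increasing)
    \<comment> \<open>The right-hand side is j + 1 for even j and j + 2 for odd j.\<close>
    show "Suc j \<le> 2 * num_points j - 1" unfolding num_points_eq by presburger
  qed (use t \<kappa> M in auto)
  finally show ?thesis by (simp only: \<kappa>_def)
qed

lemma quad_diff_even: "even j \<Longrightarrow> j > 0 \<Longrightarrow> Quad_diff j g = 0"
  by (auto simp: Quad_diff_def Quad_def num_points_eq elim!: evenE)

text \<open>The two alternatives for c correspond to truncation, with its factor 1/t, and to
  smoothing, which gains one more power of kappa instead.\<close>

lemma quad_diff_bound:
  assumes t: "t > 0" and hol: "u holomorphic_on tube t" and bound: "\<And>z. z \<in> tube t \<Longrightarrow> cmod (u z) \<le> M"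
    and c: "2 / t \<le> c n \<or> 43 / 5 / (t + sqrt (1 + t\<^sup>2)) \<le> c n"
  shows "\<bar>Quad_diff j (\<lambda>x. Re (u (of_real x)))\<bar> \<le> level_factor c n j / (t + sqrt (1 + t\<^sup>2)) ^ j * M"
proof -
  define \<kappa> where "\<kappa> = t + sqrt (1 + t\<^sup>2)"
  have \<kappa>: "\<kappa> > 1" using tube_radius_gt_1[OF t] by (simp add: \<kappa>_def)
  have M: "M \<ge> 0"
    using bound[OF real_in_tube[OF t, of 0]] norm_ge_zero[of "u 0"] by (simp del: norm_ge_zero)
  consider "j = 0" | "even j" "j > 0" | "odd j" by auto
  then show ?thesis
  proof cases
    case 1
    have "\<bar>gauss_legendre (num_points 0) (\<lambda>x. Re (u (of_real x)))\<bar> \<le> M"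
      using bound real_in_tube[OF t] order_trans[OF abs_Re_le_cmod]
      by (intro gauss_legendre_bound) (auto simp: abs_le_iff[of _ 1] num_points_eq)
    then show ?thesis by (simp add: 1 Quad_diff_def Quad_def level_factor_def)
  next
    case 2
    then show ?thesis by (simp add: quad_diff_even level_factor_def)
  next
    case 3
    then obtain i where j: "j = 2 * i + 1" by (rule oddE)
    \<comment> \<open>For j = 2i + 1 the levels j - 1 and j use i + 1 and i + 2 points; the smaller
      number governs the exactness of the difference.\<close>
    have ann: "annihilating (2 * (i + 1)) (Quad_diff j)"
      using annihilating_difference[of "i + 1" "i + 2"]
      by (simp add: Quad_diff_def[abs_def] Quad_def num_points_eq j)
    have n: "2 * (i + 1) = Suc j" by (simp add: j)
    have "\<bar>Quad_diff j (\<lambda>x. Re (u (of_real x)))\<bar> \<le> c n / \<kappa> ^ j * M"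
      using c
    proof
      assume c: "2 / t \<le> c n"
      have "\<bar>Quad_diff j (\<lambda>x. Re (u (of_real x)))\<bar> \<le> 2 * M / (t * \<kappa> ^ j)"
        using annihilating_bound_even[OF ann _ _ t hol bound] unfolding n \<kappa>_def by (simp add: j)
      also have "\<dots> = 2 / t / \<kappa> ^ j * M" by simp
      also have "\<dots> \<le> c n / \<kappa> ^ j * M" using c \<kappa> M by (intro mult_right_mono divide_right_mono) auto
      finally show ?thesis .
    next
      assume c: "43 / 5 / (t + sqrt (1 + t\<^sup>2)) \<le> c n"
      have "\<bar>Quad_diff j (\<lambda>x. Re (u (of_real x)))\<bar> \<le> 43 / 5 * M / \<kappa> ^ Suc j"
        using annihilating_bound_smooth[OF ann t hol bound] by (simp only: n \<kappa>_def)
      also have "\<dots> = 43 / 5 / \<kappa> / \<kappa> ^ j * M" by simp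
      also have "\<dots> \<le> c n / \<kappa> ^ j * M" using c \<kappa> M by (intro mult_right_mono divide_right_mono) (auto simp: \<kappa>_def)
      finally show ?thesis .
    qed
    then show ?thesis using 3 by (auto simp: level_factor_def \<kappa>_def)
  qed
qed

text \<open>The right-hand side is arsinh t, and 3t/(3 + t) is chosen because its reciprocal is 1/t
  + 1/3, the form in which 1/w is bounded later. Both sides vanish at 0, so comparing derivatives
  suffices.\<close>

lemma ln_radius_lower:
  fixes t :: real
  assumes "t > 0"
  shows "3 * t / (3 + t) \<le> ln (t + sqrt (1 + t\<^sup>2))"
proof -
  define f where "f = (\<lambda>s :: real. arsinh s - 3 * s / (3 + s))"
  have "f 0 \<le> f t"
  proof (rule DERIV_nonneg_imp_nondecreasing[where f = f and a = 0 and b = t])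
    show "0 \<le> t" using assms by simp
    fix s :: real assume s: "0 \<le> s" "s \<le> t"
    have "(f has_real_derivative 1 / sqrt (s\<^sup>2 + 1) - (3 * (3 + s) - 3 * s * 1) / (3 + s)\<^sup>2) (at s)"
      unfolding f_def using s
      by (auto intro!: derivative_eq_intros simp: power2_eq_square)
    moreover have "(3 * (3 + s) - 3 * s * 1) / (3 + s)\<^sup>2 \<le> 1 / sqrt (s\<^sup>2 + 1)"
    proof -
      have "9 * sqrt (s\<^sup>2 + 1) \<le> (3 + s)\<^sup>2"
      proof -
        have "(sqrt (81 * (s\<^sup>2 + 1))) \<le> (3 + s)\<^sup>2"
        proof (rule real_le_lsqrt)
          \<comment> \<open>This expression is (3 + s)^4 - 81 (s^2 + 1), arranged so that its sign
            is visible for s \<ge> 0.\<close>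
          have "0 \<le> s * (12 * (s - 2)\<^sup>2 + 21 * s + 60 + s ^ 3)" using s by simp
          then show "81 * (s\<^sup>2 + 1) \<le> ((3 + s)\<^sup>2)\<^sup>2"
            by (simp add: power2_eq_square power3_eq_cube algebra_simps)
        qed simp
        moreover have "sqrt 81 = (9 :: real)" by (rule real_sqrt_unique) auto
        ultimately show ?thesis by (simp only: real_sqrt_mult)
      qed
      moreover have "sqrt (s\<^sup>2 + 1) > 0" by (simp add: add_nonneg_pos)
      moreover have "(3 + s)\<^sup>2 > 0" using s by simp
      ultimately show ?thesis by (simp add: divide_simps)
    qed
    ultimately show "\<exists>y. (f has_real_derivative y) (at s) \<and> 0 \<le> y" by force
  qed
  then show ?thesis by (simp add: f_def arsinh_real_def add.commute)
qed

section \<open>Tensor products and the error recursion\<close>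

text \<open>Together with \<open>level_weight\<close>, this writes the difference of two quadratures
  as one weighted sum of point values, a form that also applies to complex-valued functions.\<close>

definition level_nodes :: "nat \<Rightarrow> real set" where
  "level_nodes j = gauss_nodes (num_points j) \<union> (if j = 0 then {} else gauss_nodes (num_points (j - 1)))"

definition level_weight :: "nat \<Rightarrow> real \<Rightarrow> real" where
  "level_weight j x = (if x \<in> gauss_nodes (num_points j) then gauss_weight (num_points j) x else 0)
     - (if j \<noteq> 0 \<and> x \<in> gauss_nodes (num_points (j - 1)) then gauss_weight (num_points (j - 1)) x else 0)"

lemma finite_level_nodes: "finite (level_nodes j)"
  by (simp add: level_nodes_def finite_gauss_nodes)

lemma level_nodes_bound: "x \<in> level_nodes j \<Longrightarrow> \<bar>x\<bar> \<le> 1"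
  using gauss_node_bound by (fastforce simp: level_nodes_def abs_le_iff split: if_splits)

lemma Quad_diff_sum: "Quad_diff j g = (\<Sum>x\<in>level_nodes j. level_weight j x * g x)"
proof -
  let ?X = "gauss_nodes (num_points j)" and ?Y = "if j = 0 then {} else gauss_nodes (num_points (j - 1))"
  have X: "(\<Sum>x\<in>?X. gauss_weight (num_points j) x * g x)
      = (\<Sum>x\<in>level_nodes j. (if x \<in> ?X then gauss_weight (num_points j) x else 0) * g x)"
    by (intro sum.mono_neutral_cong_left finite_level_nodes) (auto simp: level_nodes_def)
  have Y: "(\<Sum>x\<in>?Y. gauss_weight (num_points (j - 1)) x * g x)
      = (\<Sum>x\<in>level_nodes j. (if j \<noteq> 0 \<and> x \<in> gauss_nodes (num_points (j - 1)) then gauss_weight (num_points (j - 1)) x else 0) * g x)"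
    by (intro sum.mono_neutral_cong_left finite_level_nodes) (auto simp: level_nodes_def split: if_splits)
  have "Quad_diff j g = (\<Sum>x\<in>?X. gauss_weight (num_points j) x * g x) - (\<Sum>x\<in>?Y. gauss_weight (num_points (j - 1)) x * g x)"
    by (simp add: Quad_diff_def Quad_def gauss_legendre_def)
  then show ?thesis
    unfolding X Y by (simp add: level_weight_def sum_subtractf[symmetric] left_diff_distrib)
qed

lemma sum_Quad_diff: "(\<Sum>j\<le>J. Quad_diff j g) = Quad J g"
  by (induction J) (auto simp: Quad_diff_def)

definition overwrite :: "'a set \<Rightarrow> ('a \<Rightarrow> 'b) \<Rightarrow> ('a \<Rightarrow> 'b) \<Rightarrow> 'a \<Rightarrow> 'b" where
  "overwrite S \<xi> z = (\<lambda>n. if n \<in> S then \<xi> n else z n)"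

text \<open>The value type is left open because the same rule is applied to the real integrand and
  to its complex extension, and \<open>S\<close> is an arbitrary set of variables so that variables
  can be added one at a time.\<close>

definition product_rule :: "nat set \<Rightarrow> (nat \<Rightarrow> nat) \<Rightarrow> ((nat \<Rightarrow> real) \<Rightarrow> 'b) \<Rightarrow> 'b :: real_vector" where
  "product_rule S \<alpha> g = (\<Sum>\<xi>\<in>PiE S (\<lambda>n. level_nodes (\<alpha> n)). (\<Prod>n\<in>S. level_weight (\<alpha> n) (\<xi> n)) *\<^sub>R g \<xi>)"

lemma product_rule_insert:
  assumes "finite S" "k \<notin> S"
  shows "product_rule (insert k S) \<alpha> g =
     (\<Sum>x\<in>level_nodes (\<alpha> k). level_weight (\<alpha> k) x *\<^sub>R product_rule S \<alpha> (\<lambda>\<xi>. g (\<xi>(k := x))))"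
proof -
  have "product_rule (insert k S) \<alpha> g = (\<Sum>(x, \<xi>)\<in>level_nodes (\<alpha> k) \<times> PiE S (\<lambda>n. level_nodes (\<alpha> n)).
      (\<Prod>n\<in>insert k S. level_weight (\<alpha> n) ((\<xi>(k := x)) n)) *\<^sub>R g (\<xi>(k := x)))"
    unfolding product_rule_def PiE_insert_eq
    by (subst sum.reindex[OF inj_combinator[OF assms(2)]]) (simp add: case_prod_unfold)
  also have "\<dots> = (\<Sum>(x, \<xi>)\<in>level_nodes (\<alpha> k) \<times> PiE S (\<lambda>n. level_nodes (\<alpha> n)).
      level_weight (\<alpha> k) x *\<^sub>R ((\<Prod>n\<in>S. level_weight (\<alpha> n) (\<xi> n)) *\<^sub>R g (\<xi>(k := x))))"
  proof (intro sum.cong refl, clarify)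
    fix x \<xi>
    have "(\<Prod>n\<in>S. level_weight (\<alpha> n) ((\<xi>(k := x)) n)) = (\<Prod>n\<in>S. level_weight (\<alpha> n) (\<xi> n))"
      using assms by (intro prod.cong) auto
    then show "(\<Prod>n\<in>insert k S. level_weight (\<alpha> n) ((\<xi>(k := x)) n)) *\<^sub>R g (\<xi>(k := x))
        = level_weight (\<alpha> k) x *\<^sub>R ((\<Prod>n\<in>S. level_weight (\<alpha> n) (\<xi> n)) *\<^sub>R g (\<xi>(k := x)))"
      using assms by simp
  qed
  finally show ?thesis
    by (simp add: product_rule_def scaleR_sum_right sum.cartesian_product)
qed

lemma tensor_Quad_diff: "tensor (\<lambda>n. Quad_diff (\<alpha> n)) m g = product_rule {1..m} \<alpha> g"
proof (induction m arbitrary: g)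
  case 0
  show ?case by (simp add: product_rule_def PiE_empty_domain)
next
  case (Suc m)
  have ins: "{1..Suc m} = insert (Suc m) {1..m}" by auto
  have "tensor (\<lambda>n. Quad_diff (\<alpha> n)) (Suc m) g
      = product_rule {1..m} \<alpha> (\<lambda>\<xi>. \<Sum>x\<in>level_nodes (\<alpha> (Suc m)). level_weight (\<alpha> (Suc m)) x * g (\<xi>(Suc m := x)))"
    by (simp add: Suc Quad_diff_sum)
  also have "\<dots> = (\<Sum>x\<in>level_nodes (\<alpha> (Suc m)). level_weight (\<alpha> (Suc m)) x *\<^sub>R product_rule {1..m} \<alpha> (\<lambda>\<xi>. g (\<xi>(Suc m := x))))"
    unfolding product_rule_def
    by (simp add: sum_distrib_left) (subst sum.swap, simp add: mult_ac)
  also have "\<dots> = product_rule {1..Suc m} \<alpha> g"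
    unfolding ins by (rule product_rule_insert[symmetric]) auto
  finally show ?case .
qed

section \<open>Separately holomorphic functions under tensor product rules\<close>

definition admissible :: "nat set \<Rightarrow> (nat \<Rightarrow> real) \<Rightarrow> real \<Rightarrow> ((nat \<Rightarrow> complex) \<Rightarrow> complex) \<Rightarrow> bool" where
  "admissible J \<tau> M H \<longleftrightarrow> (\<forall>z. (\<forall>n\<in>J. z n \<in> tube (\<tau> n)) \<longrightarrow>
     cmod (H z) \<le> M \<and> (\<forall>n\<in>J. (\<lambda>w. H (z(n := w))) holomorphic_on tube (\<tau> n)))"

lemma admissible_bound: "admissible J \<tau> M H \<Longrightarrow> \<forall>n\<in>J. z n \<in> tube (\<tau> n) \<Longrightarrow> cmod (H z) \<le> M"
  by (simp add: admissible_def)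

lemma admissible_slice:
  assumes "admissible J \<tau> M H" "\<forall>n\<in>J. z n \<in> tube (\<tau> n)" "n \<in> J"
  shows "(\<lambda>w. H (z(n := w))) holomorphic_on tube (\<tau> n)"
    and "w \<in> tube (\<tau> n) \<Longrightarrow> cmod (H (z(n := w))) \<le> M"
proof -
  show "(\<lambda>w. H (z(n := w))) holomorphic_on tube (\<tau> n)"
    using assms unfolding admissible_def by blast
  assume "w \<in> tube (\<tau> n)"
  then have "\<forall>k\<in>J. (z(n := w)) k \<in> tube (\<tau> k)" using assms(2) by auto
  then show "cmod (H (z(n := w))) \<le> M" using assms(1) unfolding admissible_def by blast
qed

definition rate_bound :: "(nat \<Rightarrow> real) \<Rightarrow> (nat \<Rightarrow> real) \<Rightarrow> (nat \<Rightarrow> nat) \<Rightarrow> nat \<Rightarrow> real" where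
  "rate_bound \<tau> c \<alpha> k = level_factor c k (\<alpha> k) / kappa \<tau> k ^ \<alpha> k"

text \<open>One univariate difference trades the bound M for its rate times M and keeps holomorphy
  in the remaining variables, so the estimate can be iterated over the variables.\<close>

lemma admissible_quad_step:
  assumes H: "admissible J \<tau> M H" and k: "k \<in> J" "\<tau> k > 0"
    and c: "2 / \<tau> k \<le> c k \<or> 43 / 5 / kappa \<tau> k \<le> c k"
  shows "admissible (J - {k}) \<tau> (rate_bound \<tau> c \<alpha> k * M)
     (\<lambda>z. \<Sum>x\<in>level_nodes (\<alpha> k). level_weight (\<alpha> k) x *\<^sub>R H (z(k := of_real x)))"
  unfolding admissible_def
proof (intro allI impI conjI ballI)
  fix z assume z: "\<forall>n\<in>J - {k}. z n \<in> tube (\<tau> n)"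
  \<comment> \<open>Coordinate k of z may lie outside its tube; as it is replaced by nodes anyway, 0
    serves as a legal value.\<close>
  define z' where "z' = z(k := 0)"
  have z': "\<forall>n\<in>J. z' n \<in> tube (\<tau> n)"
    using z real_in_tube[OF k(2), of 0] by (auto simp: z'_def)
  define u where "u = (\<lambda>w. H (z(k := w)))"
  have u: "u holomorphic_on tube (\<tau> k)" "\<And>w. w \<in> tube (\<tau> k) \<Longrightarrow> cmod (u w) \<le> M"
    using admissible_slice[OF H z' k(1)] by (simp_all only: u_def z'_def fun_upd_upd)
  show "cmod (\<Sum>x\<in>level_nodes (\<alpha> k). level_weight (\<alpha> k) x *\<^sub>R H (z(k := of_real x))) \<le> rate_bound \<tau> c \<alpha> k * M"
  \<comment> \<open>The univariate bound concerns real functions, so it is applied to the real part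
    of u multiplied by an arbitrary unimodular e, which loses no constant.\<close>
  proof (rule norm_le_if_Re_le)
    fix e :: complex assume e: "cmod e = 1"
    have "Re (e * (\<Sum>x\<in>level_nodes (\<alpha> k). level_weight (\<alpha> k) x *\<^sub>R H (z(k := of_real x))))
        = Quad_diff (\<alpha> k) (\<lambda>x. Re (e * u (of_real x)))"
      by (simp add: Quad_diff_sum u_def sum_distrib_left)
    also have "\<dots> \<le> rate_bound \<tau> c \<alpha> k * M"
      using quad_diff_bound[OF k(2), of "\<lambda>w. e * u w" M c k "\<alpha> k"] u e c
      by (simp add: rate_bound_def kappa_def holomorphic_on_mult norm_mult)
    finally show "Re (e * (\<Sum>x\<in>level_nodes (\<alpha> k). level_weight (\<alpha> k) x *\<^sub>R H (z(k := of_real x)))) \<le> rate_bound \<tau> c \<alpha> k * M" .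
  qed
  fix n assume n: "n \<in> J - {k}"
  show "(\<lambda>w. \<Sum>x\<in>level_nodes (\<alpha> k). level_weight (\<alpha> k) x *\<^sub>R H ((z(n := w))(k := of_real x))) holomorphic_on tube (\<tau> n)"
    unfolding scaleR_conv_of_real
  proof (intro holomorphic_intros)
    fix x assume "x \<in> level_nodes (\<alpha> k)"
    then have "\<forall>i\<in>J. (z(k := of_real x)) i \<in> tube (\<tau> i)"
      using z real_in_tube[OF k(2) level_nodes_bound] by auto
    from admissible_slice(1)[OF H this, of n] n
    have "(\<lambda>w. H ((z(k := of_real x))(n := w))) holomorphic_on tube (\<tau> n)" by blast
    moreover have "(z(n := w))(k := of_real x) = (z(k := of_real x))(n := w)" for w
      using n by (intro fun_upd_twist) auto
    ultimately show "(\<lambda>w. H ((z(n := w))(k := of_real x))) holomorphic_on tube (\<tau> n)"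
      by (simp only:)
  qed
qed

lemma admissible_product_rule:
  assumes "finite S" "S \<subseteq> J" and H: "admissible J \<tau> M H" and \<tau>: "\<And>n. n \<in> J \<Longrightarrow> \<tau> n > 0"
    and c: "\<And>n. n \<in> J \<Longrightarrow> 2 / \<tau> n \<le> c n \<or> 43 / 5 / kappa \<tau> n \<le> c n"
  shows "admissible (J - S) \<tau> ((\<Prod>k\<in>S. rate_bound \<tau> c \<alpha> k) * M)
     (\<lambda>z. product_rule S \<alpha> (\<lambda>\<xi>. H (overwrite S (\<lambda>n. of_real (\<xi> n)) z)))"
  using assms(1,2)
proof (induction S rule: finite_induct)
  case empty
  show ?case using H by (simp add: product_rule_def PiE_empty_domain overwrite_def)
next
  case (insert k S)
  define V where "V = (\<lambda>z. product_rule S \<alpha> (\<lambda>\<xi>. H (overwrite S (\<lambda>n. of_real (\<xi> n)) z)))"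
  have "admissible (J - S) \<tau> ((\<Prod>k\<in>S. rate_bound \<tau> c \<alpha> k) * M) V"
    using insert by (auto simp: V_def)
  from admissible_quad_step[OF this, of k c \<alpha>]
  have step: "admissible (J - S - {k}) \<tau> (rate_bound \<tau> c \<alpha> k * ((\<Prod>k\<in>S. rate_bound \<tau> c \<alpha> k) * M))
      (\<lambda>z. \<Sum>x\<in>level_nodes (\<alpha> k). level_weight (\<alpha> k) x *\<^sub>R V (z(k := of_real x)))"
    using insert \<tau> c by auto
  have "(\<Sum>x\<in>level_nodes (\<alpha> k). level_weight (\<alpha> k) x *\<^sub>R V (z(k := of_real x)))
      = product_rule (insert k S) \<alpha> (\<lambda>\<xi>. H (overwrite (insert k S) (\<lambda>n. of_real (\<xi> n)) z))" for z
  proof -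
    have "overwrite (insert k S) (\<lambda>n. complex_of_real ((\<xi>(k := x)) n)) z = overwrite S (\<lambda>n. of_real (\<xi> n)) (z(k := of_real x))" for \<xi> x
      using insert(2) by (auto simp: overwrite_def)
    then show ?thesis
      unfolding product_rule_insert[OF insert(1,2)] V_def by simp
  qed
  moreover have "J - S - {k} = J - insert k S" by auto
  ultimately show ?case
    using step insert(1,2) by (simp add: mult.assoc)
qed

section \<open>Recursion over the number of variables\<close>

lemma index_set_Suc:
  assumes w: "w (Suc m) > 0"
  shows "index_set w q (Suc m) = (\<lambda>(\<alpha>, j). \<alpha>(Suc m := j)) `
     (SIGMA \<alpha>:index_set w q m. {..nat \<lfloor>(real q - (\<Sum>n=1..m. real (\<alpha> n) * w n)) / w (Suc m)\<rfloor>})"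
    (is "_ = ?f ` ?S")
proof (intro equalityI subsetI)
  have level: "j \<le> nat \<lfloor>(real q - s) / w (Suc m)\<rfloor> \<longleftrightarrow> s + real j * w (Suc m) \<le> real q" if "s \<le> real q" for j s
  proof -
    have "(real q - s) / w (Suc m) \<ge> 0" using that w by simp
    then have "j \<le> nat \<lfloor>(real q - s) / w (Suc m)\<rfloor> \<longleftrightarrow> real j \<le> (real q - s) / w (Suc m)"
      by (simp add: le_nat_iff le_floor_iff)
    also have "\<dots> \<longleftrightarrow> s + real j * w (Suc m) \<le> real q"
      using w by (simp add: pos_le_divide_eq algebra_simps)
    finally show ?thesis .
  qed
  have sum_upd: "(\<Sum>n=1..m. real ((\<alpha>(Suc m := j)) n) * w n) = (\<Sum>n=1..m. real (\<alpha> n) * w n)" for \<alpha> j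
    by (intro sum.cong) auto
  {
    fix \<beta> assume \<beta>: "\<beta> \<in> index_set w q (Suc m)"
    define \<alpha> where "\<alpha> = \<beta>(Suc m := undefined)"
    have s: "(\<Sum>n=1..m. real (\<alpha> n) * w n) = (\<Sum>n=1..m. real (\<beta> n) * w n)"
      unfolding \<alpha>_def by (rule sum_upd)
    have total: "(\<Sum>n=1..m. real (\<beta> n) * w n) + real (\<beta> (Suc m)) * w (Suc m) \<le> real q"
      using \<beta> by (simp add: index_set_def)
    then have le: "(\<Sum>n=1..m. real (\<beta> n) * w n) \<le> real q"
      using w by (smt (verit) mult_nonneg_nonneg of_nat_0_le_iff)
    have "\<alpha> \<in> index_set w q m"
      using \<beta> le s by (auto simp: index_set_def PiE_iff extensional_def \<alpha>_def)
    moreover have "\<beta> (Suc m) \<le> nat \<lfloor>(real q - (\<Sum>n=1..m. real (\<alpha> n) * w n)) / w (Suc m)\<rfloor>"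
      unfolding s level[OF le] by (rule total)
    moreover have "\<beta> = ?f (\<alpha>, \<beta> (Suc m))" by (simp add: \<alpha>_def)
    ultimately show "\<beta> \<in> ?f ` ?S" by (intro image_eqI[of _ _ "(\<alpha>, \<beta> (Suc m))"]) auto
  next
    fix \<beta> assume "\<beta> \<in> ?f ` ?S"
    then obtain \<alpha> j where \<beta>: "\<beta> = \<alpha>(Suc m := j)" and \<alpha>: "\<alpha> \<in> index_set w q m"
      and j: "j \<le> nat \<lfloor>(real q - (\<Sum>n=1..m. real (\<alpha> n) * w n)) / w (Suc m)\<rfloor>" by auto
    have "(\<Sum>n=1..m. real (\<alpha> n) * w n) \<le> real q" using \<alpha> by (simp add: index_set_def)
    from level[OF this] j have "(\<Sum>n=1..m. real (\<alpha> n) * w n) + real j * w (Suc m) \<le> real q" by simp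
    then have "(\<Sum>n=1..Suc m. real (\<beta> n) * w n) \<le> real q"
      unfolding \<beta> by (simp add: sum_upd)
    moreover have "\<beta> \<in> PiE {1..Suc m} (\<lambda>_. UNIV)"
      using \<alpha> by (auto simp: \<beta> index_set_def PiE_iff extensional_def)
    ultimately show "\<beta> \<in> index_set w q (Suc m)" by (simp add: index_set_def)
  }
qed

lemma sum_index_set_Suc:
  fixes G :: "(nat \<Rightarrow> nat) \<Rightarrow> real"
  assumes w: "\<And>n. n \<in> {1..Suc m} \<Longrightarrow> w n > 0"
  shows "(\<Sum>\<beta>\<in>index_set w q (Suc m). G \<beta>) = (\<Sum>\<alpha>\<in>index_set w q m.
     \<Sum>j\<le>nat \<lfloor>(real q - (\<Sum>n=1..m. real (\<alpha> n) * w n)) / w (Suc m)\<rfloor>. G (\<alpha>(Suc m := j)))"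
proof -
  have inj: "inj_on (\<lambda>(\<alpha>, j). \<alpha>(Suc m := j))
     (SIGMA \<alpha>:index_set w q m. {..nat \<lfloor>(real q - (\<Sum>n=1..m. real (\<alpha> n) * w n)) / w (Suc m)\<rfloor>})"
  proof (rule inj_onI, clarify)
    fix \<alpha> \<beta> :: "nat \<Rightarrow> nat" and i j
    assume \<alpha>\<beta>: "\<alpha> \<in> index_set w q m" "\<beta> \<in> index_set w q m" and eq: "\<alpha>(Suc m := i) = \<beta>(Suc m := j)"
    have "\<alpha> n = \<beta> n" for n
    proof (cases "n = Suc m")
      case True
      then show ?thesis using \<alpha>\<beta> by (simp add: index_set_def PiE_iff extensional_def)
    next
      case False
      then show ?thesis using fun_cong[OF eq, of n] by simp
    qed
    moreover have "i = j" using fun_cong[OF eq, of "Suc m"] by simp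
    ultimately show "\<alpha> = \<beta> \<and> i = j" by auto
  qed
  show ?thesis
    unfolding index_set_Suc[of w m q, OF w[of "Suc m", simplified]] sum.reindex[OF inj]
    using w by (subst sum.Sigma) (auto simp: case_prod_unfold intro!: finite_index_set)
qed

text \<open>Fubini's theorem with the new variable outermost: the error of the earlier variables is
  estimated for each fixed value of the new one.\<close>

lemma integral_PiM_insert_outer:
  fixes \<phi> :: "('i \<Rightarrow> real) \<Rightarrow> real" and P :: "real measure"
  assumes P: "prob_space P" and I: "i \<notin> I"
    and \<phi>: "integrable (PiM (insert i I) (\<lambda>_. P)) \<phi>"
  shows "integrable P (\<lambda>t. LINT X|PiM I (\<lambda>_. P). \<phi> (X(i := t)))"
    and "(LINT X|PiM (insert i I) (\<lambda>_. P). \<phi> X) = (LINT t|P. LINT X|PiM I (\<lambda>_. P). \<phi> (X(i := t)))"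
proof -
  interpret P: prob_space P by (rule P)
  interpret PI: prob_space "PiM I (\<lambda>_. P)" by (intro prob_space_PiM P)
  interpret pair: pair_sigma_finite P "PiM I (\<lambda>_. P)" ..
  have meas: "(\<lambda>(x, X). X(i := x)) \<in> P \<Otimes>\<^sub>M PiM I (\<lambda>_. P) \<rightarrow>\<^sub>M PiM (insert i I) (\<lambda>_. P)"
    by measurable
  have distr: "distr (P \<Otimes>\<^sub>M PiM I (\<lambda>_. P)) (PiM (insert i I) (\<lambda>_. P)) (\<lambda>(x, X). X(i := x)) = PiM (insert i I) (\<lambda>_. P)"
    by (rule distr_pair_PiM_eq_PiM) (auto intro: P)
  have int: "integrable (P \<Otimes>\<^sub>M PiM I (\<lambda>_. P)) (\<lambda>z. \<phi> ((\<lambda>(x, X). X(i := x)) z))"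
    using \<phi> by (intro integrable_distr[OF meas]) (simp add: distr)
  then have int': "integrable (P \<Otimes>\<^sub>M PiM I (\<lambda>_. P)) (\<lambda>(t, X). \<phi> (X(i := t)))"
    by (simp add: case_prod_unfold)
  show "integrable P (\<lambda>t. LINT X|PiM I (\<lambda>_. P). \<phi> (X(i := t)))"
    using pair.integrable_fst'[OF int'] by simp
  have "(LINT X|PiM (insert i I) (\<lambda>_. P). \<phi> X) = (LINT z|(P \<Otimes>\<^sub>M PiM I (\<lambda>_. P)). \<phi> ((\<lambda>(x, X). X(i := x)) z))"
    using \<phi> by (subst distr[symmetric], intro integral_distr[OF meas]) auto
  also have "\<dots> = (LINT t|P. LINT X|PiM I (\<lambda>_. P). \<phi> (X(i := t)))"
    using pair.integral_fst'[OF int'] by (simp add: case_prod_unfold)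
  finally show "(LINT X|PiM (insert i I) (\<lambda>_. P). \<phi> X) = (LINT t|P. LINT X|PiM I (\<lambda>_. P). \<phi> (X(i := t)))" .
qed

text \<open>The point y for the remaining variables is kept as a parameter because the induction
  step integrates over its next coordinate.\<close>

definition block_error :: "(nat \<Rightarrow> real) \<Rightarrow> nat \<Rightarrow> nat \<Rightarrow> ((nat \<Rightarrow> real) \<Rightarrow> real) \<Rightarrow> (nat \<Rightarrow> real) \<Rightarrow> real" where
  "block_error w q k g y = (LINT x|PiM {1..k} (\<lambda>_. \<Gamma>_measure). g (overwrite {1..k} x y))
     - (\<Sum>\<alpha>\<in>index_set w q k. product_rule {1..k} \<alpha> (\<lambda>\<xi>. g (overwrite {1..k} \<xi> y)))"

lemma overwrite_insert: "k \<notin> S \<Longrightarrow> overwrite (insert k S) (x(k := t)) y = overwrite S x (y(k := t))"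
  by (auto simp: overwrite_def)

lemma overwrite_Suc: "overwrite {1..Suc k} (x(Suc k := t)) y = overwrite {1..k} x (y(Suc k := t))"
  by (auto simp: overwrite_def)

text \<open>With r the unspent budget, the floor is the last level that can be afforded; the next
  one overspends it, and this next level is the exponent in the quadrature error.\<close>

lemma level_complement:
  assumes w: "w > 0" and r: "r \<ge> 0"
  shows "exp (- (w * real (Suc (nat \<lfloor>r / w\<rfloor>)))) \<le> exp (- r)"
proof -
  have "r / w \<ge> 0" using assms by simp
  then have "r / w < real (Suc (nat \<lfloor>r / w\<rfloor>))" by linarith
  then have "r < w * real (Suc (nat \<lfloor>r / w\<rfloor>))" using w by (simp add: pos_divide_less_eq mult.commute)
  then show ?thesis by simp
qed

text \<open>H supplies the analytic bounds and g the integrals; they are linked at real points only.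
  Measurability is required for each k because every induction step integrates over one variable
  more.\<close>

lemma block_error_bound:
  fixes g :: "(nat \<Rightarrow> real) \<Rightarrow> real"
  assumes H: "admissible {1..m} \<tau> M H"
    and real: "\<And>y. \<forall>n\<in>{1..m}. y n \<in> \<Gamma> \<Longrightarrow> H (\<lambda>n. of_real (y n)) = of_real (g y)"
    and meas: "\<And>k y. k \<le> m \<Longrightarrow> \<forall>n\<in>{1..m}. y n \<in> \<Gamma> \<Longrightarrow>
        (\<lambda>x. g (overwrite {1..k} x y)) \<in> borel_measurable (PiM {1..k} (\<lambda>_. \<Gamma>_measure))"
    and \<tau>: "\<And>n. n \<in> {1..m} \<Longrightarrow> \<tau> n > 0"
    and c: "\<And>n. n \<in> {1..m} \<Longrightarrow> 2 / \<tau> n \<le> c n \<or> 43 / 5 / kappa \<tau> n \<le> c n"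
    and c_nonneg: "\<And>n. n \<in> {1..m} \<Longrightarrow> c n \<ge> 0"
    and k: "k \<le> m" and y: "\<forall>n\<in>{1..m}. y n \<in> \<Gamma>"
  shows "\<bar>block_error (weight \<tau>) q k g y\<bar>
     \<le> (\<Sum>n=1..k. 2 / \<tau> n * (\<Sum>\<alpha>\<in>index_set (weight \<tau>) q (n - 1). \<Prod>i=1..n - 1. level_factor c i (\<alpha> i))) * exp (- real q) * M"
  using k y
proof (induction k arbitrary: y)
  case 0
  interpret P0: prob_space "PiM {1..0 :: nat} (\<lambda>_. \<Gamma>_measure)"
    by (intro prob_space_PiM prob_space_Gamma_measure)
  have "index_set (weight \<tau>) q 0 = {\<lambda>_. undefined}"
    by (simp add: index_set_def PiE_empty_domain)
  moreover have "overwrite {1..0} x y = y" for x by (simp add: overwrite_def)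
  ultimately show ?case
    using P0.prob_space by (simp add: block_error_def product_rule_def PiE_empty_domain)
next
  case (Suc k)
  define w where "w = weight \<tau>"
  define P where "P I = PiM I (\<lambda>_ :: nat. \<Gamma>_measure)" for I
  interpret G: prob_space \<Gamma>_measure by (rule prob_space_Gamma_measure)
  have kappa_gt: "kappa \<tau> n > 1" if "n \<in> {1..m}" for n
    using tube_radius_gt_1[OF \<tau>[OF that]] by (simp add: kappa_def)
  have w_pos: "w n > 0" if "n \<in> {1..m}" for n using kappa_gt[OF that] by (simp add: w_def weight_def)
  have ins: "{1..Suc k} = insert (Suc k) {1..k}" by auto
  have g_bound: "\<bar>g y\<bar> \<le> M" if "\<forall>n\<in>{1..m}. y n \<in> \<Gamma>" for y
  proof -
    have "\<forall>n\<in>{1..m}. complex_of_real (y n) \<in> tube (\<tau> n)"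
      using that real_in_tube \<tau> by (auto simp: abs_le_iff)
    from admissible_bound[OF H this] have "cmod (H (\<lambda>n. of_real (y n))) \<le> M" .
    then show ?thesis using real[OF that] by simp
  qed
  have y_upd: "\<forall>n\<in>{1..m}. (y(Suc k := t)) n \<in> \<Gamma>" if "t \<in> \<Gamma>" for t using Suc.prems that by auto
  define A where "A t = (LINT x|P {1..k}. g (overwrite {1..k} x (y(Suc k := t))))" for t
  define h where "h \<alpha> t = product_rule {1..k} \<alpha> (\<lambda>\<xi>. g (overwrite {1..k} \<xi> (y(Suc k := t))))" for \<alpha> t
  define u where "u \<alpha> z = product_rule {1..k} \<alpha> (\<lambda>\<xi>. H (overwrite {1..k} (\<lambda>n. of_real (\<xi> n)) ((\<lambda>n. of_real (y n))(Suc k := z))))" for \<alpha> z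
  define J where "J \<alpha> = nat \<lfloor>(real q - (\<Sum>n=1..k. real (\<alpha> n) * w n)) / w (Suc k)\<rfloor>" for \<alpha>
  define R where "R \<alpha> = (\<Prod>i=1..k. rate_bound \<tau> c \<alpha> i)" for \<alpha>
  define B where "B = (\<Sum>\<alpha>\<in>index_set w q k. \<Prod>i=1..k. level_factor c i (\<alpha> i))"
  have k: "k \<le> m" "Suc k \<in> {1..m}" using Suc.prems by auto

  have integrable: "integrable (P {1..Suc k}) (\<lambda>x. g (overwrite {1..Suc k} x y))"
  proof -
    interpret PP: prob_space "P {1..Suc k}"
      unfolding P_def by (intro prob_space_PiM prob_space_Gamma_measure)
    have "\<bar>g (overwrite {1..Suc k} x y)\<bar> \<le> M" if "x \<in> space (P {1..Suc k})" for x
      using that Suc.prems by (intro g_bound) (auto simp: overwrite_def P_def space_PiM PiE_iff)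
    then show ?thesis
      using meas[OF Suc.prems] unfolding P_def
      by (intro PP.integrable_const_bound[unfolded P_def, of _ M]) (auto simp: P_def)
  qed
  have A_int: "integrable \<Gamma>_measure A"
    and A: "(LINT x|P {1..Suc k}. g (overwrite {1..Suc k} x y)) = (LINT t|\<Gamma>_measure. A t)"
    using integral_PiM_insert_outer[OF prob_space_Gamma_measure, of "Suc k" "{1..k}" "\<lambda>x. g (overwrite {1..Suc k} x y)"] integrable
    unfolding ins[symmetric] A_def P_def overwrite_Suc by auto

  have u_adm: "u \<alpha> holomorphic_on tube (\<tau> (Suc k))"
    "\<And>z. z \<in> tube (\<tau> (Suc k)) \<Longrightarrow> cmod (u \<alpha> z) \<le> R \<alpha> * M" for \<alpha>
  proof -
    have adm: "admissible ({1..m} - {1..k}) \<tau> (R \<alpha> * M)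
        (\<lambda>z. product_rule {1..k} \<alpha> (\<lambda>\<xi>. H (overwrite {1..k} (\<lambda>n. of_real (\<xi> n)) z)))"
      unfolding R_def using k by (intro admissible_product_rule H \<tau> c) auto
    have "\<forall>n\<in>{1..m} - {1..k}. complex_of_real (y n) \<in> tube (\<tau> n)"
      using Suc.prems real_in_tube \<tau> by (auto simp: abs_le_iff)
    from admissible_slice[OF adm this, of "Suc k"] k(2)
    show "u \<alpha> holomorphic_on tube (\<tau> (Suc k))"
      "\<And>z. z \<in> tube (\<tau> (Suc k)) \<Longrightarrow> cmod (u \<alpha> z) \<le> R \<alpha> * M"
      by (auto simp: u_def[abs_def])
  qed
  have u_h: "Re (u \<alpha> (of_real t)) = h \<alpha> t" if t: "t \<in> \<Gamma>" for \<alpha> t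
  proof -
    have "H (overwrite {1..k} (\<lambda>n. of_real (\<xi> n)) ((\<lambda>n. of_real (y n))(Suc k := of_real t)))
        = of_real (g (overwrite {1..k} \<xi> (y(Suc k := t))))" if \<xi>: "\<xi> \<in> PiE {1..k} (\<lambda>n. level_nodes (\<alpha> n))" for \<xi>
    proof -
      have "overwrite {1..k} (\<lambda>n. of_real (\<xi> n)) ((\<lambda>n. of_real (y n))(Suc k := of_real t))
          = (\<lambda>n. complex_of_real (overwrite {1..k} \<xi> (y(Suc k := t)) n))"
        by (auto simp: overwrite_def)
      moreover have "\<forall>n\<in>{1..m}. overwrite {1..k} \<xi> (y(Suc k := t)) n \<in> \<Gamma>"
      proof
        fix n assume n: "n \<in> {1..m}"
        show "overwrite {1..k} \<xi> (y(Suc k := t)) n \<in> \<Gamma>"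
        proof (cases "n \<in> {1..k}")
          case True
          then have "\<xi> n \<in> level_nodes (\<alpha> n)" using \<xi> by (rule PiE_mem[rotated])
          from level_nodes_bound[OF this] show ?thesis using True by (simp add: overwrite_def abs_le_iff)
        next
          case False
          then show ?thesis using y_upd[OF t] n unfolding overwrite_def by metis
        qed
      qed
      ultimately show ?thesis using real by simp
    qed
    then show ?thesis
      by (simp add: u_def h_def product_rule_def)
  qed
  have h_cont: "continuous_on \<Gamma> (h \<alpha>)" for \<alpha>
    using continuous_on_Re_tube[OF u_adm(1) \<tau>[OF k(2)], of \<alpha>] u_h by (simp cong: continuous_on_cong_simp)
  have h_int: "integrable \<Gamma>_measure (h \<alpha>)" for \<alpha> by (rule integrable_Gamma_measure[OF h_cont])

  \<comment> \<open>For a fixed multi-index in the first k directions, the levels of the new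
    direction fill an interval from 0 to J, and their differences collapse to the single quadrature
    of level J.\<close>
  have sparse: "(\<Sum>\<beta>\<in>index_set w q (Suc k). product_rule {1..Suc k} \<beta> (\<lambda>\<xi>. g (overwrite {1..Suc k} \<xi> y)))
      = (\<Sum>\<alpha>\<in>index_set w q k. Quad (J \<alpha>) (h \<alpha>))"
  proof -
    have "product_rule {1..Suc k} (\<alpha>(Suc k := j)) (\<lambda>\<xi>. g (overwrite {1..Suc k} \<xi> y)) = Quad_diff j (h \<alpha>)" for \<alpha> j
    proof -
      have "product_rule {1..k} (\<alpha>(Suc k := j)) = (product_rule {1..k} \<alpha> :: ((nat \<Rightarrow> real) \<Rightarrow> real) \<Rightarrow> real)"
        unfolding product_rule_def by (intro ext sum.cong arg_cong2[where f = scaleR] prod.cong PiE_cong) auto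
      then show ?thesis
        unfolding ins by (subst product_rule_insert) (auto simp: Quad_diff_sum h_def overwrite_insert)
    qed
    then have "(\<Sum>\<beta>\<in>index_set w q (Suc k). product_rule {1..Suc k} \<beta> (\<lambda>\<xi>. g (overwrite {1..Suc k} \<xi> y)))
        = (\<Sum>\<alpha>\<in>index_set w q k. \<Sum>j\<le>J \<alpha>. Quad_diff j (h \<alpha>))"
      using Suc.prems w_pos by (subst sum_index_set_Suc) (auto simp: J_def)
    then show ?thesis by (simp only: sum_Quad_diff)
  qed
  have err_slice: "block_error w q k g (y(Suc k := t)) = A t - (\<Sum>\<alpha>\<in>index_set w q k. h \<alpha> t)" for t
    by (simp add: block_error_def A_def h_def P_def)
  have err: "block_error w q (Suc k) g y = (LINT t|\<Gamma>_measure. block_error w q k g (y(Suc k := t)))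
      + (\<Sum>\<alpha>\<in>index_set w q k. (LINT t|\<Gamma>_measure. h \<alpha> t) - Quad (J \<alpha>) (h \<alpha>))"
  proof -
    have "(LINT t|\<Gamma>_measure. block_error w q k g (y(Suc k := t)))
        = (LINT t|\<Gamma>_measure. A t) - (\<Sum>\<alpha>\<in>index_set w q k. LINT t|\<Gamma>_measure. h \<alpha> t)"
      unfolding err_slice using A_int h_int by (simp add: Bochner_Integration.integral_diff Bochner_Integration.integral_sum)
    then show ?thesis
      using A sparse by (simp add: block_error_def P_def sum_subtractf)
  qed

  have "\<bar>LINT t|\<Gamma>_measure. block_error w q k g (y(Suc k := t))\<bar>
      \<le> (\<Sum>n=1..k. 2 / \<tau> n * (\<Sum>\<alpha>\<in>index_set w q (n - 1). \<Prod>i=1..n - 1. level_factor c i (\<alpha> i))) * exp (- real q) * M"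
    unfolding w_def using k y_upd by (intro integral_Gamma_bound Suc.IH) auto
  moreover have "\<bar>\<Sum>\<alpha>\<in>index_set w q k. (LINT t|\<Gamma>_measure. h \<alpha> t) - Quad (J \<alpha>) (h \<alpha>)\<bar> \<le> 2 / \<tau> (Suc k) * B * exp (- real q) * M"
  proof -
    have "\<bar>(LINT t|\<Gamma>_measure. h \<alpha> t) - Quad (J \<alpha>) (h \<alpha>)\<bar> \<le> 2 / \<tau> (Suc k) * (\<Prod>i=1..k. level_factor c i (\<alpha> i)) * exp (- real q) * M"
      if \<alpha>: "\<alpha> \<in> index_set w q k" for \<alpha>
    proof -
      define L where "L = (\<Prod>i=1..k. level_factor c i (\<alpha> i))"
      \<comment> \<open>Since kappa_i^alpha_i = exp (alpha_i w_i), the rates of the first k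
        directions multiply to exp (-s), where s is the budget spent by alpha; the new direction
        accounts for the remaining q - s.\<close>
      define s where "s = (\<Sum>n=1..k. real (\<alpha> n) * w n)"
      have s: "s \<le> real q" using \<alpha> by (simp add: index_set_def s_def)
      have M: "M \<ge> 0" using g_bound[OF Suc.prems(2)] by linarith
      have L: "L \<ge> 0"
        unfolding L_def using c_nonneg k by (intro prod_nonneg) (auto simp: level_factor_def)
      have rate: "R \<alpha> = L * exp (- s)"
      proof -
        have "kappa \<tau> i ^ \<alpha> i = exp (real (\<alpha> i) * w i)" if "i \<in> {1..k}" for i
          using kappa_gt[of i] that k by (simp add: w_def weight_def exp_of_nat_mult)
        then have "R \<alpha> = (\<Prod>i=1..k. level_factor c i (\<alpha> i) * exp (- (real (\<alpha> i) * w i)))"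
          unfolding R_def by (intro prod.cong) (auto simp: rate_bound_def exp_minus field_simps)
        then show ?thesis by (simp add: prod.distrib L_def s_def exp_sum[symmetric] sum_negf[symmetric])
      qed
      have "\<bar>(LINT t|\<Gamma>_measure. h \<alpha> t) - Quad (J \<alpha>) (h \<alpha>)\<bar>
          = \<bar>(LINT t|\<Gamma>_measure. Re (u \<alpha> (of_real t))) - Quad (J \<alpha>) (\<lambda>t. Re (u \<alpha> (of_real t)))\<bar>"
      proof -
        have "(LINT t|\<Gamma>_measure. h \<alpha> t) = (LINT t|\<Gamma>_measure. Re (u \<alpha> (of_real t)))"
          using u_h by (intro Bochner_Integration.integral_cong) auto
        moreover have "Quad (J \<alpha>) (h \<alpha>) = Quad (J \<alpha>) (\<lambda>t. Re (u \<alpha> (of_real t)))"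
          unfolding Quad_def gauss_legendre_def using u_h gauss_node_bound by (intro sum.cong) auto
        ultimately show ?thesis by simp
      qed
      also have "\<dots> \<le> 2 * (R \<alpha> * M) / (\<tau> (Suc k) * kappa \<tau> (Suc k) ^ Suc (J \<alpha>))"
        unfolding kappa_def by (rule quadrature_error_bound[OF \<tau>[OF k(2)] u_adm])
      also have "\<dots> = 2 / \<tau> (Suc k) * L * M * (exp (- s) * exp (- (w (Suc k) * real (Suc (J \<alpha>)))))"
      proof -
        have "kappa \<tau> (Suc k) ^ Suc (J \<alpha>) = exp (w (Suc k) * real (Suc (J \<alpha>)))"
          using kappa_gt[OF k(2)] by (simp only: exp_of_nat2_mult) (simp add: w_def weight_def)
        moreover have "2 * (L * a * M) / (\<tau> (Suc k) * exp X) = 2 / \<tau> (Suc k) * L * M * (a * exp (- X))" for a X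
          by (simp add: exp_minus field_simps)
        ultimately show ?thesis unfolding rate by simp
      qed
      also have "\<dots> \<le> 2 / \<tau> (Suc k) * L * M * (exp (- s) * exp (- (real q - s)))"
        unfolding J_def s_def[symmetric]
        using L M \<tau>[OF k(2)] s by (intro mult_left_mono level_complement w_pos[OF k(2)]) auto
      also have "exp (- s) * exp (- (real q - s)) = exp (- real q)" by (simp add: exp_add[symmetric])
      finally show ?thesis by (simp add: L_def mult_ac)
    qed
    then have "\<bar>\<Sum>\<alpha>\<in>index_set w q k. (LINT t|\<Gamma>_measure. h \<alpha> t) - Quad (J \<alpha>) (h \<alpha>)\<bar>
        \<le> (\<Sum>\<alpha>\<in>index_set w q k. 2 / \<tau> (Suc k) * (\<Prod>i=1..k. level_factor c i (\<alpha> i)) * exp (- real q) * M)"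
      by (intro order_trans[OF sum_abs] sum_mono)
    then show ?thesis by (simp only: B_def sum_distrib_left sum_distrib_right)
  qed
  ultimately show ?case
    unfolding w_def[symmetric] err by (simp add: B_def distrib_right)
qed

section \<open>Analytic extensions, infinite products and the error estimate\<close>

lemma tube_subset_nbhd: "tube t \<subseteq> \<Sigma>_nbhd t"
  by (auto simp: tube_def \<Sigma>_nbhd_def)

lemma real_in_nbhd: "t > 0 \<Longrightarrow> x \<in> \<Gamma> \<Longrightarrow> complex_of_real x \<in> \<Sigma>_nbhd t"
  using tube_subset_nbhd real_in_tube by (fastforce simp: abs_le_iff)

lemma compact_nbhd: "compact (\<Sigma>_nbhd t)"
proof -
  have compact: "compact (complex_of_real ` \<Gamma>)"
    by (intro compact_continuous_image continuous_intros) auto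
  have "closed (\<Sigma>_nbhd t)"
    unfolding \<Sigma>_nbhd_def by (intro closed_Collect_le continuous_intros)
  moreover have "\<Sigma>_nbhd t \<subseteq> cball 0 (1 + t)"
  proof
    fix z assume z: "z \<in> \<Sigma>_nbhd t"
    obtain a where a: "a \<in> complex_of_real ` \<Gamma>" "infdist z (complex_of_real ` \<Gamma>) = dist z a"
      using infdist_attains_inf[OF compact_imp_closed[OF compact]] by auto
    then have "cmod a \<le> 1" "dist z a \<le> t" using z by (auto simp: \<Sigma>_nbhd_def)
    then show "z \<in> cball 0 (1 + t)"
      using norm_triangle_ineq[of a "z - a"] by (simp add: dist_norm)
  qed
  ultimately show ?thesis
    using bounded_subset[OF bounded_cball] compact_eq_bounded_closed by blast
qed

text \<open>Unconditional summability at the point with all coordinates epsilon/2 is absolute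
  summability there, and it dominates the series in the whole polydisc of that radius.\<close>

lemma has_sum_polydisc_bound:
  fixes a :: "('i \<Rightarrow> nat) \<Rightarrow> complex" and g :: "('i \<Rightarrow> complex) \<Rightarrow> complex"
  assumes I: "finite I" and \<epsilon>: "\<epsilon> > 0"
    and sum: "\<And>h. \<forall>n\<in>I. cmod (h n) < \<epsilon> \<Longrightarrow> ((\<lambda>\<nu>. a \<nu> * (\<Prod>n\<in>I. h n ^ \<nu> n)) has_sum g h) A"
  shows "\<exists>B. \<forall>h. (\<forall>n\<in>I. cmod (h n) < \<epsilon> / 2) \<longrightarrow> cmod (g h) \<le> B"
proof -
  define t where "t = (\<lambda>\<nu>. cmod (a \<nu> * (\<Prod>n\<in>I. of_real (\<epsilon> / 2) ^ \<nu> n)))"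
  have "((\<lambda>\<nu>. a \<nu> * (\<Prod>n\<in>I. of_real (\<epsilon> / 2) ^ \<nu> n)) has_sum g (\<lambda>_. of_real (\<epsilon> / 2))) A"
    using \<epsilon> by (intro sum) auto
  then have t: "t summable_on A"
    unfolding t_def by (rule iffD1[OF summable_on_iff_abs_summable_on_complex, OF has_sum_imp_summable])
  show ?thesis
  proof (intro exI[of _ "infsum t A"] allI impI)
    fix h assume h: "\<forall>n\<in>I. cmod (h n) < \<epsilon> / 2"
    have le: "cmod (a \<nu> * (\<Prod>n\<in>I. h n ^ \<nu> n)) \<le> t \<nu>" for \<nu>
      unfolding t_def norm_mult prod_norm[symmetric] norm_power
      using h \<epsilon> by (intro mult_left_mono prod_mono conjI power_mono) (auto simp: less_imp_le)
    have s: "((\<lambda>\<nu>. a \<nu> * (\<Prod>n\<in>I. h n ^ \<nu> n)) has_sum g h) A"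
      using h \<epsilon> by (intro sum) force
    have abs: "(\<lambda>\<nu>. cmod (a \<nu> * (\<Prod>n\<in>I. h n ^ \<nu> n))) summable_on A"
      by (rule summable_on_comparison_test[OF t le]) auto
    have "cmod (g h) \<le> infsum (\<lambda>\<nu>. cmod (a \<nu> * (\<Prod>n\<in>I. h n ^ \<nu> n))) A"
      by (rule norm_has_sum_bound[OF has_sum_infsum[OF abs] s])
    also have "\<dots> \<le> infsum t A" by (rule infsum_mono[OF abs t le])
    finally show "cmod (g h) \<le> infsum t A" .
  qed
qed

text \<open>Local bounds from the power series are combined by compactness. Without this, the
  supremum in \<open>sup_norm\<close> could be taken over an unbounded set of reals, where it bounds
  nothing.\<close>

lemma analytic_on_prod_bounded:
  assumes F: "analytic_on_prod J S F" and I: "finite I" "I \<subseteq> J" and S: "\<And>n. n \<in> I \<Longrightarrow> compact (S n)"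
    and p: "p \<in> PiE J S"
  shows "\<exists>B. \<forall>z. (\<forall>n\<in>I. z n \<in> S n) \<longrightarrow> cmod (F (overwrite I z p)) \<le> B"
proof -
  \<comment> \<open>Padding with {0} outside I makes K compact in the product topology on all
    functions, so that Tychonoff's theorem applies.\<close>
  define K where "K = PiE UNIV (\<lambda>n. if n \<in> I then S n else {0 :: complex})"
  have K: "compact K"
    unfolding K_def compactin_euclidean_iff[symmetric] euclidean_product_topology[symmetric]
    using S by (simp only: compactin_PiE) auto
  have loc: "\<exists>\<epsilon> B. \<epsilon> > 0 \<and> (\<forall>z. (\<forall>n\<in>I. dist (x n) (z n) < \<epsilon>) \<longrightarrow> cmod (F (overwrite I z p)) \<le> B)"
    if x: "x \<in> K" for x
  proof -
    have "x n \<in> S n" if "n \<in> I" for n using x that by (auto simp: K_def PiE_iff split: if_splits)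
    then have "overwrite I x p \<in> PiE J S"
      using p I by (auto simp: overwrite_def PiE_iff extensional_def)
    then obtain \<epsilon> a where \<epsilon>: "\<epsilon> > 0" and sum: "\<And>h. \<forall>n\<in>I. cmod (h n) < \<epsilon> \<Longrightarrow>
        ((\<lambda>\<nu>. a \<nu> * (\<Prod>n\<in>I. h n ^ \<nu> n)) has_sum
           F (\<lambda>n. if n \<in> I then overwrite I x p n + h n else overwrite I x p n)) (PiE I (\<lambda>_. UNIV))"
      using F I unfolding analytic_on_prod_def by meson
    obtain B where B: "\<And>h. \<forall>n\<in>I. cmod (h n) < \<epsilon> / 2 \<Longrightarrow>
        cmod (F (\<lambda>n. if n \<in> I then overwrite I x p n + h n else overwrite I x p n)) \<le> B"
      using has_sum_polydisc_bound[OF I(1) \<epsilon> sum] by metis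
    have "cmod (F (overwrite I z p)) \<le> B" if z: "\<forall>n\<in>I. dist (x n) (z n) < \<epsilon> / 2" for z
    proof -
      have "(\<lambda>n. if n \<in> I then overwrite I x p n + (z n - x n) else overwrite I x p n) = overwrite I z p"
        by (auto simp: overwrite_def)
      then show ?thesis
        using B[of "\<lambda>n. z n - x n"] z by (simp add: dist_norm norm_minus_commute)
    qed
    then show ?thesis using \<epsilon> by (intro exI[of _ "\<epsilon> / 2"] exI[of _ B]) auto
  qed
  then obtain \<epsilon> B where \<epsilon>: "\<And>x. x \<in> K \<Longrightarrow> \<epsilon> x > 0"
    and B: "\<And>x z. x \<in> K \<Longrightarrow> \<forall>n\<in>I. dist (x n) (z n) < \<epsilon> x \<Longrightarrow> cmod (F (overwrite I z p)) \<le> B x"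
    by metis
  define U where "U x = (\<Inter>n\<in>I. (\<lambda>z. z n) -` ball (x n) (\<epsilon> x))" for x
  have open_U: "open (U x)" for x
    unfolding U_def using I(1)
    by (intro open_INT ballI open_vimage open_ball) (auto intro: continuous_on_product_coordinates)
  have "K \<subseteq> (\<Union>x\<in>K. U x)" using \<epsilon> by (auto simp: U_def)
  then obtain K' where K': "K' \<subseteq> K" "finite K'" "K \<subseteq> (\<Union>x\<in>K'. U x)"
    using compactE_image[OF K, of K U] open_U by metis
  show ?thesis
  proof (intro exI[of _ "\<Sum>x\<in>K'. \<bar>B x\<bar>"] allI impI)
    fix z assume z: "\<forall>n\<in>I. z n \<in> S n"
    define z' where "z' n = (if n \<in> I then z n else 0)" for n
    have "z' \<in> K" using z by (auto simp: K_def z'_def PiE_iff)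
    then obtain x where x: "x \<in> K'" "z' \<in> U x" using K'(3) by blast
    then have "cmod (F (overwrite I z' p)) \<le> B x"
      using K'(1) by (intro B) (auto simp: U_def)
    also have "\<dots> \<le> \<bar>B x\<bar>" by simp
    also have "\<dots> \<le> (\<Sum>x\<in>K'. \<bar>B x\<bar>)" using x(1) K'(2) by (intro member_le_sum) auto
    also have "overwrite I z' p = overwrite I z p" by (auto simp: overwrite_def z'_def)
    finally show "cmod (F (overwrite I z p)) \<le> (\<Sum>x\<in>K'. \<bar>B x\<bar>)" .
  qed
qed

lemma analytic_on_prod_slice:
  assumes F: "analytic_on_prod J S F" and n: "n \<in> J" and T: "open T" "T \<subseteq> S n" and p: "p \<in> PiE J S"
  shows "(\<lambda>w. F (p(n := w))) holomorphic_on T"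
proof (rule analytic_imp_holomorphic, unfold analytic_on_def, intro ballI)
  fix w0 assume w0: "w0 \<in> T"
  have "p(n := w0) \<in> PiE J S" using p n w0 T by (auto simp: PiE_iff extensional_def)
  moreover have "finite {n}" "{n} \<subseteq> J" using n by auto
  ultimately obtain \<epsilon> a where \<epsilon>: "\<epsilon> > 0" and sum: "\<And>h. \<forall>k\<in>{n}. cmod (h k) < \<epsilon> \<Longrightarrow>
      ((\<lambda>\<nu>. a \<nu> * (\<Prod>k\<in>{n}. h k ^ \<nu> k)) has_sum
         F (\<lambda>k. if k \<in> {n} then (p(n := w0)) k + h k else (p(n := w0)) k)) (PiE {n} (\<lambda>_. UNIV))"
    using F unfolding analytic_on_prod_def by meson
  define e where "e j = (\<lambda>k\<in>{n}. j :: nat)" for j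
  have e: "inj e" "e ` UNIV = PiE {n} (\<lambda>_. UNIV)"
  proof -
    show "inj e" by (rule injI) (metis e_def restrict_apply' singletonI)
    show "e ` UNIV = PiE {n} (\<lambda>_. UNIV)"
    proof (intro equalityI subsetI)
      fix \<nu> :: "nat \<Rightarrow> nat" assume "\<nu> \<in> PiE {n} (\<lambda>_. UNIV)"
      then have "\<nu> = e (\<nu> n)" by (auto simp: e_def PiE_iff extensional_def fun_eq_iff)
      then show "\<nu> \<in> e ` UNIV" by blast
    qed (auto simp: e_def split: if_splits)
  qed
  have "(\<lambda>w. F (p(n := w))) holomorphic_on ball w0 \<epsilon>"
  proof (rule power_series_holomorphic[where a = "\<lambda>j. a (e j)"])
    fix w assume w: "w \<in> ball w0 \<epsilon>"
    have pt: "(\<lambda>k. if k \<in> {n} then (p(n := w0)) k + (w - w0) else (p(n := w0)) k) = p(n := w)" by auto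
    have "((\<lambda>\<nu>. a \<nu> * (\<Prod>k\<in>{n}. (w - w0) ^ \<nu> k)) has_sum F (p(n := w))) (e ` UNIV)"
      using sum[of "\<lambda>_. w - w0"] w unfolding e pt by (simp add: dist_norm norm_minus_commute)
    then have "((\<lambda>j. a (e j) * (w - w0) ^ j) has_sum F (p(n := w))) UNIV"
      unfolding has_sum_reindex[OF e(1)] by (simp add: comp_def e_def)
    then show "(\<lambda>j. a (e j) * (w - w0) ^ j) sums F (p(n := w))" by (rule has_sum_imp_sums)
  qed
  then show "\<exists>\<epsilon>>0. (\<lambda>w. F (p(n := w))) holomorphic_on ball w0 \<epsilon>" using \<epsilon> by blast
qed

lemma anchored_eq_overwrite:
  "anchored m \<psi> f z = f (overwrite {1..m} z (restrict \<psi> {1..}))"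
  unfolding anchored_def by (rule arg_cong[of _ _ f]) (auto simp: overwrite_def)

lemma admissible_anchored:
  fixes m :: nat
  assumes F: "analytic_on_prod {1..} (\<lambda>n. \<Sigma>_nbhd (\<tau> n)) F" and \<tau>: "\<forall>n\<ge>1. \<tau> n > 0"
    and anchor: "anchor \<in> PiE {1..} (\<lambda>_. \<Gamma>)"
  defines "G \<equiv> anchored m (\<lambda>n. complex_of_real (anchor n)) F"
  shows "admissible {1..m} \<tau> (sup_norm m \<tau> G) G" "sup_norm m \<tau> G \<ge> 0"
proof -
  define p where "p = restrict (\<lambda>n. complex_of_real (anchor n)) {1..}"
  have p: "p \<in> PiE {1..} (\<lambda>n. \<Sigma>_nbhd (\<tau> n))"
    using anchor \<tau> by (auto simp: p_def intro!: real_in_nbhd)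
  have G: "G z = F (overwrite {1..m} z p)" for z by (simp add: G_def anchored_eq_overwrite p_def)
  obtain B where B: "\<And>z. \<forall>n\<in>{1..m}. z n \<in> \<Sigma>_nbhd (\<tau> n) \<Longrightarrow> cmod (G z) \<le> B"
    using analytic_on_prod_bounded[OF F _ _ compact_nbhd p, of "{1..m}"] by (auto simp: G)
  have bdd: "bdd_above ((\<lambda>z. cmod (G z)) ` PiE {1..m} (\<lambda>n. \<Sigma>_nbhd (\<tau> n)))"
    using B by (intro bdd_aboveI2[of _ _ B]) (auto simp: PiE_iff)
  have bound: "cmod (G z) \<le> sup_norm m \<tau> G" if z: "\<forall>n\<in>{1..m}. z n \<in> \<Sigma>_nbhd (\<tau> n)" for z
  proof -
    have "cmod (G (restrict z {1..m})) \<le> sup_norm m \<tau> G"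
      unfolding sup_norm_def using z by (intro cSUP_upper bdd) auto
    moreover have "overwrite {1..m} (restrict z {1..m}) p = overwrite {1..m} z p" by (auto simp: overwrite_def)
    ultimately show ?thesis by (simp add: G)
  qed
  have "0 \<in> \<Sigma>_nbhd (\<tau> n)" if "n \<in> {1..m}" for n
    using real_in_nbhd[of "\<tau> n" 0] \<tau> that by auto
  then have "cmod (G (\<lambda>_. 0)) \<le> sup_norm m \<tau> G" by (intro bound) auto
  then show "sup_norm m \<tau> G \<ge> 0" using norm_ge_zero order_trans by blast
  show "admissible {1..m} \<tau> (sup_norm m \<tau> G) G"
    unfolding admissible_def
  proof (intro allI impI conjI ballI)
    fix z assume z: "\<forall>n\<in>{1..m}. z n \<in> tube (\<tau> n)"
    then have z': "\<forall>n\<in>{1..m}. z n \<in> \<Sigma>_nbhd (\<tau> n)" using tube_subset_nbhd by blast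
    then show "cmod (G z) \<le> sup_norm m \<tau> G" by (rule bound)
    fix n assume n: "n \<in> {1..m}"
    have "overwrite {1..m} z p \<in> PiE {1..} (\<lambda>n. \<Sigma>_nbhd (\<tau> n))"
      using z' p by (auto simp: overwrite_def PiE_iff extensional_def)
    then have "(\<lambda>w. F ((overwrite {1..m} z p)(n := w))) holomorphic_on tube (\<tau> n)"
      using n by (intro analytic_on_prod_slice[OF F _ open_tube tube_subset_nbhd]) auto
    moreover have "(overwrite {1..m} z p)(n := w) = overwrite {1..m} (z(n := w)) p" for w
      using n by (auto simp: overwrite_def)
    ultimately show "(\<lambda>w. G (z(n := w))) holomorphic_on tube (\<tau> n)" by (simp add: G)
  qed
qed

section \<open>Infinite products and the constants c(delta)\<close>

lemma convergent_prod_shifted: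
  assumes "summable \<psi>" "\<And>n. \<psi> n \<ge> (0 :: real)"
  shows "convergent_prod (\<lambda>n. real q * \<psi> n + 1)"
proof (rule abs_convergent_prod_imp_convergent_prod, rule summable_imp_abs_convergent_prod)
  show "summable (\<lambda>n. norm (real q * \<psi> n + 1 - 1))"
    using assms by (simp add: abs_mult summable_mult)
qed

text \<open>Sequences here start at index 1 with unconditional summation, while series and infinite
  products start at 0; for nonnegative terms both notions agree after a shift.\<close>

lemma summable_on_shift:
  fixes \<psi> :: "nat \<Rightarrow> real"
  assumes "\<And>n. n \<ge> 1 \<Longrightarrow> \<psi> n \<ge> 0"
  shows "\<psi> summable_on {1..} \<longleftrightarrow> summable (\<lambda>n. \<psi> (Suc n))"
proof -
  have "{1..} = range Suc" by (auto simp: image_iff) (metis Suc_pred' not_less_eq_eq not_gr0 le_zero_eq)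
  then have "\<psi> summable_on {1..} \<longleftrightarrow> (\<lambda>n. \<psi> (Suc n)) summable_on UNIV"
    using summable_on_reindex[of Suc UNIV \<psi>] by (simp add: comp_def)
  also have "\<dots> \<longleftrightarrow> summable (\<lambda>n. \<psi> (Suc n))"
    using assms by (intro summable_on_UNIV_nonneg_real_iff) auto
  finally show ?thesis .
qed

text \<open>A tail with sum below delta/2 costs at most exp (delta q / 2). The finitely many factors
  before it are linear in q, and each is bounded by a constant times exp (e q), via 1 + q phi <= (1
  + phi/e) (1 + e q).\<close>

lemma product_estimate_exists:
  assumes pos: "\<forall>n\<ge>1. \<psi> n > (0 :: real)" and sum: "\<psi> summable_on {1..}" and \<delta>: "\<delta> > 0"
  shows "\<exists>C. product_estimate \<psi> \<delta> C"
proof -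
  define \<phi> where "\<phi> n = \<psi> (Suc n)" for n
  have \<phi>: "\<phi> n > 0" for n using pos by (simp add: \<phi>_def)
  have summ: "summable \<phi>"
    unfolding \<phi>_def using summable_on_shift[of \<psi>] pos sum by (auto simp: less_imp_le)
  obtain N where N: "(\<Sum>n. \<phi> (n + N)) < \<delta> / 2"
    using order_tendstoD(2)[OF suminf_exist_split2[OF summ], of "\<delta> / 2"] \<delta>
    by (auto simp: eventually_sequentially)
  \<comment> \<open>The other half of delta is shared by the first N factors; \<open>Suc N\<close>
    avoids a division by zero for N = 0.\<close>
  define e where "e = \<delta> / (2 * real (Suc N))"
  have e: "e > 0" using \<delta> by (simp add: e_def)
  define D where "D = (\<Prod>n<N. 1 + \<phi> n / e)"
  have D: "D > 0" unfolding D_def using \<phi> e by (intro prod_pos) (auto intro!: add_pos_pos)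
  have partial: "(\<Prod>n<N + k. real q * \<phi> n + 1) \<le> D * exp (\<delta> * real q)" for q k
  proof -
    have "(\<Prod>n<N. real q * \<phi> n + 1) \<le> (\<Prod>n<N. (1 + \<phi> n / e) * exp (e * real q))"
    proof (rule prod_mono, intro conjI)
      fix n
      show "0 \<le> real q * \<phi> n + 1" using \<phi>[of n] by simp
      have "real q * \<phi> n + 1 \<le> (1 + \<phi> n / e) * (1 + e * real q)"
        using e \<phi>[of n] by (simp add: field_simps)
      also have "\<dots> \<le> (1 + \<phi> n / e) * exp (e * real q)"
        using e \<phi>[of n] exp_ge_add_one_self[of "e * real q"] by (intro mult_left_mono) auto
      finally show "real q * \<phi> n + 1 \<le> (1 + \<phi> n / e) * exp (e * real q)" .
    qed
    also have "\<dots> = D * exp (e * real q * real N)"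
      by (simp add: prod.distrib D_def exp_of_nat_mult[symmetric] mult.commute)
    also have "\<dots> \<le> D * exp (\<delta> / 2 * real q)"
    proof -
      have "e * real N \<le> \<delta> / 2" using \<delta> by (simp add: e_def field_simps)
      then have "e * real N * real q \<le> \<delta> / 2 * real q" by (rule mult_right_mono) simp
      then show ?thesis using D by (simp add: mult_ac)
    qed
    finally have low: "(\<Prod>n<N. real q * \<phi> n + 1) \<le> D * exp (\<delta> / 2 * real q)" .
    have "(\<Prod>n<k. real q * \<phi> (n + N) + 1) \<le> (\<Prod>n<k. exp (real q * \<phi> (n + N)))"
      using \<phi> exp_ge_add_one_self by (intro prod_mono) (auto simp: add.commute less_imp_le intro!: add_nonneg_nonneg)
    also have "\<dots> = exp (real q * (\<Sum>n<k. \<phi> (n + N)))" by (simp add: exp_sum sum_distrib_left)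
    also have "\<dots> \<le> exp (real q * (\<delta> / 2))"
    proof -
      have "(\<Sum>n<k. \<phi> (n + N)) \<le> (\<Sum>n. \<phi> (n + N))"
        using \<phi> summ by (intro sum_le_suminf) (auto simp: less_imp_le summable_iff_shift)
      then have "(\<Sum>n<k. \<phi> (n + N)) \<le> \<delta> / 2" using N by linarith
      then have "real q * (\<Sum>n<k. \<phi> (n + N)) \<le> real q * (\<delta> / 2)" by (rule mult_left_mono) simp
      then show ?thesis by simp
    qed
    finally have high: "(\<Prod>n<k. real q * \<phi> (n + N) + 1) \<le> exp (\<delta> / 2 * real q)" by (simp add: mult.commute)
    have "(\<Prod>n<N + k. real q * \<phi> n + 1) = (\<Prod>n<N. real q * \<phi> n + 1) * (\<Prod>n<k. real q * \<phi> (n + N) + 1)"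
      by (induction k) (simp_all add: mult.assoc add.commute)
    also have "\<dots> \<le> (D * exp (\<delta> / 2 * real q)) * exp (\<delta> / 2 * real q)"
      using \<phi> D by (intro mult_mono low high prod_nonneg) (auto simp: less_imp_le)
    also have "\<dots> = D * exp (\<delta> * real q)" by (simp add: mult.assoc exp_add[symmetric])
    finally show ?thesis .
  qed
  have "(\<Prod>n. real q * \<phi> n + 1) \<le> D * exp (\<delta> * real q)" for q
  proof (rule prodinf_le_const[where N = N])
    show "convergent_prod (\<lambda>n. real q * \<phi> n + 1)"
      using summ \<phi> by (intro convergent_prod_shifted) (auto simp: less_imp_le)
    fix n assume "N \<le> n"
    then show "(\<Prod>n<n. real q * \<phi> n + 1) \<le> D * exp (\<delta> * real q)"
      using partial[of q "n - N"] by simp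
  qed
  then show ?thesis unfolding product_estimate_def \<phi>_def by blast
qed

lemma product_estimate_finite:
  assumes pos: "\<forall>n\<ge>1. \<psi> n > (0 :: real)" and sum: "\<psi> summable_on {1..}" and C: "product_estimate \<psi> \<delta> C" and q: "q \<ge> 1"
  shows "(\<Prod>k=1..m. 1 + real q * \<psi> k) \<le> C * exp (\<delta> * real q)"
proof -
  have "(\<Prod>k=1..m. 1 + real q * \<psi> k) = (\<Prod>n<m. real q * \<psi> (Suc n) + 1)"
    by (rule prod.reindex_bij_witness[where i = Suc and j = "\<lambda>k. k - 1"]) auto
  also have "\<dots> \<le> (\<Prod>n. real q * \<psi> (Suc n) + 1)"
  proof (rule prod_le_prodinf)
    show "(\<lambda>n. real q * \<psi> (Suc n) + 1) has_prod (\<Prod>n. real q * \<psi> (Suc n) + 1)"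
      using summable_on_shift[of \<psi>] pos sum
      by (intro convergent_prod_has_prod convergent_prod_shifted) (auto simp: less_imp_le)
  qed (use pos in \<open>auto simp: less_imp_le\<close>)
  also have "\<dots> \<le> C * exp (\<delta> * real q)" using C q by (simp add: product_estimate_def)
  finally show ?thesis .
qed

text \<open>Here c is the minimum of 2/tau and (43/5) w/tau. The latter is at least (43/5)/kappa
  because tau <= w kappa, so c always dominates one of the two rates of
  \<open>quad_diff_bound\<close>.\<close>

lemma weight_estimates:
  assumes \<tau>: "\<tau> n > 0"
  defines "p \<equiv> min (1 / weight \<tau> n) (43 / 10)" and "c \<equiv> 1 / \<tau> n * (2 * weight \<tau> n) * min (1 / weight \<tau> n) (43 / 10)"
  shows "weight \<tau> n > 0" "0 \<le> p" "p \<le> 1 / \<tau> n + 1 / 3" "0 \<le> c" "2 / \<tau> n \<le> c \<or> 43 / 5 / kappa \<tau> n \<le> c"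
proof -
  define t where "t = \<tau> n"
  have t: "t > 0" using \<tau> by (simp add: t_def)
  have low: "3 * t / (3 + t) \<le> weight \<tau> n"
    using ln_radius_lower[OF t] by (simp add: weight_def kappa_def t_def)
  have "0 < 3 * t / (3 + t)" using t by simp
  then show w: "weight \<tau> n > 0" using low by linarith
  then show "0 \<le> p" "0 \<le> c" using \<tau> by (auto simp: p_def c_def)
  have "1 / weight \<tau> n \<le> 1 / (3 * t / (3 + t))" using low t by (intro divide_left_mono mult_pos_pos w) auto
  also have "\<dots> = 1 / t + 1 / 3" using t by (simp add: field_simps)
  finally show "p \<le> 1 / \<tau> n + 1 / 3" by (simp add: p_def t_def)
  show "2 / \<tau> n \<le> c \<or> 43 / 5 / kappa \<tau> n \<le> c"
  proof (cases "1 / weight \<tau> n \<le> 43 / 10")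
    case True
    then show ?thesis using w by (simp add: c_def min_def)
  next
    case False
    have \<kappa>: "kappa \<tau> n \<ge> 1 + t" by (simp add: kappa_def t_def)
    have "t * (3 + t) \<le> 3 * t * (1 + t)" using t by (simp add: algebra_simps)
    then have "t \<le> 3 * t / (3 + t) * (1 + t)" using t by (simp add: pos_le_divide_eq)
    also have "\<dots> \<le> weight \<tau> n * kappa \<tau> n" using low \<kappa> t w by (intro mult_mono) auto
    finally have "1 / kappa \<tau> n \<le> weight \<tau> n / t" using \<kappa> t by (simp add: field_simps)
    then have "43 / 5 * (1 / kappa \<tau> n) \<le> 43 / 5 * (weight \<tau> n / t)" by (rule mult_left_mono) simp
    then show ?thesis using False by (simp add: c_def min_def t_def field_simps)
  qed
qed

text \<open>The points that agree with the anchor beyond m form a null set, on which integrability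
  of f says nothing. Only measurability is taken from f; the sections are integrable because the
  extension bounds them.\<close>

lemma anchored_measurable:
  fixes f :: "(nat \<Rightarrow> real) \<Rightarrow> real"
  assumes f: "f \<in> borel_measurable (PiM {1..} (\<lambda>_. \<Gamma>_measure))" and anchor: "anchor \<in> PiE {1..} (\<lambda>_. \<Gamma>)"
    and y: "\<forall>n\<in>{1..m}. y n \<in> \<Gamma>" and k: "k \<le> m"
  shows "(\<lambda>x. anchored m anchor f (overwrite {1..k} x y)) \<in> borel_measurable (PiM {1..k} (\<lambda>_. \<Gamma>_measure))"
  unfolding anchored_def
proof (rule measurable_compose[OF _ f], rule measurable_restrict)
  fix n :: nat assume n: "n \<in> {1..}"
  show "(\<lambda>x. if n \<le> m then overwrite {1..k} x y n else anchor n) \<in> PiM {1..k} (\<lambda>_. \<Gamma>_measure) \<rightarrow>\<^sub>M \<Gamma>_measure"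
  proof (cases "n \<in> {1..k}")
    case True
    then show ?thesis using k by (simp add: overwrite_def measurable_component_singleton)
  next
    case False
    have "(if n \<le> m then y n else anchor n) \<in> space \<Gamma>_measure"
      using y anchor n by (auto simp: PiE_iff)
    moreover have "(\<lambda>x. if n \<le> m then overwrite {1..k} x y n else anchor n) = (\<lambda>_. if n \<le> m then y n else anchor n)"
      using False by (auto simp: overwrite_def)
    ultimately show ?thesis by (simp only: measurable_const)
  qed
qed

text \<open>With L and P the sum and the product up to n, the next term 4 x P (1 + q L) is at most
  the increment of 4 L P, from which it differs by 4 q x^2 P.\<close>

lemma level_sum_telescope:
  fixes x b :: "nat \<Rightarrow> real"
  assumes x: "\<And>n. n \<in> {1..m} \<Longrightarrow> x n > 0" and q: "q \<ge> 0"
    and b: "\<And>n. n < m \<Longrightarrow> b n \<le> 2 * ((\<Prod>k=1..n. 1 + q * x k) * (1 + q * (\<Sum>k=1..n. x k)))"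
  shows "(\<Sum>n=1..m. 2 * x n * b (n - 1)) \<le> 4 * (\<Sum>k=1..m. x k) * (\<Prod>k=1..m. 1 + q * x k)"
  using assms
proof (induction m)
  case (Suc m)
  define P L where "P = (\<Prod>k=1..m. 1 + q * x k)" and "L = (\<Sum>k=1..m. x k)"
  have P: "P \<ge> 0" unfolding P_def using Suc.prems by (intro prod_nonneg) (auto simp: less_imp_le intro!: add_nonneg_nonneg)
  have xm: "x (Suc m) > 0" using Suc.prems by auto
  have "2 * x (Suc m) * b m \<le> 2 * x (Suc m) * (2 * (P * (1 + q * L)))"
    unfolding P_def L_def using Suc.prems by (intro mult_left_mono) (auto simp: less_imp_le)
  moreover have "(\<Sum>n=1..m. 2 * x n * b (n - 1)) \<le> 4 * L * P"
    unfolding P_def L_def using Suc by auto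
  moreover have "4 * (L + x (Suc m)) * (P * (1 + q * x (Suc m)))
      = 4 * L * P + 2 * x (Suc m) * (2 * (P * (1 + q * L))) + 4 * (P * (q * (x (Suc m))\<^sup>2))"
    by (simp add: algebra_simps power2_eq_square)
  moreover have "0 \<le> 4 * (P * (q * (x (Suc m))\<^sup>2))" using P Suc.prems(2) by simp
  moreover have "(\<Sum>n=1..Suc m. 2 * x n * b (n - 1)) = (\<Sum>n=1..m. 2 * x n * b (n - 1)) + 2 * x (Suc m) * b m"
    "(\<Sum>k=1..Suc m. x k) = L + x (Suc m)" "(\<Prod>k=1..Suc m. 1 + q * x k) = P * (1 + q * x (Suc m))"
    by (simp_all add: P_def L_def mult.commute)
  ultimately show ?case by (simp only: mult.assoc)
qed simp

lemma index_set_0: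
  assumes "\<And>n. n \<in> {1..m} \<Longrightarrow> w n > 0"
  shows "index_set w 0 m = {\<lambda>n\<in>{1..m}. 0}"
proof (intro equalityI subsetI)
  fix \<alpha> assume \<alpha>: "\<alpha> \<in> index_set w 0 m"
  have "\<alpha> n = 0" if "n \<in> {1..m}" for n
  proof -
    have "real (\<alpha> n) * w n \<le> 0" using index_set_bound[OF assms \<alpha> that] by simp
    then show ?thesis using assms[OF that] by (simp add: mult_le_0_iff)
  qed
  then show "\<alpha> \<in> {\<lambda>n\<in>{1..m}. 0}"
    using \<alpha> by (auto simp: index_set_def PiE_iff extensional_def fun_eq_iff)
qed (auto simp: index_set_def)

lemma sparse_grid_error:
  fixes f :: "(nat \<Rightarrow> real) \<Rightarrow> real" and F :: "(nat \<Rightarrow> complex) \<Rightarrow> complex" and m :: nat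
  assumes f: "f \<in> borel_measurable (PiM {1..} (\<lambda>_. \<Gamma>_measure))"
    and anchor: "anchor \<in> PiE {1..} (\<lambda>_. \<Gamma>)" and \<tau>: "\<forall>n\<ge>1. \<tau> n > 0"
    and ext: "analytic_extension f \<tau> F"
  defines "G \<equiv> anchored m (\<lambda>n. complex_of_real (anchor n)) F"
  shows "\<bar>integral_m m (anchored m anchor f) - sparse_grid (weight \<tau>) q m (anchored m anchor f)\<bar>
     \<le> 4 * (\<Sum>k=1..m. 1 / \<tau> k) * (\<Prod>k=1..m. 1 + real q * (1 / \<tau> k)) * exp (- real q) * sup_norm m \<tau> G"
proof -
  define g where "g = anchored m anchor f"
  define w where "w = weight \<tau>"
  define p where "p n = min (1 / w n) (43 / 10)" for n
  define c where "c n = 1 / \<tau> n * (2 * w n) * p n" for n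
  define b where "b n = (\<Sum>\<alpha>\<in>index_set w q n. \<Prod>i=1..n. level_factor c i (\<alpha> i))" for n
  have pos: "\<tau> n > 0" if "n \<in> {1..m}" for n using \<tau> that by auto
  have est: "w n > 0" "0 \<le> p n" "p n \<le> 1 / \<tau> n + 1 / 3" "0 \<le> c n" "2 / \<tau> n \<le> c n \<or> 43 / 5 / kappa \<tau> n \<le> c n"
    if "n \<in> {1..m}" for n
    using weight_estimates[where n = n and \<tau> = \<tau>, OF pos[OF that]] by (auto simp: w_def p_def c_def)
  have adm: "admissible {1..m} \<tau> (sup_norm m \<tau> G) G" "sup_norm m \<tau> G \<ge> 0"
    using admissible_anchored[OF _ \<tau> anchor] ext by (auto simp: G_def analytic_extension_def)
  have real: "G (\<lambda>n. of_real (y n)) = of_real (g y)" if y: "\<forall>n\<in>{1..m}. y n \<in> \<Gamma>" for y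
  proof -
    define v where "v = restrict (\<lambda>n. if n \<le> m then y n else anchor n) {1..}"
    have "v \<in> PiE {1..} (\<lambda>_. \<Gamma>)" using y anchor by (auto simp: v_def PiE_iff)
    then have "F (restrict (\<lambda>n. complex_of_real (v n)) {1..}) = of_real (f v)"
      using ext by (simp add: analytic_extension_def)
    moreover have "restrict (\<lambda>n. complex_of_real (v n)) {1..}
        = restrict (\<lambda>n. if n \<le> m then complex_of_real (y n) else of_real (anchor n)) {1..}"
      by (auto simp: v_def)
    ultimately show ?thesis by (simp add: G_def g_def anchored_def v_def)
  qed
  \<comment> \<open>Once all m coordinates are overwritten, \<open>anchored\<close> reads nothing of
    the base point, so 0 can be used there.\<close>
  have g_overwrite: "g (overwrite {1..m} x (\<lambda>_. 0)) = g x" for x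
    unfolding g_def anchored_eq_overwrite by (rule arg_cong[of _ _ f]) (auto simp: overwrite_def)
  have "\<bar>block_error w q m g (\<lambda>_. 0)\<bar>
      \<le> (\<Sum>n=1..m. 2 / \<tau> n * (\<Sum>\<alpha>\<in>index_set w q (n - 1). \<Prod>i=1..n - 1. level_factor c i (\<alpha> i))) * exp (- real q) * sup_norm m \<tau> G"
    unfolding w_def
  proof (rule block_error_bound[OF adm(1) real _ pos est(5) est(4)])
    fix k and y :: "nat \<Rightarrow> real" assume "k \<le> m" "\<forall>n\<in>{1..m}. y n \<in> \<Gamma>"
    then show "(\<lambda>x. g (overwrite {1..k} x y)) \<in> borel_measurable (PiM {1..k} (\<lambda>_. \<Gamma>_measure))"
      unfolding g_def by (intro anchored_measurable[OF f anchor])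
  qed auto
  also have "block_error w q m g (\<lambda>_. 0) = integral_m m g - sparse_grid w q m g"
    by (simp only: block_error_def integral_m_def sparse_grid_def tensor_Quad_diff g_overwrite)
  finally have err: "\<bar>integral_m m g - sparse_grid w q m g\<bar> \<le> (\<Sum>n=1..m. 2 * (1 / \<tau> n) * b (n - 1)) * exp (- real q) * sup_norm m \<tau> G"
    by (simp add: b_def)
  have "(\<Sum>n=1..m. 2 * (1 / \<tau> n) * b (n - 1)) \<le> 4 * (\<Sum>k=1..m. 1 / \<tau> k) * (\<Prod>k=1..m. 1 + real q * (1 / \<tau> k))"
  proof (rule level_sum_telescope)
    fix n assume n: "n < m"
    then have sub: "k \<in> {1..m}" if "k \<in> {1..n}" for k using that by auto
    show "b n \<le> 2 * ((\<Prod>k=1..n. 1 + real q * (1 / \<tau> k)) * (1 + real q * (\<Sum>k=1..n. 1 / \<tau> k)))"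
    \<comment> \<open>The counting bound assumes q \<ge> 1. At level 0 only the zero multi-index is
      left, and its factor is 1.\<close>
    proof (cases "q = 0")
      case True
      have "index_set w q n = {\<lambda>n\<in>{1..n}. 0}"
        unfolding True using est(1) sub by (intro index_set_0) auto
      moreover have "(\<Prod>i=1..n. level_factor c i ((\<lambda>n\<in>{1..n}. 0) i)) = 1"
        by (intro prod.neutral) (auto simp: level_factor_def)
      ultimately have "b n = 1" by (simp add: b_def)
      then show ?thesis by (simp add: True)
    next
      case False
      then show ?thesis
        unfolding b_def using est pos sub
        by (intro sum_level_factor_bound[where p = p]) (auto simp: c_def p_def)
    qed
  qed (use pos in auto)
  then have "(\<Sum>n=1..m. 2 * (1 / \<tau> n) * b (n - 1)) * exp (- real q) * sup_norm m \<tau> G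
      \<le> 4 * (\<Sum>k=1..m. 1 / \<tau> k) * (\<Prod>k=1..m. 1 + real q * (1 / \<tau> k)) * exp (- real q) * sup_norm m \<tau> G"
    using adm(2) by (intro mult_right_mono) auto
  with err show ?thesis unfolding g_def w_def by linarith
qed

text \<open>The first factor alone gives 1 + q psi_1 <= C(delta) exp (delta q). For delta < 1/q the
  exponential is at most exp 1, so C(delta) is at least (1 + q psi_1) / exp 1, with q
  arbitrary.\<close>

lemma product_estimate_blowup:
  assumes pos: "\<forall>n\<ge>1. \<psi> n > (0 :: real)" and sum: "\<psi> summable_on {1..}"
    and C: "\<forall>\<delta>>0. product_estimate \<psi> \<delta> (C \<delta>)"
  shows "filterlim C at_top (at_right 0)"
proof (subst filterlim_at_top, intro allI)
  fix Z :: real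
  obtain q0 :: nat where q0: "\<bar>Z\<bar> * exp 1 / \<psi> 1 < real q0" using reals_Archimedean2 by blast
  define q where "q = Suc q0"
  have "\<psi> 1 > 0" using pos by simp
  have "\<bar>Z\<bar> * exp 1 < real q0 * \<psi> 1" using q0 \<open>\<psi> 1 > 0\<close> by (simp add: pos_divide_less_eq)
  also have "\<dots> \<le> 1 + real q * \<psi> 1" using \<open>\<psi> 1 > 0\<close> by (simp add: q_def algebra_simps)
  finally have q: "\<bar>Z\<bar> * exp 1 \<le> 1 + real q * \<psi> 1" by simp
  have "\<forall>\<^sub>F \<delta> in at_right 0. \<delta> \<in> {0<..<1 / real q}"
    by (rule eventually_at_right_real) (simp add: q_def)
  then show "\<forall>\<^sub>F \<delta> in at_right 0. Z \<le> C \<delta>"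
  proof (rule eventually_mono)
    fix \<delta> :: real assume \<delta>: "\<delta> \<in> {0<..<1 / real q}"
    have "product_estimate \<psi> \<delta> (C \<delta>)" using C \<delta> by simp
    from product_estimate_finite[OF pos sum this, of q 1]
    have le: "1 + real q * \<psi> 1 \<le> C \<delta> * exp (\<delta> * real q)" by (simp add: q_def)
    have "0 < 1 + real q * \<psi> 1" using \<open>\<psi> 1 > 0\<close> by (simp add: add_pos_nonneg)
    then have "C \<delta> > 0" using le by (metis exp_gt_zero less_le_trans zero_less_mult_pos2)
    have "\<delta> * real q \<le> 1" using \<delta> by (simp add: q_def field_simps)
    then have "C \<delta> * exp (\<delta> * real q) \<le> C \<delta> * exp 1" using \<open>C \<delta> > 0\<close> by simp
    then have "\<bar>Z\<bar> * exp 1 \<le> C \<delta> * exp 1" using q le by linarith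
    then show "Z \<le> C \<delta>" by simp
  qed
qed

text \<open>An admissible constant is constrained through q \<ge> 1 only and could be less than 1
  for large delta. Level q = 0 is therefore covered for C \<ge> 1, and the existence of such a
  constant is asserted separately.\<close>

theorem lemma4p3:
  fixes f :: "(nat \<Rightarrow> real) \<Rightarrow> real"
    and F :: "(nat \<Rightarrow> complex) \<Rightarrow> complex"
    and \<tau> anchor :: "nat \<Rightarrow> real"
    and c r :: real
  assumes f_integrable: "integrable (PiM {1..} (\<lambda>_. \<Gamma>_measure)) f"
    and anchor: "anchor \<in> PiE {1..} (\<lambda>_. \<Gamma>)"
    and isotone: "mono_on {1..} \<tau>"
    and tau_pos: "\<forall>n\<ge>1. \<tau> n > 0"
    and tau_lim: "filterlim \<tau> at_top sequentially"
    and rc: "r > 1" "c > 0"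
    and tau_growth: "\<forall>n\<ge>1. \<tau> n \<ge> c * real n powr r"
    and analytic: "analytic_extension f \<tau> F"
  shows "(\<lambda>n. 1 / \<tau> n) summable_on {1..} \<and>
         (\<forall>\<psi> \<delta>. (\<forall>n\<ge>1. \<psi> n > 0) \<and> \<psi> summable_on {1..} \<and> \<delta> > 0 \<longrightarrow>
           (\<exists>C. product_estimate \<psi> \<delta> C)) \<and>
         (\<forall>\<delta>>0.
           (\<exists>C\<ge>1. product_estimate (\<lambda>n. 1 / \<tau> n) \<delta> C) \<and>
           (\<forall>C. product_estimate (\<lambda>n. 1 / \<tau> n) \<delta> C \<longrightarrow>
              (\<forall>m\<ge>1. \<forall>q::nat. q \<ge> 1 \<or> C \<ge> 1 \<longrightarrow>
                 \<bar>integral_m m (anchored m anchor f) -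
                   sparse_grid (weight \<tau>) q m (anchored m anchor f)\<bar>
                 \<le> (4 * C * l1_norm (\<lambda>n. 1 / \<tau> n)) * exp (- real q * (1 - \<delta>)) *
                     sup_norm m \<tau> (anchored m (\<lambda>n. complex_of_real (anchor n)) F)))) \<and>
         (\<forall>C. (\<forall>\<delta>>0. product_estimate (\<lambda>n. 1 / \<tau> n) \<delta> (C \<delta>)) \<longrightarrow>
           filterlim (\<lambda>\<delta>. 4 * C \<delta> * l1_norm (\<lambda>n. 1 / \<tau> n)) at_top (at_right 0))"
proof -
  let ?M = "\<lambda>m. sup_norm m \<tau> (anchored m (\<lambda>n. complex_of_real (anchor n)) F)"
  define x where "x = (\<lambda>n. 1 / \<tau> n)"
  have x_pos: "\<forall>n\<ge>1. x n > 0" using tau_pos by (simp add: x_def)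
  have summ: "x summable_on {1..}"
  proof -
    have "summable (\<lambda>n. real n powr (- r))" using rc(1) by (simp add: summable_real_powr_iff)
    then have "summable (\<lambda>n. 1 / c * real (Suc n) powr (- r))"
      by (intro summable_mult) (subst summable_Suc_iff)
    then have "summable (\<lambda>n. x (Suc n))"
    proof (rule summable_comparison_test')
      fix n :: nat assume "n \<ge> 0"
      have "c * real (Suc n) powr r \<le> \<tau> (Suc n)" using tau_growth[rule_format, of "Suc n"] by simp
      then have "1 / \<tau> (Suc n) \<le> 1 / (c * real (Suc n) powr r)"
        using rc tau_pos by (intro divide_left_mono mult_pos_pos) auto
      moreover have "x (Suc n) > 0" using x_pos by simp
      ultimately show "norm (x (Suc n)) \<le> 1 / c * real (Suc n) powr (- r)"
        by (simp add: x_def powr_minus_divide)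
    qed
    then show ?thesis using summable_on_shift[of x] x_pos by (auto simp: less_imp_le)
  qed
  have l1: "(\<Sum>k\<in>A. x k) \<le> l1_norm x" if "finite A" "A \<subseteq> {1..}" for A
  proof -
    have "l1_norm x = infsum x {1..}"
      unfolding l1_norm_def using x_pos by (intro infsum_cong) auto
    then show ?thesis
      using finite_sum_le_infsum[OF summ that] x_pos by (auto simp: less_imp_le)
  qed
  have l1_pos: "l1_norm x > 0" using l1[of "{1}"] x_pos by auto
  have exists: "\<exists>C\<ge>1. product_estimate x \<delta> C" if \<delta>: "\<delta> > 0" for \<delta>
  proof -
    obtain C where C: "product_estimate x \<delta> C" using product_estimate_exists[OF x_pos summ \<delta>] by blast
    have "C * exp (\<delta> * real q) \<le> max 1 C * exp (\<delta> * real q)" for q :: nat by (intro mult_right_mono) auto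
    then have "product_estimate x \<delta> (max 1 C)"
      using C unfolding product_estimate_def by (meson order_trans)
    then show ?thesis by (intro exI[of _ "max 1 C"]) auto
  qed
  have bound: "\<bar>integral_m m (anchored m anchor f) - sparse_grid (weight \<tau>) q m (anchored m anchor f)\<bar>
      \<le> (4 * C * l1_norm x) * exp (- real q * (1 - \<delta>)) * ?M m"
    if C: "product_estimate x \<delta> C" and q: "q \<ge> 1 \<or> C \<ge> 1" for \<delta> C m q
  proof -
    define P where "P = (\<Prod>k=1..m. 1 + real q * x k)"
    have M: "?M m \<ge> 0"
      using analytic by (intro admissible_anchored(2) tau_pos anchor) (simp add: analytic_extension_def)
    have P: "P \<le> C * exp (\<delta> * real q)"
    proof (cases "q = 0")
      case False
      then show ?thesis unfolding P_def by (intro product_estimate_finite[OF x_pos summ C]) simp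
    qed (use q in \<open>simp add: P_def\<close>)
    have "P \<ge> 0" unfolding P_def using x_pos by (intro prod_nonneg) (auto simp: less_imp_le)
    then have "4 * (\<Sum>k=1..m. x k) * P \<le> 4 * l1_norm x * (C * exp (\<delta> * real q))"
      using l1[of "{1..m}"] l1_pos P x_pos by (intro mult_mono) (auto intro!: sum_nonneg simp: less_imp_le)
    then have "4 * (\<Sum>k=1..m. x k) * P * exp (- real q) \<le> 4 * l1_norm x * (C * exp (\<delta> * real q)) * exp (- real q)"
      by (rule mult_right_mono) simp
    also have "\<dots> = 4 * C * l1_norm x * exp (- real q * (1 - \<delta>))"
    proof -
      have "exp (\<delta> * real q) * exp (- real q) = exp (- real q * (1 - \<delta>))"
        unfolding exp_add[symmetric] by (simp add: algebra_simps)
      then show ?thesis by (simp only: mult.assoc mult.commute mult.left_commute)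
    qed
    finally have "4 * (\<Sum>k=1..m. x k) * P * exp (- real q) * ?M m
        \<le> 4 * C * l1_norm x * exp (- real q * (1 - \<delta>)) * ?M m"
      using M by (rule mult_right_mono)
    then show ?thesis
      using sparse_grid_error[OF borel_measurable_integrable[OF f_integrable] anchor tau_pos analytic, of m q]
      unfolding P_def x_def by linarith
  qed
  have blowup: "filterlim (\<lambda>\<delta>. 4 * C \<delta> * l1_norm x) at_top (at_right 0)"
    if "\<forall>\<delta>>0. product_estimate x \<delta> (C \<delta>)" for C
  proof -
    have "filterlim (\<lambda>\<delta>. (4 * l1_norm x) * C \<delta>) at_top (at_right 0)"
      using l1_pos by (intro filterlim_tendsto_pos_mult_at_top[OF tendsto_const] product_estimate_blowup[OF x_pos summ that]) auto
    then show ?thesis by (simp add: mult_ac)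
  qed
  show ?thesis
    unfolding x_def[symmetric] using summ product_estimate_exists exists bound blowup by blast
qed

end
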